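(* The matrices $W_{f,N}^*W_{f,N}$ and $W_{p,N}^*W_{p,N}$ are almost surely asymptotically free.
   Context: $L\ge 1$ is a fixed integer, $M=M(N)$ are integers such that $c_N=ML/N\to c_*>0$ as $N\to\infty$. $(R_N)_{N\ge1}$ are $M\times M$ Hermitian positive definite matrices with $aI_M\le R_N<bI_M$ for all $N$, where $a,b>0$ do not depend on $N$. It is assumed that the empirical eigenvalue distribution $\omega_N=\frac1M\sum_{k=1}^M\delta_{\lambda_{k,N}}$ of $R_N$ converges (weakly) towards a limit distribution $\omega$. For each $N$, $y_n=R_N^{1/2}\xi_n$, $n\geq 1$, where the $\xi_n$ are independent $M$-dimensional random vectors with i.i.d. standard complex Gaussian components (real and imaginary parts i.i.d. $\mathcal{N}(0,1/2)$). $W_{p,N}$ and $W_{f,N}$ are the $ML\times N$ block-Hankel matrices whose $(i,j)$ block ($M\times1$, $1\le i\le L$, $1\le j\le N$) is $\frac{1}{\sqrt N}y_{i+j-1}$ for $W_{p,N}$ and $\frac{1}{\sqrt N}y_{L+i+j-1}$ for $W_{f,N}$. Sequences $(X_N^{(1)})_{N\ge1},\dots,(X_N^{(p)})_{N\ge1}$ of $N\times N$ possibly random Hermitian matrices are said to be almost surely asymptotically free if: (i) for each $q$, $(X_N^{(q)})$ has an almost sure limit distribution, i.e. for each polynomial $P$, $\frac1N\mathrm{Tr}P(X_N^{(q)})$ converges almost surely to a deterministic limit; (ii) for all $m$, all $i_1,\dots,i_m\in\{1,\dots,p\}$ with $i_1\ne i_2$, $i_2\neq i_3$, $\dots$, $i_{m-1}\ne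 i_m$, and all one-variable polynomials $P_1,\dots,P_m$ such that $\frac1N\mathrm{Tr}(P_j(X_N^{(i_j)}))\to0$ a.s. for each $j$, one has $\frac1N\mathrm{Tr}\left(P_1(X_N^{(i_1)})P_2(X_N^{(i_2)})\cdots P_m(X_N^{(i_m)})\right)\to0$ a.s. *)

theory Defs
  imports
    "HOL-Probability.Probability"
    "HOL-Computational_Algebra.Computational_Algebra"
    "Jordan_Normal_Form.Schur_Decomposition"
    "Jordan_Normal_Form.Char_Poly"
begin

definition hermitian_mat :: "complex mat \<Rightarrow> bool" where
  "hermitian_mat A \<longleftrightarrow> dim_row A = dim_col A \<and> mat_adjoint A = A"

definition pos_semidef :: "complex mat \<Rightarrow> bool" where
  "pos_semidef A \<longleftrightarrow> hermitian_mat A \<and>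
     (\<forall>v \<in> carrier_vec (dim_row A). 0 \<le> Re ((A *\<^sub>v v) \<bullet>c v))"

definition pos_def :: "complex mat \<Rightarrow> bool" where
  "pos_def A \<longleftrightarrow> hermitian_mat A \<and>
     (\<forall>v \<in> carrier_vec (dim_row A). v \<noteq> 0\<^sub>v (dim_row A) \<longrightarrow> 0 < Re ((A *\<^sub>v v) \<bullet>c v))"

definition loewner_le :: "complex mat \<Rightarrow> complex mat \<Rightarrow> bool" where
  "loewner_le A B \<longleftrightarrow> pos_semidef (B - A)"

definition loewner_less :: "complex mat \<Rightarrow> complex mat \<Rightarrow> bool" where
  "loewner_less A B \<longleftrightarrow> pos_def (B - A)"

text \<open>For positive semidefinite \<open>A\<close> the matrix selected here exists and is unique.\<close>

definition mat_sqrt :: "complex mat \<Rightarrow> complex mat" where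
  "mat_sqrt A = (SOME S. S \<in> carrier_mat (dim_row A) (dim_row A) \<and> pos_semidef S \<and> S * S = A)"

definition mat_trace :: "complex mat \<Rightarrow> complex" where
  "mat_trace A = (\<Sum>i<dim_row A. A $$ (i, i))"

definition mat_poly :: "complex poly \<Rightarrow> complex mat \<Rightarrow> complex mat" where
  "mat_poly p A = mat (dim_row A) (dim_row A)
     (\<lambda>(i, j). \<Sum>k\<le>degree p. coeff p k * (A ^\<^sub>m k) $$ (i, j))"

text \<open>The roots of the characteristic polynomial form a multiset, so each eigenvalue of the
  \<open>m \<times> m\<close> matrix \<open>A\<close> gets mass (algebraic multiplicity) / \<open>m\<close>. It is used for
  Hermitian \<open>A\<close> with \<open>m > 0\<close> only, where the eigenvalues are real.\<close>

definition empirical_eigenvalue_dist :: "complex mat \<Rightarrow> real measure" where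
  "empirical_eigenvalue_dist A =
     distr (measure_pmf (pmf_of_multiset (proots (char_poly A)))) borel Re"

definition std_complex_gaussian :: "'w measure \<Rightarrow> ('w \<Rightarrow> complex) \<Rightarrow> bool" where
  "std_complex_gaussian \<Omega> Z \<longleftrightarrow>
     prob_space.indep_var \<Omega> borel (\<lambda>w. Re (Z w)) borel (\<lambda>w. Im (Z w)) \<and>
     distributed \<Omega> lborel (\<lambda>w. Re (Z w)) (normal_density 0 (sqrt (1/2))) \<and>
     distributed \<Omega> lborel (\<lambda>w. Im (Z w)) (normal_density 0 (sqrt (1/2)))"

text \<open>Independence of the vectors \<open>\<xi> 1, \<xi> 2, \<dots>\<close> together with independence of the
  components of each vector is joint independence of all the components.\<close>

definition iid_gaussian_vectors ::
    "'w measure \<Rightarrow> nat \<Rightarrow> (nat \<Rightarrow> 'w \<Rightarrow> complex vec) \<Rightarrow> bool" where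
  "iid_gaussian_vectors \<Omega> m \<xi> \<longleftrightarrow>
     (\<forall>n\<ge>1. \<forall>w \<in> space \<Omega>. \<xi> n w \<in> carrier_vec m) \<and>
     prob_space.indep_vars \<Omega> (\<lambda>_. borel) (\<lambda>(n, k) w. \<xi> n w $ k) ({1..} \<times> {..<m}) \<and>
     (\<forall>n\<ge>1. \<forall>k<m. std_complex_gaussian \<Omega> (\<lambda>w. \<xi> n w $ k))"

text \<open>Rows and columns are counted from 0: row \<open>r\<close> is component \<open>r mod m\<close> of block row
  \<open>i = r div m + 1\<close>, and column \<open>j\<close> is block column \<open>j + 1\<close>, so that the block with
  1-based indices \<open>(i, j)\<close> is \<open>y (s + i + j - 1) / sqrt N\<close>.\<close>

definition block_hankel ::
    "nat \<Rightarrow> nat \<Rightarrow> nat \<Rightarrow> nat \<Rightarrow> (nat \<Rightarrow> complex vec) \<Rightarrow> complex mat" where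
  "block_hankel m L N s y = mat (m * L) N
     (\<lambda>(r, j). y (s + r div m + j + 1) $ (r mod m) / complex_of_real (sqrt (real N)))"

definition W_past ::
    "nat \<Rightarrow> nat \<Rightarrow> nat \<Rightarrow> (nat \<Rightarrow> complex vec) \<Rightarrow> complex mat" where
  "W_past m L N y = block_hankel m L N 0 y"

definition W_future ::
    "nat \<Rightarrow> nat \<Rightarrow> nat \<Rightarrow> (nat \<Rightarrow> complex vec) \<Rightarrow> complex mat" where
  "W_future m L N y = block_hankel m L N L y"

definition random_hermitian_seq :: "'w measure \<Rightarrow> (nat \<Rightarrow> 'w \<Rightarrow> complex mat) \<Rightarrow> bool" where
  "random_hermitian_seq \<Omega> X \<longleftrightarrow>
     (\<forall>N\<ge>1. (\<forall>w \<in> space \<Omega>. X N w \<in> carrier_mat N N \<and> hermitian_mat (X N w)) \<and>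
            (\<forall>i<N. \<forall>j<N. (\<lambda>w. X N w $$ (i, j)) \<in> borel_measurable \<Omega>))"

definition has_as_limit_distribution ::
    "'w measure \<Rightarrow> (nat \<Rightarrow> 'w \<Rightarrow> complex mat) \<Rightarrow> bool" where
  "has_as_limit_distribution \<Omega> X \<longleftrightarrow>
     (\<forall>p. \<exists>l. AE w in \<Omega>. (\<lambda>N. mat_trace (mat_poly p (X N w)) / of_nat N) \<longlonglongrightarrow> l)"

definition as_centered ::
    "'w measure \<Rightarrow> (nat \<Rightarrow> 'w \<Rightarrow> complex mat) \<Rightarrow> complex poly \<Rightarrow> bool" where
  "as_centered \<Omega> X p \<longleftrightarrow>
     (AE w in \<Omega>. (\<lambda>N. mat_trace (mat_poly p (X N w)) / of_nat N) \<longlonglongrightarrow> 0)"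

text \<open>The list \<open>Xs\<close> holds the sequences; a list \<open>[(i\<^sub>1, p\<^sub>1), \<dots>, (i\<^sub>m, p\<^sub>m)]\<close> encodes an
  alternating word, \<open>i\<^sub>j\<close> being a position in \<open>Xs\<close>.\<close>

definition as_asymptotically_free ::
    "'w measure \<Rightarrow> (nat \<Rightarrow> 'w \<Rightarrow> complex mat) list \<Rightarrow> bool" where
  "as_asymptotically_free \<Omega> Xs \<longleftrightarrow>
     (\<forall>X \<in> set Xs. random_hermitian_seq \<Omega> X) \<and>
     (\<forall>X \<in> set Xs. has_as_limit_distribution \<Omega> X) \<and>
     (\<forall>ips :: (nat \<times> complex poly) list.
        ips \<noteq> [] \<and> (\<forall>(i, p) \<in> set ips. i < length Xs \<and> as_centered \<Omega> (Xs ! i) p) \<and>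
        distinct_adj (map fst ips) \<longrightarrow>
        (AE w in \<Omega>.
           (\<lambda>N. mat_trace (foldr (*) (map (\<lambda>(i, p). mat_poly p ((Xs ! i) N w)) ips) (1\<^sub>m N))
                 / of_nat N) \<longlonglongrightarrow> 0))"

end

theory Submission
  imports Defs "HOL-Library.Landau_Symbols"
    "Jordan_Normal_Form.Jordan_Normal_Form_Existence"
    "Jordan_Normal_Form.Jordan_Normal_Form_Uniqueness"
begin

text \<open>
  Write \<open>h k n p = (\<xi>\<^sub>n\<^sup>* R\<^sup>k \<xi>\<^sub>p) / N\<close> for the entries of the Gram matrix of the Gaussian vectors, taken
  in the metric \<open>R\<^sup>k\<close>. Then \<open>(W\<^sub>p\<^sup>* W\<^sub>p)\<^sub>i\<^sub>j\<close> is the sum of \<open>h 1 (i + l) (j + l)\<close> over \<open>l < L\<close>, and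
  \<open>W\<^sub>f\<^sup>* W\<^sub>f\<close> is the same sum over \<open>L \<le> l < 2 L\<close>: both are sums of \<open>N \<times> N\<close> windows of one Gram
  matrix, cut out at different places along its diagonal. The law of the Gram matrix does not change
  when the Gaussian vectors are multiplied by phases \<open>e\<^sup>i\<^sup>n\<^sup>\<theta>\<close>, so a word whose letters displace the
  index by a nonzero total amount has a trace of mean zero. Pairing a Gaussian of one window with a
  Gaussian of another window produces such a displacement; hence only pairings inside one window
  survive, which is why the windows, and then the two sums, become free.

  The computation rests on Gaussian integration by parts alone. Applied to the first Gram factor of
  a word, it expresses the expectation of a product of normalized traces by expectations in which
  fewer Gram factors occur (\<open>loop_equation\<close>). Three facts follow by induction on the number of Gram
  factors: the vanishing just described (\<open>expectation_weight\<close>); the bound \<open>O(N\<^sup>-\<^sup>s)\<close> for the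
  expectation of a product of \<open>s\<close> centered traces (\<open>trace_bounds\<close>); and the convergence of the mean
  traces of all words in the two matrices (\<open>colour_mean_tendsto\<close>). For \<open>s = 2\<close> the bound is summable
  in \<open>N\<close>, so traces converge almost surely to the same limits (\<open>colour_trace_AE\<close>).

  In the limit the loop equation becomes a recursion in which a letter interacts only with letters
  of its own colour (\<open>limit_moment_loop\<close>); this is the moment recursion of a family whose mixed free
  cumulants vanish. That alternating products of centered elements have limit zero is a formal
  consequence (\<open>alternating_centered\<close>). The powers \<open>R\<^sup>k\<close> enter because a pairing multiplies two copies
  of \<open>R\<close>; the normalized traces of \<open>R\<^sup>k\<close> converge because the spectra of the matrices \<open>R\<close> lie in a
  fixed bounded interval and their empirical distributions converge weakly.
\<close>

section \<open>Integration by parts for complex Gaussian variables\<close>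

context prob_space
begin

text \<open>The recursion \<open>E X\<^sup>n\<^sup>+\<^sup>1 = (n / 2) E X\<^sup>n\<^sup>-\<^sup>1\<close> is integration by parts against the density of variance
  \<open>1/2\<close>, read off from the closed form of the moments.\<close>

lemma real_gaussian_moments:
  assumes X: "distributed M lborel X (normal_density 0 (sqrt (1/2)))"
  shows "integrable M (\<lambda>w. X w ^ n)"
    and "expectation (\<lambda>w. X w ^ Suc n) = n / 2 * expectation (\<lambda>w. X w ^ (n - 1))"
proof -
  have pos: "0 < sqrt (1/2 :: real)" by simp
  have even_eq: "expectation (\<lambda>w. X w ^ (2 * k)) = fact (2 * k) / (4 ^ k * fact k)" for k
    using distributed_integral[OF X, of "\<lambda>x. x ^ (2 * k)"] integral_normal_moment_even[OF pos, of 0 k]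
    by simp
  have odd_eq: "expectation (\<lambda>w. X w ^ (2 * k + 1)) = 0" for k
    using distributed_integral[OF X, of "\<lambda>x. x ^ (2 * k + 1)"] integral_normal_moment_odd[OF pos, of 0 k]
    by simp
  show "integrable M (\<lambda>w. X w ^ n)"
    using distributed_integrable[OF X, of "\<lambda>x. x ^ n"] integrable_normal_moment[OF pos, of 0 n] by simp
  show "expectation (\<lambda>w. X w ^ Suc n) = n / 2 * expectation (\<lambda>w. X w ^ (n - 1))"
  proof (cases "even n")
    case True
    then obtain k where n: "n = 2 * k" by (auto elim: evenE)
    show ?thesis
    proof (cases k)
      case 0 then show ?thesis using odd_eq[of 0] n by simp
    next
      case (Suc j)
      have "expectation (\<lambda>w. X w ^ (n - 1)) = 0" using odd_eq[of j] n Suc by simp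
      then show ?thesis using odd_eq[of k] n by simp
    qed
  next
    case False
    then obtain k where n: "n = 2 * k + 1" by (auto elim: oddE)
    have f: "fact (2 * Suc k) = (2 * real k + 2) * (2 * real k + 1) * fact (2 * k)"
      by (simp add: algebra_simps)
    have "expectation (\<lambda>w. X w ^ Suc n) = fact (2 * Suc k) / (4 ^ Suc k * fact (Suc k))"
      using even_eq[of "Suc k"] n by simp
    also have "\<dots> = n / 2 * (fact (2 * k) / (4 ^ k * fact k))"
      unfolding f using n by (simp add: divide_simps) (simp add: algebra_simps)
    finally show ?thesis using even_eq[of k] n by simp
  qed
qed

lemma gaussian_pair_monomial:
  fixes X Y :: "'a \<Rightarrow> real"
  assumes ind: "indep_var borel X borel Y"
    and X: "distributed M lborel X (normal_density 0 (sqrt (1/2)))"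
    and Y: "distributed M lborel Y (normal_density 0 (sqrt (1/2)))"
  shows "integrable M (\<lambda>w. complex_of_real (X w) ^ i * complex_of_real (Y w) ^ j)"
    and "expectation (\<lambda>w. complex_of_real (X w) ^ i * complex_of_real (Y w) ^ j)
      = of_real (expectation (\<lambda>w. X w ^ i) * expectation (\<lambda>w. Y w ^ j))"
proof -
  have ind': "indep_var borel (\<lambda>w. X w ^ i) borel (\<lambda>w. Y w ^ j)"
    using indep_var_compose[OF ind, of "\<lambda>x. x ^ i" borel "\<lambda>x. x ^ j" borel]
    by (simp add: comp_def)
  have eq: "complex_of_real (X w) ^ i * complex_of_real (Y w) ^ j = of_real (X w ^ i * Y w ^ j)" for w
    by simp
  have int: "integrable M (\<lambda>w. X w ^ i * Y w ^ j)"
    by (rule indep_var_integrable[OF ind']) (rule real_gaussian_moments[OF X] real_gaussian_moments[OF Y])+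
  show "integrable M (\<lambda>w. complex_of_real (X w) ^ i * complex_of_real (Y w) ^ j)"
    unfolding eq using int by (rule integrable_of_real)
  show "expectation (\<lambda>w. complex_of_real (X w) ^ i * complex_of_real (Y w) ^ j)
      = of_real (expectation (\<lambda>w. X w ^ i) * expectation (\<lambda>w. Y w ^ j))"
    unfolding eq integral_complex_of_real
    by (subst indep_var_lebesgue_integral[OF ind'])
      (auto intro: real_gaussian_moments[OF X] real_gaussian_moments[OF Y])
qed

text \<open>Integration by parts in the real and in the imaginary part, for monomials in
  \<open>Re Z\<close>, \<open>Im Z\<close>, \<open>Z\<close> and \<open>cnj Z\<close>. The mixture of the four makes an induction on the exponents of
  \<open>Z\<close> and \<open>cnj Z\<close> possible: one factor \<open>Z = Re Z + \<i> Im Z\<close> is traded for real factors.\<close>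

lemma std_complex_gaussian_IBP_real:
  fixes Z :: "'a \<Rightarrow> complex"
  assumes Z: "std_complex_gaussian M Z"
  defines "X \<equiv> \<lambda>w. complex_of_real (Re (Z w))" and "Y \<equiv> \<lambda>w. complex_of_real (Im (Z w))"
  defines "G \<equiv> \<lambda>i j p q w. X w ^ i * Y w ^ j * (Z w ^ p * cnj (Z w) ^ q)"
  shows "integrable M (G i j p q)" (is ?int)
    and "2 * expectation (G (Suc i) j p q) = of_nat i * expectation (G (i - 1) j p q)
      + of_nat p * expectation (G i j (p - 1) q) + of_nat q * expectation (G i j p (q - 1))" (is ?x)
    and "2 * expectation (G i (Suc j) p q) = of_nat j * expectation (G i (j - 1) p q)
      + \<i> * of_nat p * expectation (G i j (p - 1) q) - \<i> * of_nat q * expectation (G i j p (q - 1))" (is ?y)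
proof -
  have ind: "indep_var borel (\<lambda>w. Re (Z w)) borel (\<lambda>w. Im (Z w))"
    and dX: "distributed M lborel (\<lambda>w. Re (Z w)) (normal_density 0 (sqrt (1/2)))"
    and dY: "distributed M lborel (\<lambda>w. Im (Z w)) (normal_density 0 (sqrt (1/2)))"
    using Z by (auto simp: std_complex_gaussian_def)
  have mono: "integrable M (\<lambda>w. X w ^ i * Y w ^ j)"
      "expectation (\<lambda>w. X w ^ i * Y w ^ j)
        = of_real (expectation (\<lambda>w. Re (Z w) ^ i) * expectation (\<lambda>w. Im (Z w) ^ j))" for i j
    unfolding X_def Y_def by (rule gaussian_pair_monomial[OF ind dX dY])+
  have lin: "2 * (u + \<i> * v) = 2 * u + \<i> * (2 * v)" "2 * (u - \<i> * v) = 2 * u - \<i> * (2 * v)" for u v :: complex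
    by (simp_all add: algebra_simps)
  have ZXY: "Z w = X w + \<i> * Y w" "cnj (Z w) = X w - \<i> * Y w" for w
    by (simp_all add: X_def Y_def complex_eq_iff)
  have rp: "G i j (Suc p) q = (\<lambda>w. G (Suc i) j p q w + \<i> * G i (Suc j) p q w)" for i j p q
    unfolding G_def by (rule ext) (simp add: ZXY(1) algebra_simps)
  have rq: "G i j p (Suc q) = (\<lambda>w. G (Suc i) j p q w - \<i> * G i (Suc j) p q w)" for i j p q
    unfolding G_def by (rule ext) (simp add: ZXY(2) algebra_simps)
  have G00: "G i j 0 0 = (\<lambda>w. X w ^ i * Y w ^ j)" for i j by (simp add: G_def)
  have int0: "integrable M (G i j p 0)" for i j p
    by (induction p arbitrary: i j) (auto simp: rp G00 mono intro!: Bochner_Integration.integrable_add integrable_mult_right)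
  have int: "integrable M (G i j p q)" for i j p q
    by (induction q arbitrary: i j) (auto simp: rq int0 intro!: Bochner_Integration.integrable_diff integrable_mult_right)
  then show ?int .
  define E where "E i j p q = expectation (G i j p q)" for i j p q
  have Ep: "E i j (Suc p) q = E (Suc i) j p q + \<i> * E i (Suc j) p q" for i j p q
    unfolding E_def rp by (simp add: int)
  have Eq: "E i j p (Suc q) = E (Suc i) j p q - \<i> * E i (Suc j) p q" for i j p q
    unfolding E_def rq by (simp add: int)
  have E00: "E i j 0 0 = of_real (expectation (\<lambda>w. Re (Z w) ^ i)) * of_real (expectation (\<lambda>w. Im (Z w) ^ j))" for i j
    unfolding E_def G00 mono by simp
  have x00: "2 * E (Suc i) j 0 0 = of_nat i * E (i - 1) j 0 0"
    and y00: "2 * E i (Suc j) 0 0 = of_nat j * E i (j - 1) 0 0" for i j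
    unfolding E00 real_gaussian_moments(2)[OF dX] real_gaussian_moments(2)[OF dY] by simp_all
  have x0: "2 * E (Suc i) j p 0 = of_nat i * E (i - 1) j p 0 + of_nat p * E i j (p - 1) 0"
    and y0: "2 * E i (Suc j) p 0 = of_nat j * E i (j - 1) p 0 + \<i> * of_nat p * E i j (p - 1) 0" for i j p
  proof (induction p arbitrary: i j)
    case 0
    { case 1 then show ?case by (simp add: x00) next case 2 then show ?case by (simp add: y00) }
  next
    case (Suc p)
    { case 1
      show ?case
        unfolding Ep[of "Suc i"] lin Suc(1)[of "Suc i" j] Suc(1)[of i "Suc j"]
        by (cases i; cases p) (simp_all add: Ep algebra_simps)
    next case 2
      show ?case
        unfolding Ep[of i "Suc j"] lin Suc(2)[of "Suc i" j] Suc(2)[of i "Suc j"]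
        by (cases j; cases p) (simp_all add: Ep algebra_simps) }
  qed
  have "2 * E (Suc i) j p q = of_nat i * E (i - 1) j p q + of_nat p * E i j (p - 1) q
        + of_nat q * E i j p (q - 1)"
    and "2 * E i (Suc j) p q = of_nat j * E i (j - 1) p q + \<i> * of_nat p * E i j (p - 1) q
        - \<i> * of_nat q * E i j p (q - 1)" for i j p q
  proof (induction q arbitrary: i j)
    case 0
    { case 1 then show ?case by (simp add: x0) next case 2 then show ?case by (simp add: y0) }
  next
    case (Suc q)
    { case 1
      show ?case
        unfolding Eq[of "Suc i"] lin Suc(1)[of "Suc i" j] Suc(1)[of i "Suc j"]
        by (cases i; cases p; cases q) (simp_all add: Eq algebra_simps)
    next case 2
      show ?case
        unfolding Eq[of i "Suc j"] lin Suc(2)[of "Suc i" j] Suc(2)[of i "Suc j"]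
        by (cases j; cases p; cases q) (simp_all add: Eq algebra_simps) }
  qed
  then show ?x ?y unfolding E_def by blast+
qed

text \<open>The Wirtinger form of integration by parts: multiplication by \<open>cnj Z = Re Z - \<i> Im Z\<close> acts under the
  expectation as \<open>(\<partial>\<^sub>R\<^sub>e - \<i> \<partial>\<^sub>I\<^sub>m) / 2 = \<partial>/\<partial>Z\<close>, so that the contributions of the exponent of
  \<open>cnj Z\<close> cancel.\<close>

lemma std_complex_gaussian_moments:
  fixes Z :: "'a \<Rightarrow> complex"
  assumes Z: "std_complex_gaussian M Z"
  shows "integrable M (\<lambda>w. Z w ^ p * cnj (Z w) ^ q)"
    and "expectation (\<lambda>w. Z w ^ p * cnj (Z w) ^ Suc q)
      = of_nat p * expectation (\<lambda>w. Z w ^ (p - 1) * cnj (Z w) ^ q)"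
proof -
  note ibp = std_complex_gaussian_IBP_real[OF Z]
  show "integrable M (\<lambda>w. Z w ^ p * cnj (Z w) ^ q)" using ibp(1)[of 0 0 p q] by simp
  define e where "e i j p q = expectation (\<lambda>w. complex_of_real (Re (Z w)) ^ i * complex_of_real (Im (Z w)) ^ j *
       (Z w ^ p * cnj (Z w) ^ q))" for i j p q
  have cnj_eq: "cnj (Z w) = complex_of_real (Re (Z w)) - \<i> * complex_of_real (Im (Z w))" for w
    by (simp add: complex_eq_iff)
  have "(\<lambda>w. Z w ^ p * cnj (Z w) ^ Suc q) =
      (\<lambda>w. complex_of_real (Re (Z w)) ^ 1 * complex_of_real (Im (Z w)) ^ 0 * (Z w ^ p * cnj (Z w) ^ q)
        - \<i> * (complex_of_real (Re (Z w)) ^ 0 * complex_of_real (Im (Z w)) ^ 1 * (Z w ^ p * cnj (Z w) ^ q)))"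
    by (rule ext, subst power_Suc, subst cnj_eq) (simp add: algebra_simps)
  then have "expectation (\<lambda>w. Z w ^ p * cnj (Z w) ^ Suc q) = e 1 0 p q - \<i> * e 0 1 p q"
    unfolding e_def by (simp only: Bochner_Integration.integral_diff integrable_mult_right ibp(1) integral_mult_right_zero)
  also have "\<dots> = of_nat p * e 0 0 (p - 1) q"
  proof -
    have "2 * e 1 0 p q = of_nat p * e 0 0 (p - 1) q + of_nat q * e 0 0 p (q - 1)"
      using ibp(2)[of 0 0 p q] by (simp add: e_def)
    moreover have "2 * e 0 1 p q = \<i> * of_nat p * e 0 0 (p - 1) q - \<i> * of_nat q * e 0 0 p (q - 1)"
      using ibp(3)[of 0 0 p q] by (simp add: e_def)
    moreover have "2 * (e 1 0 p q - \<i> * e 0 1 p q) = 2 * e 1 0 p q - \<i> * (2 * e 0 1 p q)"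
      by (simp add: algebra_simps)
    ultimately have "2 * (e 1 0 p q - \<i> * e 0 1 p q) = 2 * (of_nat p * e 0 0 (p - 1) q)"
      by (simp only:) (simp add: algebra_simps)
    then show ?thesis unfolding mult_cancel_left by simp
  qed
  finally show "expectation (\<lambda>w. Z w ^ p * cnj (Z w) ^ Suc q)
      = of_nat p * expectation (\<lambda>w. Z w ^ (p - 1) * cnj (Z w) ^ q)"
    by (simp add: e_def)
qed

end

locale complex_gaussian_family = prob_space \<Omega> for \<Omega> :: "'w measure" +
  fixes I :: "'i set" and Z :: "'i \<Rightarrow> 'w \<Rightarrow> complex"
  assumes indep: "indep_vars (\<lambda>_. borel) Z I"
    and gaussian: "\<And>v. v \<in> I \<Longrightarrow> std_complex_gaussian \<Omega> (Z v)"
begin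

definition monomial :: "'i multiset \<Rightarrow> 'i multiset \<Rightarrow> 'w \<Rightarrow> complex" where
  "monomial U W w = (\<Prod>u\<in>#U. Z u w) * (\<Prod>v\<in>#W. cnj (Z v w))"

definition moment :: "nat \<Rightarrow> nat \<Rightarrow> 'i \<Rightarrow> complex" where
  "moment p q v = expectation (\<lambda>w. Z v w ^ p * cnj (Z v w) ^ q)"

lemma monomial_factors:
  assumes "finite S" "set_mset U \<subseteq> S" "set_mset W \<subseteq> S"
  shows "monomial U W w = (\<Prod>v\<in>S. Z v w ^ count U v * cnj (Z v w) ^ count W v)"
proof -
  have "(\<Prod>u\<in>#U. f u) = (\<Prod>v\<in>S. f v ^ count U v)" if "set_mset U \<subseteq> S" for U and f :: "'i \<Rightarrow> complex"
    unfolding image_prod_mset_multiplicity using assms(1) that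
    by (intro prod.mono_neutral_left) (auto simp: not_in_iff)
  then show ?thesis using assms by (simp add: monomial_def prod.distrib)
qed

lemma monomial_expectation:
  assumes S: "finite S" "S \<subseteq> I" "set_mset U \<subseteq> S" "set_mset W \<subseteq> S"
  shows "integrable \<Omega> (monomial U W)"
    and "expectation (monomial U W) = (\<Prod>v\<in>S. moment (count U v) (count W v) v)"
proof -
  have meq: "monomial U W = (\<lambda>w. \<Prod>v\<in>S. Z v w ^ count U v * cnj (Z v w) ^ count W v)"
    using monomial_factors[OF S(1,3,4)] by blast
  have ind: "indep_vars (\<lambda>_. borel) (\<lambda>v w. Z v w ^ count U v * cnj (Z v w) ^ count W v) S"
    by (rule indep_vars_compose2[OF indep_vars_subset[OF indep S(2)], where N="\<lambda>_. borel"
          and Y="\<lambda>v z. z ^ count U v * cnj z ^ count W v"])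
      (auto intro!: borel_measurable_continuous_onI continuous_intros)
  have int: "integrable \<Omega> (\<lambda>w. Z v w ^ count U v * cnj (Z v w) ^ count W v)" if "v \<in> S" for v
    using std_complex_gaussian_moments(1)[OF gaussian] that S(2) by blast
  show "integrable \<Omega> (monomial U W)"
    unfolding meq by (rule indep_vars_integrable[OF S(1) ind int])
  show "expectation (monomial U W) = (\<Prod>v\<in>S. moment (count U v) (count W v) v)"
    unfolding meq moment_def by (rule indep_vars_lebesgue_integral[OF S(1) ind int])
qed

text \<open>Independence factorizes the expectation over the index set, and only the factor at \<open>v\<close> feels the
  additional \<open>cnj (Z v)\<close>.\<close>

lemma monomial_IBP:
  assumes "v \<in> I" "set_mset U \<subseteq> I" "set_mset W \<subseteq> I"
  shows "integrable \<Omega> (\<lambda>w. cnj (Z v w) * monomial U W w)"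
    and "expectation (\<lambda>w. cnj (Z v w) * monomial U W w)
      = of_nat (count U v) * expectation (monomial (U - {#v#}) W)"
proof -
  define S where "S = insert v (set_mset U \<union> set_mset W)"
  have S: "finite S" "S \<subseteq> I" "set_mset U \<subseteq> S" "set_mset W \<subseteq> S" "v \<in> S"
    using assms by (auto simp: S_def)
  have S': "set_mset (add_mset v W) \<subseteq> S" "set_mset (U - {#v#}) \<subseteq> S"
    using S by (auto dest: in_diffD)
  have add: "(\<lambda>w. cnj (Z v w) * monomial U W w) = monomial U (add_mset v W)"
    by (auto simp: monomial_def)
  show "integrable \<Omega> (\<lambda>w. cnj (Z v w) * monomial U W w)"
    unfolding add by (rule monomial_expectation[OF S(1-3) S'(1)])
  have m: "moment p (Suc q) v = of_nat p * moment (p - 1) q v" for p q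
    unfolding moment_def by (rule std_complex_gaussian_moments(2)[OF gaussian[OF assms(1)]])
  have off_v: "(\<Prod>u\<in>S - {v}. moment (count (U - {#v#}) u) (count W u) u)
      = (\<Prod>u\<in>S - {v}. moment (count U u) (count (add_mset v W) u) u)"
    by (rule prod.cong) auto
  have "expectation (monomial U (add_mset v W))
      = moment (count U v) (Suc (count W v)) v * (\<Prod>u\<in>S - {v}. moment (count U u) (count (add_mset v W) u) u)"
    unfolding monomial_expectation[OF S(1-3) S'(1)] prod.remove[OF S(1,5)] by simp
  also have "\<dots> = of_nat (count U v) * (moment (count U v - 1) (count W v) v
       * (\<Prod>u\<in>S - {v}. moment (count (U - {#v#}) u) (count W u) u))"
    unfolding m off_v by simp
  also have "\<dots> = of_nat (count U v) * expectation (monomial (U - {#v#}) W)"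
    unfolding monomial_expectation[OF S(1,2) S'(2) S(4)] prod.remove[OF S(1,5)] by simp
  finally show "expectation (\<lambda>w. cnj (Z v w) * monomial U W w)
      = of_nat (count U v) * expectation (monomial (U - {#v#}) W)"
    unfolding add .
qed

text \<open>\<open>derivative v F F'\<close>: some way of writing \<open>F\<close> as a polynomial in the variables \<open>Z u\<close> and
  \<open>cnj (Z u)\<close> has the formal partial derivative \<open>F'\<close> with respect to \<open>Z v\<close>. As a relation between
  random variables it avoids a syntax of polynomials; integration by parts is linear in the pair
  \<open>(F, F')\<close> and needs to be checked for monomials only.\<close>

inductive derivative :: "'i \<Rightarrow> ('w \<Rightarrow> complex) \<Rightarrow> ('w \<Rightarrow> complex) \<Rightarrow> bool" for v where
  derivative_monomial: "set_mset U \<subseteq> I \<Longrightarrow> set_mset W \<subseteq> I \<Longrightarrow>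
    derivative v (\<lambda>w. c * monomial U W w) (\<lambda>w. c * (of_nat (count U v) * monomial (U - {#v#}) W w))"
| derivative_add: "derivative v F F' \<Longrightarrow> derivative v G G' \<Longrightarrow>
    derivative v (\<lambda>w. F w + G w) (\<lambda>w. F' w + G' w)"

lemma derivative_integrable: "derivative v F F' \<Longrightarrow> integrable \<Omega> F"
  by (induction rule: derivative.induct)
    (auto intro!: monomial_expectation[of "set_mset U \<union> set_mset W" for U W])

lemma derivative_IBP:
  assumes "derivative v F F'" "v \<in> I"
  shows "integrable \<Omega> F'" "integrable \<Omega> (\<lambda>w. cnj (Z v w) * F w)"
    and "expectation (\<lambda>w. cnj (Z v w) * F w) = expectation F'"
proof -
  have "integrable \<Omega> F' \<and> integrable \<Omega> (\<lambda>w. cnj (Z v w) * F w) \<and>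
    expectation (\<lambda>w. cnj (Z v w) * F w) = expectation F'"
    using assms
  proof induction
    case (derivative_monomial U W c)
    have "integrable \<Omega> (monomial (U - {#v#}) W)"
      using derivative_monomial
      by (auto intro!: monomial_expectation[of "set_mset U \<union> set_mset W"] dest: in_diffD)
    moreover have eq: "cnj (Z v w) * (c * monomial U W w) = c * (cnj (Z v w) * monomial U W w)" for w
      by (simp add: ac_simps)
    ultimately show ?case
      using monomial_IBP[OF derivative_monomial(3,1,2)] unfolding eq by simp
  qed (simp add: distrib_left derivative_integrable)
  then show "integrable \<Omega> F'" "integrable \<Omega> (\<lambda>w. cnj (Z v w) * F w)"
    and "expectation (\<lambda>w. cnj (Z v w) * F w) = expectation F'" by blast+
qed

lemma derivative_const: "derivative v (\<lambda>w. c) (\<lambda>w. 0)"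
  using derivative_monomial[of "{#}" "{#}" v c] by (simp add: monomial_def)

lemma derivative_Z: "u \<in> I \<Longrightarrow> derivative v (Z u) (\<lambda>w. of_bool (u = v))"
  using derivative_monomial[of "{#u#}" "{#}" v 1] by (auto simp: monomial_def)

lemma derivative_cnj: "u \<in> I \<Longrightarrow> derivative v (\<lambda>w. cnj (Z u w)) (\<lambda>w. 0)"
  using derivative_monomial[of "{#}" "{#u#}" v 1] by (simp add: monomial_def)

text \<open>Leibniz: both polynomials are expanded into monomials, one after the other.\<close>

lemma derivative_mult:
  assumes "derivative v F F'" "derivative v G G'"
  shows "derivative v (\<lambda>w. F w * G w) (\<lambda>w. F' w * G w + F w * G' w)"
  using assms
proof (induction)
  case F: (derivative_monomial U W c)
  show ?case using F(3)
  proof induction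
    case (derivative_monomial U' W' c')
    have mult: "monomial U W w * monomial U' W' w = monomial (U + U') (W + W') w" for U W U' W' w
      by (simp add: monomial_def)
    have d: "of_nat (count X v) * monomial (X - {#v#} + Y) V w
        = of_nat (count X v) * monomial (X + Y - {#v#}) V w" for X Y V w
      by (cases "v \<in># X") (simp_all add: count_eq_zero_iff)
    have "derivative v (\<lambda>w. c * c' * monomial (U + U') (W + W') w)
      (\<lambda>w. c * c' * (of_nat (count (U + U') v) * monomial (U + U' - {#v#}) (W + W') w))"
      using derivative_monomial F by (intro derivative.derivative_monomial) auto
    moreover have "c * (of_nat (count U v) * monomial (U - {#v#}) W w) * (c' * monomial U' W' w) +
        c * monomial U W w * (c' * (of_nat (count U' v) * monomial (U' - {#v#}) W' w))
      = c * c' * (of_nat (count (U + U') v) * monomial (U + U' - {#v#}) (W + W') w)" for w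
    proof -
      have "c * (of_nat (count U v) * monomial (U - {#v#}) W w) * (c' * monomial U' W' w) +
        c * monomial U W w * (c' * (of_nat (count U' v) * monomial (U' - {#v#}) W' w))
        = c * c' * (of_nat (count U v) * (monomial (U - {#v#}) W w * monomial U' W' w)
          + of_nat (count U' v) * (monomial (U' - {#v#}) W' w * monomial U W w))"
        by (simp add: algebra_simps)
      also have "\<dots> = c * c' * (of_nat (count U v) * monomial (U + U' - {#v#}) (W + W') w
          + of_nat (count U' v) * monomial (U' + U - {#v#}) (W' + W) w)"
        unfolding mult d ..
      finally show ?thesis by (simp add: algebra_simps)
    qed
    ultimately show ?case by (simp add: mult[symmetric] ac_simps)
  next
    case (derivative_add G G' K K')
    from derivative.derivative_add[OF derivative_add(3,4)] show ?case by (simp add: algebra_simps)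
  qed
next
  case (derivative_add F F' K K')
  from derivative.derivative_add[OF derivative_add(3)[OF derivative_add(5)] derivative_add(4)[OF derivative_add(5)]]
  show ?case by (simp add: algebra_simps)
qed

lemma derivative_cmult: "derivative v F F' \<Longrightarrow> derivative v (\<lambda>w. c * F w) (\<lambda>w. c * F' w)"
  using derivative_mult[OF derivative_const[of v c]] by simp

lemma derivative_sum:
  "finite S \<Longrightarrow> (\<And>s. s \<in> S \<Longrightarrow> derivative v (F s) (F' s)) \<Longrightarrow>
    derivative v (\<lambda>w. \<Sum>s\<in>S. F s w) (\<lambda>w. \<Sum>s\<in>S. F' s w)"
  by (induction rule: finite_induct) (auto intro: derivative_const derivative_add)

definition polynomial :: "('w \<Rightarrow> complex) \<Rightarrow> bool" where
  "polynomial F \<longleftrightarrow> (\<forall>v. \<exists>F'. derivative v F F')"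

lemma polynomial_integrable: "polynomial F \<Longrightarrow> integrable \<Omega> F"
  unfolding polynomial_def using derivative_integrable by blast

lemma polynomial_const: "polynomial (\<lambda>w. c)"
  unfolding polynomial_def using derivative_const by blast

lemma polynomial_Z: "u \<in> I \<Longrightarrow> polynomial (Z u)"
  unfolding polynomial_def using derivative_Z by blast

lemma polynomial_cnj: "u \<in> I \<Longrightarrow> polynomial (\<lambda>w. cnj (Z u w))"
  unfolding polynomial_def using derivative_cnj by blast

lemma polynomial_add: "polynomial F \<Longrightarrow> polynomial G \<Longrightarrow> polynomial (\<lambda>w. F w + G w)"
  unfolding polynomial_def using derivative_add by blast

lemma polynomial_mult: "polynomial F \<Longrightarrow> polynomial G \<Longrightarrow> polynomial (\<lambda>w. F w * G w)"
  unfolding polynomial_def using derivative_mult by blast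

lemma polynomial_diff: "polynomial F \<Longrightarrow> polynomial G \<Longrightarrow> polynomial (\<lambda>w. F w - G w)"
  using polynomial_add[OF _ polynomial_mult[OF polynomial_const[of "-1"]], of F G] by simp

lemma polynomial_divide: "polynomial F \<Longrightarrow> polynomial (\<lambda>w. F w / c)"
  using polynomial_mult[OF _ polynomial_const[of "inverse c"], of F] by (simp add: divide_inverse)

lemma polynomial_sum:
  "(\<And>s. s \<in> S \<Longrightarrow> polynomial (F s)) \<Longrightarrow> polynomial (\<lambda>w. \<Sum>s\<in>S. F s w)"
  by (induction S rule: infinite_finite_induct) (auto intro: polynomial_const polynomial_add)

lemma polynomial_sum_list:
  "(\<And>s. s \<in> set S \<Longrightarrow> polynomial (F s)) \<Longrightarrow> polynomial (\<lambda>w. \<Sum>s\<leftarrow>S. F s w)"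
  by (induction S) (auto intro: polynomial_const polynomial_add)

lemma expectation_sum_list:
  "(\<And>s. s \<in> set S \<Longrightarrow> polynomial (F s)) \<Longrightarrow>
    expectation (\<lambda>w. \<Sum>s\<leftarrow>S. F s w) = (\<Sum>s\<leftarrow>S. expectation (F s))"
  by (induction S) (auto simp: polynomial_integrable polynomial_sum_list)

lemmas polynomial_intros = polynomial_const polynomial_Z polynomial_cnj polynomial_add polynomial_mult
  polynomial_diff polynomial_divide polynomial_sum polynomial_sum_list

end

section \<open>Words in windows of a Gaussian Gram matrix\<close>

declare sum_of_bool_mult_eq [simp del] sum_mult_of_bool_eq [simp del]

lemma sum_sum_list_swap:
  fixes f :: "'a \<Rightarrow> 'b \<Rightarrow> 'c :: comm_monoid_add"
  shows "(\<Sum>s\<in>S. \<Sum>x\<leftarrow>xs. f s x) = (\<Sum>x\<leftarrow>xs. \<Sum>s\<in>S. f s x)"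
  by (induction xs) (simp_all add: sum.distrib)

lemma sum_list_divide:
  fixes c :: "'a :: field"
  shows "(\<Sum>x\<leftarrow>xs. f x) / c = (\<Sum>x\<leftarrow>xs. f x / c)"
  by (induction xs) (simp_all add: add_divide_distrib)

text \<open>The entry \<open>Z\<^sub>n\<^sup>* P\<^sub>k Z\<^sub>p / N\<close> of a generalized Gram matrix; \<open>P\<^sub>k\<close> will be the \<open>k\<close>-th power of the
  covariance matrix.\<close>

definition gram :: "nat \<Rightarrow> nat \<Rightarrow> (nat \<Rightarrow> nat \<Rightarrow> nat \<Rightarrow> complex) \<Rightarrow> (nat \<times> nat \<Rightarrow> 'w \<Rightarrow> complex) \<Rightarrow>
    nat \<Rightarrow> nat \<Rightarrow> nat \<Rightarrow> 'w \<Rightarrow> complex" where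
  "gram m N P Z k n p w = (\<Sum>a<m. cnj (Z (n, a) w) * (\<Sum>b<m. P k a b * Z (p, b) w)) / of_nat N"

text \<open>The letters of words in \<open>N \<times> N\<close> matrices. \<open>Gram k l m\<close> is the window of the \<open>k\<close>-th Gram matrix
  whose rows start at \<open>l\<close> and whose columns start at \<open>m\<close>. \<open>Shift l m\<close> is the deterministic window of
  the identity matrix with the same offsets; such matrices arise when two Gaussians are paired.\<close>

datatype letter = Gram nat nat nat | Shift nat nat

fun letter_entry :: "(nat \<Rightarrow> nat \<Rightarrow> nat \<Rightarrow> 'w \<Rightarrow> complex) \<Rightarrow> letter \<Rightarrow> nat \<Rightarrow> nat \<Rightarrow> 'w \<Rightarrow> complex" where
  "letter_entry h (Gram k l m) i j w = h k (i + l) (j + m) w"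
| "letter_entry h (Shift l m) i j w = of_bool (i + l = j + m)"

fun entry :: "(nat \<Rightarrow> nat \<Rightarrow> nat \<Rightarrow> 'w \<Rightarrow> complex) \<Rightarrow> nat \<Rightarrow> letter list \<Rightarrow> nat \<Rightarrow> nat \<Rightarrow> 'w \<Rightarrow> complex" where
  "entry h N [] i j w = of_bool (i = j)"
| "entry h N (x # u) i j w = (\<Sum>s<N. letter_entry h x i s w * entry h N u s j w)"

lemma letter_entry_fun:
  "letter_entry h (Gram k l m) i j = h k (i + l) (j + m)"
  "letter_entry h (Shift l m) i j = (\<lambda>w. of_bool (i + l = j + m))"
  by auto

lemma entry_fun:
  "entry h N [] i j = (\<lambda>w. of_bool (i = j))"
  "entry h N (x # u) i j = (\<lambda>w. \<Sum>s<N. letter_entry h x i s w * entry h N u s j w)"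
  by auto

definition ntrace :: "(nat \<Rightarrow> nat \<Rightarrow> nat \<Rightarrow> 'w \<Rightarrow> complex) \<Rightarrow> nat \<Rightarrow> letter list \<Rightarrow> 'w \<Rightarrow> complex" where
  "ntrace h N u w = (\<Sum>i<N. entry h N u i i w) / of_nat N"

lemma sum_delta_lessThan:
  fixes f :: "nat \<Rightarrow> complex"
  shows "i < N \<Longrightarrow> (\<Sum>s<N. of_bool (i = s) * f s) = f i"
    and "i < N \<Longrightarrow> (\<Sum>s<N. f s * of_bool (s = i)) = f i"
  by (auto simp: of_bool_def if_distrib[of "\<lambda>x. x * _"] if_distrib[of "\<lambda>x. _ * x"] cong: if_cong)

lemma entry_append:
  assumes "i < N"
  shows "entry h N (u @ v) i j w = (\<Sum>s<N. entry h N u i s w * entry h N v s j w)"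
  using assms
proof (induction u arbitrary: i)
  case (Cons x u)
  have "entry h N ((x # u) @ v) i j w
      = (\<Sum>t<N. \<Sum>s<N. letter_entry h x i t w * (entry h N u t s w * entry h N v s j w))"
    using Cons by (auto simp: sum_distrib_left intro!: sum.cong)
  also have "\<dots> = (\<Sum>s<N. entry h N (x # u) i s w * entry h N v s j w)"
    by (subst sum.swap) (simp add: sum_distrib_right mult.assoc)
  finally show ?case .
qed (simp add: sum_delta_lessThan)

lemma entry_letter: "j < N \<Longrightarrow> entry h N [x] i j w = letter_entry h x i j w"
  by (simp add: sum_delta_lessThan)

lemma ntrace_append: "ntrace h N (u @ v) w = (\<Sum>i<N. \<Sum>s<N. entry h N u i s w * entry h N v s i w) / of_nat N"
  by (simp add: ntrace_def entry_append)

lemma ntrace_rotate: "ntrace h N (u @ v) w = ntrace h N (v @ u) w"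
  unfolding ntrace_append by (subst sum.swap) (simp add: mult.commute)

text \<open>All ways of singling out one \<open>Gram\<close> letter of a word: each entry holds the part before it, its three
  parameters, and the part after it.\<close>

fun splits :: "letter list \<Rightarrow> (letter list \<times> nat \<times> nat \<times> nat \<times> letter list) list" where
  "splits [] = []"
| "splits (Gram k l m # u) = ([], k, l, m, u) # map (\<lambda>(q1, g). (Gram k l m # q1, g)) (splits u)"
| "splits (Shift l m # u) = map (\<lambda>(q1, g). (Shift l m # q1, g)) (splits u)"

text \<open>The constants \<open>c u\<close> are zero, or the means of the traces.\<close>

definition trace_product ::
    "(nat \<Rightarrow> nat \<Rightarrow> nat \<Rightarrow> 'w \<Rightarrow> complex) \<Rightarrow> nat \<Rightarrow> (letter list \<Rightarrow> complex) \<Rightarrow> letter list list \<Rightarrow> 'w \<Rightarrow> complex" where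
  "trace_product h N c us w = (\<Prod>u\<leftarrow>us. ntrace h N u w - c u)"

definition remove_nth :: "nat \<Rightarrow> 'a list \<Rightarrow> 'a list" where
  "remove_nth i xs = take i xs @ drop (Suc i) xs"

lemma remove_nth_Cons [simp]: "remove_nth 0 (x # xs) = xs" "remove_nth (Suc i) (x # xs) = x # remove_nth i xs"
  by (simp_all add: remove_nth_def)

locale gaussian_gram = complex_gaussian_family \<Omega> "UNIV \<times> {..<m}" Z
  for \<Omega> :: "'w measure" and m :: nat and Z :: "nat \<times> nat \<Rightarrow> 'w \<Rightarrow> complex" +
  fixes N :: nat and P :: "nat \<Rightarrow> nat \<Rightarrow> nat \<Rightarrow> complex"
  assumes N_pos: "N > 0"
    and P_mult: "\<And>k j a d. a < m \<Longrightarrow> d < m \<Longrightarrow> (\<Sum>b<m. P k a b * P j b d) = P (k + j) a d"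
begin

abbreviation "h \<equiv> gram m N P Z"

definition column :: "nat \<Rightarrow> nat \<Rightarrow> nat \<Rightarrow> 'w \<Rightarrow> complex" where
  "column k p a w = (\<Sum>b<m. P k a b * Z (p, b) w)"

lemma gram_column: "h k n p w = (\<Sum>a<m. cnj (Z (n, a) w) * column k p a w) / of_nat N"
  by (simp add: gram_def column_def)

lemma column_column: "a < m \<Longrightarrow> (\<Sum>d<m. P j a d * column k p d w) = column (j + k) p a w"
proof -
  assume "a < m"
  have "(\<Sum>d<m. P j a d * column k p d w) = (\<Sum>b<m. (\<Sum>d<m. P j a d * P k d b) * Z (p, b) w)"
    unfolding column_def sum_distrib_left sum_distrib_right by (subst sum.swap) (simp add: mult.assoc)
  then show ?thesis using \<open>a < m\<close> by (simp add: column_def P_mult)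
qed

lemma derivative_column: "a < m \<Longrightarrow> derivative (n, a) (column k p b) (\<lambda>w. of_bool (n = p) * P k b a)"
proof -
  assume a: "a < m"
  have "derivative (n, a) (column k p b) (\<lambda>w. \<Sum>d<m. P k b d * of_bool ((p, d) = (n, a)))"
    unfolding column_def by (intro derivative_sum derivative_cmult derivative_Z) auto
  also have "(\<lambda>w. \<Sum>d<m. P k b d * of_bool ((p, d) = (n, a))) = (\<lambda>w. of_bool (n = p) * P k b a)"
    using a by (auto simp: of_bool_def if_distrib[of "\<lambda>x. _ * x"] cong: if_cong)
  finally show ?thesis .
qed

text \<open>The derivation \<open>\<Sum>\<^sub>a (P\<^sub>k Z\<^sub>p)\<^sub>a \<partial>/\<partial>Z\<^sub>n\<^sub>a\<close>. It appears when \<open>h k n p\<close> is removed by integration by parts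
  in its left factors \<open>cnj (Z (n, a))\<close>, and it maps entries of Gram matrices to entries of Gram
  matrices, so that the Gaussians themselves no longer occur in what follows.\<close>

definition gram_derivation :: "nat \<Rightarrow> nat \<Rightarrow> nat \<Rightarrow> ('w \<Rightarrow> complex) \<Rightarrow> ('w \<Rightarrow> complex) \<Rightarrow> bool" where
  "gram_derivation k n p F G \<longleftrightarrow>
    (\<exists>F'. (\<forall>a<m. derivative (n, a) F (F' a)) \<and> G = (\<lambda>w. \<Sum>a<m. column k p a w * F' a w))"

lemma gram_derivation_const: "gram_derivation k n p (\<lambda>w. c) (\<lambda>w. 0)"
  unfolding gram_derivation_def using derivative_const by (intro exI[of _ "\<lambda>a w. 0"]) auto

lemma gram_derivation_add:
  assumes "gram_derivation k n p F G" "gram_derivation k n p F2 G2"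
  shows "gram_derivation k n p (\<lambda>w. F w + F2 w) (\<lambda>w. G w + G2 w)"
proof -
  from assms obtain F' F2' where "\<forall>a<m. derivative (n, a) F (F' a)" "\<forall>a<m. derivative (n, a) F2 (F2' a)"
    "G = (\<lambda>w. \<Sum>a<m. column k p a w * F' a w)" "G2 = (\<lambda>w. \<Sum>a<m. column k p a w * F2' a w)"
    unfolding gram_derivation_def by blast
  then show ?thesis unfolding gram_derivation_def
    by (intro exI[of _ "\<lambda>a w. F' a w + F2' a w"]) (auto intro: derivative_add simp: algebra_simps sum.distrib)
qed

lemma gram_derivation_mult:
  assumes "gram_derivation k n p F G" "gram_derivation k n p F2 G2"
  shows "gram_derivation k n p (\<lambda>w. F w * F2 w) (\<lambda>w. G w * F2 w + F w * G2 w)"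
proof -
  from assms obtain F' F2' where "\<forall>a<m. derivative (n, a) F (F' a)" "\<forall>a<m. derivative (n, a) F2 (F2' a)"
    "G = (\<lambda>w. \<Sum>a<m. column k p a w * F' a w)" "G2 = (\<lambda>w. \<Sum>a<m. column k p a w * F2' a w)"
    unfolding gram_derivation_def by blast
  then show ?thesis unfolding gram_derivation_def
    by (intro exI[of _ "\<lambda>a w. F' a w * F2 w + F w * F2' a w"] conjI allI impI derivative_mult)
      (auto simp: distrib_left sum.distrib sum_distrib_left sum_distrib_right ac_simps)
qed

lemma gram_derivation_cmult:
  "gram_derivation k n p F G \<Longrightarrow> gram_derivation k n p (\<lambda>w. c * F w) (\<lambda>w. c * G w)"
  using gram_derivation_mult[OF gram_derivation_const[of k n p c]] by simp

lemma gram_derivation_sum: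
  "(\<And>s. s \<in> S \<Longrightarrow> gram_derivation k n p (F s) (G s)) \<Longrightarrow>
    gram_derivation k n p (\<lambda>w. \<Sum>s\<in>S. F s w) (\<lambda>w. \<Sum>s\<in>S. G s w)"
  by (induction S rule: infinite_finite_induct) (auto intro: gram_derivation_const gram_derivation_add)

text \<open>Pairing \<open>h k n p\<close> with \<open>h k' s t\<close> is possible when \<open>t = n\<close> and merges them into one entry with the
  product \<open>P\<^sub>k\<^sub>' P\<^sub>k = P\<^sub>k\<^sub>+\<^sub>k\<^sub>'\<close> in the middle.\<close>

lemma gram_derivation_gram:
  "gram_derivation k n p (h k' s t) (\<lambda>w. of_bool (t = n) * h (k + k') s p w)"
proof -
  define F' where "F' a w = (\<Sum>a'<m. cnj (Z (s, a') w) * (of_bool (n = t) * P k' a' a)) / of_nat N" for a w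
  have "derivative (n, a) (h k' s t) (F' a)" if "a < m" for a
  proof -
    have "derivative (n, a) (\<lambda>w. inverse (of_nat N) * (\<Sum>a'<m. cnj (Z (s, a') w) * column k' t a' w))
      (\<lambda>w. inverse (of_nat N) * (\<Sum>a'<m. 0 * column k' t a' w + cnj (Z (s, a') w) * (of_bool (n = t) * P k' a' a)))"
      using that by (intro derivative_cmult derivative_sum derivative_mult derivative_cnj derivative_column) auto
    then show ?thesis by (simp add: gram_column[abs_def] F'_def[abs_def] divide_inverse mult.commute)
  qed
  moreover have "of_bool (t = n) * h (k + k') s p w = (\<Sum>a<m. column k p a w * F' a w)" for w
  proof -
    have "(\<Sum>a<m. column k p a w * F' a w)
        = (\<Sum>a'<m. cnj (Z (s, a') w) * (\<Sum>a<m. P k' a' a * column k p a w)) * of_bool (n = t) / of_nat N"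
      unfolding F'_def sum_distrib_left sum_distrib_right sum_divide_distrib
      by (subst sum.swap) (simp add: ac_simps)
    also have "\<dots> = of_bool (t = n) * h (k + k') s p w"
      by (auto simp: column_column gram_column add.commute)
    finally show ?thesis ..
  qed
  ultimately show ?thesis unfolding gram_derivation_def by (intro exI[of _ F']) auto
qed

lemma polynomial_gram: "polynomial (h k n p)"
  unfolding gram_def by (intro polynomial_intros) auto

definition moment_R :: "nat \<Rightarrow> complex" where
  "moment_R k = (\<Sum>a<m. P k a a) / of_nat N"

text \<open>The first term pairs the two Gaussians inside \<open>h k n p\<close> with each other.\<close>

lemma gram_IBP:
  assumes "gram_derivation k n p F G" "polynomial F"
  shows "integrable \<Omega> G"
    and "expectation (\<lambda>w. h k n p w * F w) = of_bool (n = p) * moment_R k * expectation F + expectation G / of_nat N"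
proof -
  from assms obtain F' where F': "\<And>a. a < m \<Longrightarrow> derivative (n, a) F (F' a)"
    and G: "G = (\<lambda>w. \<Sum>a<m. column k p a w * F' a w)"
    unfolding gram_derivation_def by blast
  have pc: "polynomial (column k p a)" for a
    unfolding column_def by (intro polynomial_intros) auto
  have d: "derivative (n, a) (\<lambda>w. column k p a w * F w)
      (\<lambda>w. of_bool (n = p) * P k a a * F w + column k p a w * F' a w)" if "a < m" for a
    using derivative_mult[OF derivative_column[OF that] F'[OF that]] .
  have v: "(n, a) \<in> UNIV \<times> {..<m}" if "a < m" for a using that by auto
  note ibp = derivative_IBP[OF d v]
  have intF: "integrable \<Omega> F" by (rule polynomial_integrable[OF assms(2)])
  have intF': "integrable \<Omega> (\<lambda>w. column k p a w * F' a w)" if "a < m" for a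
  proof -
    have "integrable \<Omega> (\<lambda>w. of_bool (n = p) * P k a a * F w + column k p a w * F' a w - of_bool (n = p) * P k a a * F w)"
      using ibp(1)[OF that that] intF by (intro Bochner_Integration.integrable_diff integrable_mult_right)
    then show ?thesis by simp
  qed
  show "integrable \<Omega> G" unfolding G using intF' by auto
  have "expectation (\<lambda>w. h k n p w * F w)
      = expectation (\<lambda>w. (\<Sum>a<m. cnj (Z (n, a) w) * (column k p a w * F w)) / of_nat N)"
    by (simp add: gram_column sum_distrib_right mult.assoc)
  also have "\<dots> = (\<Sum>a<m. expectation (\<lambda>w. cnj (Z (n, a) w) * (column k p a w * F w))) / of_nat N"
    using ibp(2) by simp
  also have "\<dots> = (\<Sum>a<m. of_bool (n = p) * P k a a * expectation F + expectation (\<lambda>w. column k p a w * F' a w)) / of_nat N"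
    using ibp(3) intF intF' by simp
  also have "\<dots> = of_bool (n = p) * moment_R k * expectation F + expectation G / of_nat N"
    unfolding G moment_R_def using intF'
    by (simp add: sum.distrib add_divide_distrib sum_distrib_left sum_distrib_right)
  finally show "expectation (\<lambda>w. h k n p w * F w)
      = of_bool (n = p) * moment_R k * expectation F + expectation G / of_nat N" .
qed

end

context gaussian_gram
begin

abbreviation "tr \<equiv> ntrace h N"

lemma polynomial_entry: "polynomial (entry h N u i j)"
proof (induction u arbitrary: i)
  case (Cons x u)
  have "polynomial (letter_entry h x i s)" for s
    by (cases x) (auto simp: letter_entry_fun intro: polynomial_gram polynomial_const)
  then show ?case using Cons unfolding entry_fun by (intro polynomial_intros)
qed (auto simp: entry_fun intro: polynomial_const)

lemma polynomial_ntrace: "polynomial (tr u)"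
  unfolding ntrace_def by (intro polynomial_intros polynomial_entry)

lemma polynomial_trace_product: "polynomial (trace_product h N c us)"
  unfolding trace_product_def
  by (induction us) (auto intro!: polynomial_intros polynomial_ntrace)

text \<open>Each \<open>Gram\<close> letter of the word can be the partner; the word is cut there. The left piece receives the
  merged letter, and the right piece starts with the shift that records \<open>t = n\<close>.\<close>

lemma gram_derivation_entry:
  assumes "i < N" "j < N" "x < N"
  shows "gram_derivation k (i + l) (j + l') (entry h N u x y)
    (\<lambda>w. \<Sum>(u1, k', r, r', u2)\<leftarrow>splits u.
      entry h N (u1 @ [Gram (k + k') r l']) x j w * entry h N (Shift l r' # u2) i y w)"
  using assms(3)
proof (induction u arbitrary: x)
  case Nil
  then show ?case by (simp add: entry_fun gram_derivation_const)
next
  case (Cons a u)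
  let ?D = "\<lambda>u x w. \<Sum>(u1, k', r, r', u2)\<leftarrow>splits u.
      entry h N (u1 @ [Gram (k + k') r l']) x j w * entry h N (Shift l r' # u2) i y w"
  define \<delta> where "\<delta> s w = (case a of Gram k' r r' \<Rightarrow> of_bool (s + r' = i + l) * h (k + k') (x + r) (j + l') w
      | Shift _ _ \<Rightarrow> 0)" for s w
  have "gram_derivation k (i + l) (j + l') (letter_entry h a x s) (\<delta> s)" for s
  proof (cases a)
    case (Gram k' r r')
    have "\<delta> s = (\<lambda>w. of_bool (s + r' = i + l) * h (k + k') (x + r) (j + l') w)"
      by (rule ext) (simp only: \<delta>_def Gram letter.case)
    then show ?thesis using Gram by (simp only: letter_entry_fun gram_derivation_gram)
  next
    case (Shift r r')
    have "\<delta> s = (\<lambda>w. 0)"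
      by (rule ext) (simp only: \<delta>_def Shift letter.case)
    then show ?thesis using Shift by (simp only: letter_entry_fun gram_derivation_const)
  qed
  then have "gram_derivation k (i + l) (j + l') (entry h N (a # u) x y)
      (\<lambda>w. \<Sum>s<N. \<delta> s w * entry h N u s y w + letter_entry h a x s w * ?D u s w)"
    unfolding entry_fun(2)[of h N a u] using Cons
    by (intro gram_derivation_sum gram_derivation_mult) (auto simp del: entry.simps)
  moreover have "(\<Sum>s<N. \<delta> s w * entry h N u s y w + letter_entry h a x s w * ?D u s w) = ?D (a # u) x w" for w
  proof -
    have sw: "(\<Sum>s<N. letter_entry h a x s w * ?D u s w)
        = (\<Sum>(u1, k', r, r', u2)\<leftarrow>splits u.
          entry h N (a # u1 @ [Gram (k + k') r l']) x j w * entry h N (Shift l r' # u2) i y w)"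
      unfolding case_prod_unfold append_Cons entry.simps(2)[of h N a] sum_distrib_right
        sum_list_const_mult[symmetric] sum_sum_list_swap
      by (simp only: mult.assoc append_Cons)
    show ?thesis
    proof (cases a)
      case (Gram k' r r')
      have "(\<Sum>s<N. \<delta> s w * entry h N u s y w)
        = h (k + k') (x + r) (j + l') w * entry h N (Shift l r' # u) i y w"
        using Gram unfolding entry.simps(2) letter_entry.simps(2) sum_distrib_left
        by (intro sum.cong) (simp_all add: \<delta>_def)
      then show ?thesis
        using Gram sw entry_letter[OF assms(2), of h "Gram (k + k') r l'" x w]
        by (simp add: sum.distrib case_prod_unfold comp_def)
    next
      case (Shift r r')
      then show ?thesis using sw by (simp add: sum.distrib \<delta>_def case_prod_unfold comp_def)
    qed
  qed
  ultimately show ?case by (simp only:)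
qed

lemma gram_derivation_ntrace:
  assumes "i < N" "j < N"
  shows "gram_derivation k (i + l) (j + l') (tr u)
    (\<lambda>w. (\<Sum>(u1, k', r, r', u2)\<leftarrow>splits u.
      entry h N (Shift l r' # u2 @ u1 @ [Gram (k + k') r l']) i j w) / of_nat N)"
proof -
  have "gram_derivation k (i + l) (j + l') (\<lambda>w. inverse (of_nat N) * (\<Sum>x<N. entry h N u x x w))
    (\<lambda>w. inverse (of_nat N) * (\<Sum>x<N. \<Sum>(u1, k', r, r', u2)\<leftarrow>splits u.
      entry h N (u1 @ [Gram (k + k') r l']) x j w * entry h N (Shift l r' # u2) i x w))"
    using assms by (intro gram_derivation_cmult gram_derivation_sum gram_derivation_entry) auto
  moreover have "(\<Sum>x<N. \<Sum>(u1, k', r, r', u2)\<leftarrow>splits u.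
      entry h N (u1 @ [Gram (k + k') r l']) x j w * entry h N (Shift l r' # u2) i x w)
    = (\<Sum>(u1, k', r, r', u2)\<leftarrow>splits u. entry h N ((Shift l r' # u2) @ (u1 @ [Gram (k + k') r l'])) i j w)" for w
    unfolding entry_append[OF assms(1)]
    unfolding case_prod_unfold sum_sum_list_swap by (simp only: mult.commute)
  ultimately show ?thesis
    by (simp add: ntrace_def[abs_def] divide_inverse mult.commute)
qed

lemma gram_derivation_trace_product:
  assumes "i < N" "j < N"
  shows "gram_derivation k (i + l) (j + l') (trace_product h N c us)
    (\<lambda>w. \<Sum>p<length us. (\<Sum>(u1, k', r, r', u2)\<leftarrow>splits (us ! p).
      entry h N (Shift l r' # u2 @ u1 @ [Gram (k + k') r l']) i j w) / of_nat N
        * trace_product h N c (remove_nth p us) w)"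
proof (induction us)
  case Nil
  then show ?case by (simp add: trace_product_def gram_derivation_const)
next
  case (Cons u us)
  have "gram_derivation k (i + l) (j + l') (\<lambda>w. tr u w + - c u)
    (\<lambda>w. (\<Sum>(u1, k', r, r', u2)\<leftarrow>splits u.
      entry h N (Shift l r' # u2 @ u1 @ [Gram (k + k') r l']) i j w) / of_nat N + 0)"
    by (intro gram_derivation_add gram_derivation_const gram_derivation_ntrace assms)
  from gram_derivation_mult[OF this Cons.IH]
  show ?case
    unfolding list.size(4) add_0_right Nat.add_Suc_right sum.lessThan_Suc_shift
    by (simp add: trace_product_def[abs_def] sum_distrib_left ac_simps)
qed

lemma sum_sum_factor:
  fixes f g :: "nat \<Rightarrow> complex"
  shows "(\<Sum>i\<in>S. \<Sum>j\<in>S. f j * g i * y) = (\<Sum>j\<in>S. f j) * (\<Sum>i\<in>S. g i) * y"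
  by (subst sum.swap) (simp only: sum_distrib_right[symmetric] sum_distrib_left[symmetric])

text \<open>Integration by parts in the first \<open>Gram\<close> letter of a word. Its partner is the letter itself (first
  term), another letter of the same word, which cuts the trace into two (second term), or a letter of
  another trace, which joins the two traces at the price of a factor \<open>N\<^sup>-\<^sup>2\<close> (third term). In every term
  one \<open>Gram\<close> letter has disappeared, which drives all later inductions.\<close>

lemma loop_equation:
  fixes c us
  defines "Y \<equiv> trace_product h N c"
  shows "expectation (\<lambda>w. tr (Gram k l l' # u) w * Y us w)
    = moment_R k * expectation (\<lambda>w. tr (Shift l l' # u) w * Y us w)
    + (\<Sum>(u1, k', r, r', u2)\<leftarrow>splits u.
        expectation (\<lambda>w. tr (u1 @ [Gram (k + k') r l']) w * tr (Shift l r' # u2) w * Y us w))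
    + (\<Sum>p<length us. \<Sum>(u1, k', r, r', u2)\<leftarrow>splits (us ! p).
        expectation (\<lambda>w. tr (u @ Shift l r' # u2 @ u1 @ [Gram (k + k') r l']) w * Y (remove_nth p us) w)) / of_nat (N^2)"
proof -
  define F where "F i j w = entry h N u j i w * Y us w" for i j w
  define G1 where "G1 i j w = (\<Sum>(u1, k', r, r', u2)\<leftarrow>splits u.
      entry h N (u1 @ [Gram (k + k') r l']) j j w * entry h N (Shift l r' # u2) i i w) * Y us w" for i j w
  define G2 where "G2 i j w = entry h N u j i w * (\<Sum>p<length us. (\<Sum>(u1, k', r, r', u2)\<leftarrow>splits (us ! p).
      entry h N (Shift l r' # u2 @ u1 @ [Gram (k + k') r l']) i j w) / of_nat N
        * Y (remove_nth p us) w)" for i j w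
  note poly = polynomial_intros polynomial_entry polynomial_trace_product[of c, folded Y_def] polynomial_ntrace
    polynomial_gram
  have polyF: "polynomial (F i j)" for i j
    unfolding F_def by (intro poly)
  have poly1: "polynomial (G1 i j)" and poly2: "polynomial (G2 i j)" for i j
    unfolding G1_def G2_def case_prod_unfold by (intro poly)+
  have step: "expectation (\<lambda>w. h k (i + l) (j + l') w * F i j w)
      = of_bool (i + l = j + l') * moment_R k * expectation (F i j)
        + (expectation (G1 i j) + expectation (G2 i j)) / of_nat N" if "i < N" "j < N" for i j
  proof -
    have "gram_derivation k (i + l) (j + l') (F i j) (\<lambda>w. G1 i j w + G2 i j w)"
      unfolding F_def G1_def G2_def Y_def
      by (intro gram_derivation_mult gram_derivation_entry gram_derivation_trace_product that)
    from gram_IBP(2)[OF this polyF] show ?thesis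
      by (simp add: polynomial_integrable poly1 poly2)
  qed
  have "expectation (\<lambda>w. tr (Gram k l l' # u) w * Y us w)
    = expectation (\<lambda>w. (\<Sum>i<N. \<Sum>j<N. h k (i + l) (j + l') w * F i j w) / of_nat N)"
    by (simp add: ntrace_def F_def sum_distrib_right mult.assoc)
  also have "\<dots> = (\<Sum>i<N. \<Sum>j<N. expectation (\<lambda>w. h k (i + l) (j + l') w * F i j w)) / of_nat N"
    by (simp add: polynomial_integrable poly polyF)
  also have "\<dots> = (\<Sum>i<N. \<Sum>j<N. of_bool (i + l = j + l') * moment_R k * expectation (F i j)
        + (expectation (G1 i j) + expectation (G2 i j)) / of_nat N) / of_nat N"
    by (simp add: step)
  also have "\<dots> = moment_R k * ((\<Sum>i<N. \<Sum>j<N. of_bool (i + l = j + l') * expectation (F i j)) / of_nat N)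
      + (\<Sum>i<N. \<Sum>j<N. expectation (G1 i j)) / of_nat (N^2)
      + (\<Sum>i<N. \<Sum>j<N. expectation (G2 i j)) / of_nat (N^2)"
    by (simp add: sum.distrib sum_divide_distrib sum_distrib_left add_divide_distrib power2_eq_square ac_simps)
  also have "(\<Sum>i<N. \<Sum>j<N. of_bool (i + l = j + l') * expectation (F i j)) / of_nat N
      = expectation (\<lambda>w. tr (Shift l l' # u) w * Y us w)"
  proof -
    have "expectation (\<lambda>w. tr (Shift l l' # u) w * Y us w)
        = expectation (\<lambda>w. (\<Sum>i<N. \<Sum>j<N. of_bool (i + l = j + l') * F i j w) / of_nat N)"
      by (simp add: ntrace_def F_def sum_distrib_right mult.assoc)
    then show ?thesis by (simp add: polynomial_integrable poly polyF)
  qed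
  also have "(\<Sum>i<N. \<Sum>j<N. expectation (G1 i j)) / of_nat (N^2)
      = (\<Sum>(u1, k', r, r', u2)\<leftarrow>splits u.
        expectation (\<lambda>w. tr (u1 @ [Gram (k + k') r l']) w * tr (Shift l r' # u2) w * Y us w))"
  proof -
    have "(\<Sum>i<N. \<Sum>j<N. expectation (G1 i j)) / of_nat (N^2)
        = expectation (\<lambda>w. (\<Sum>i<N. \<Sum>j<N. G1 i j w) / of_nat (N^2))"
      by (simp add: polynomial_integrable poly1)
    also have "(\<lambda>w. (\<Sum>i<N. \<Sum>j<N. G1 i j w) / of_nat (N^2)) = (\<lambda>w. \<Sum>(u1, k', r, r', u2)\<leftarrow>splits u.
        tr (u1 @ [Gram (k + k') r l']) w * tr (Shift l r' # u2) w * Y us w)"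
    proof (rule ext)
      fix w
      show "(\<Sum>i<N. \<Sum>j<N. G1 i j w) / of_nat (N^2) = (\<Sum>(u1, k', r, r', u2)\<leftarrow>splits u.
        tr (u1 @ [Gram (k + k') r l']) w * tr (Shift l r' # u2) w * Y us w)"
        unfolding G1_def case_prod_unfold sum_list_mult_const[symmetric] sum_sum_list_swap sum_list_divide
        unfolding ntrace_def sum_sum_factor by (simp add: power2_eq_square del: entry.simps)
    qed
    finally show ?thesis
      by (subst (asm) expectation_sum_list) (auto intro!: poly simp: case_prod_unfold)
  qed
  also have "(\<Sum>i<N. \<Sum>j<N. expectation (G2 i j)) / of_nat (N^2)
    = (\<Sum>p<length us. \<Sum>(u1, k', r, r', u2)\<leftarrow>splits (us ! p).
        expectation (\<lambda>w. tr (u @ Shift l r' # u2 @ u1 @ [Gram (k + k') r l']) w * Y (remove_nth p us) w)) / of_nat (N^2)"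
  proof -
    have "(\<Sum>i<N. \<Sum>j<N. expectation (G2 i j)) = expectation (\<lambda>w. \<Sum>i<N. \<Sum>j<N. G2 i j w)"
      by (simp add: polynomial_integrable poly2)
    also have "(\<lambda>w. \<Sum>i<N. \<Sum>j<N. G2 i j w) = (\<lambda>w. \<Sum>p<length us. \<Sum>(u1, k', r, r', u2)\<leftarrow>splits (us ! p).
        tr (u @ Shift l r' # u2 @ u1 @ [Gram (k + k') r l']) w * Y (remove_nth p us) w)"
    proof (rule ext)
      fix w
      have "(\<Sum>i<N. \<Sum>j<N. G2 i j w) = (\<Sum>p<length us. \<Sum>i<N. \<Sum>j<N. entry h N u j i w *
        ((\<Sum>(u1, k', r, r', u2)\<leftarrow>splits (us ! p).
          entry h N (Shift l r' # u2 @ u1 @ [Gram (k + k') r l']) i j w) / of_nat N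
            * Y (remove_nth p us) w))"
        unfolding G2_def sum_distrib_left
        by (simp only: sum.swap[of _ "{..<N}" "{..<length us}"])
      also have "\<dots> = (\<Sum>p<length us. \<Sum>(u1, k', r, r', u2)\<leftarrow>splits (us ! p).
        tr (u @ Shift l r' # u2 @ u1 @ [Gram (k + k') r l']) w * Y (remove_nth p us) w)"
      proof (rule sum.cong[OF refl])
        fix p
        show "(\<Sum>i<N. \<Sum>j<N. entry h N u j i w *
            ((\<Sum>(u1, k', r, r', u2)\<leftarrow>splits (us ! p).
              entry h N (Shift l r' # u2 @ u1 @ [Gram (k + k') r l']) i j w) / of_nat N
                * Y (remove_nth p us) w))
          = (\<Sum>(u1, k', r, r', u2)\<leftarrow>splits (us ! p).
            tr (u @ Shift l r' # u2 @ u1 @ [Gram (k + k') r l']) w * Y (remove_nth p us) w)"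
          unfolding case_prod_unfold sum_list_mult_const[symmetric] sum_list_const_mult[symmetric]
            sum_sum_list_swap sum_list_divide ntrace_append
          by (subst sum.swap) (simp only: sum_divide_distrib sum_distrib_right sum_distrib_left
            times_divide_eq_left times_divide_eq_right mult.assoc)
      qed
      finally show "(\<Sum>i<N. \<Sum>j<N. G2 i j w) = (\<Sum>p<length us. \<Sum>(u1, k', r, r', u2)\<leftarrow>splits (us ! p).
        tr (u @ Shift l r' # u2 @ u1 @ [Gram (k + k') r l']) w * Y (remove_nth p us) w)" .
    qed
    finally have "(\<Sum>i<N. \<Sum>j<N. expectation (G2 i j)) = (\<Sum>p<length us.
      expectation (\<lambda>w. \<Sum>(u1, k', r, r', u2)\<leftarrow>splits (us ! p).
        tr (u @ Shift l r' # u2 @ u1 @ [Gram (k + k') r l']) w * Y (remove_nth p us) w))"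
      by (simp add: polynomial_integrable poly case_prod_unfold)
    then show ?thesis
      by (subst (asm) expectation_sum_list) (auto intro!: poly simp: case_prod_unfold)
  qed
  finally show ?thesis by simp
qed

end

section \<open>Size of centered products of traces\<close>

text \<open>The amount by which a letter displaces the index; multiplying the \<open>n\<close>-th Gaussian vector by
  \<open>e\<^sup>i\<^sup>n\<^sup>\<theta>\<close> multiplies the trace of a word of weight \<open>d\<close> by \<open>e\<^sup>i\<^sup>d\<^sup>\<theta>\<close>.\<close>

fun letter_weight :: "letter \<Rightarrow> int" where
  "letter_weight (Gram k l l') = int l' - int l"
| "letter_weight (Shift l l') = int l' - int l"

definition weight :: "letter list \<Rightarrow> int" where
  "weight u = (\<Sum>x\<leftarrow>u. letter_weight x)"

fun letter_degree :: "letter \<Rightarrow> nat" where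
  "letter_degree (Gram k l l') = 1"
| "letter_degree (Shift l l') = 0"

definition gram_degree :: "letter list \<Rightarrow> nat" where
  "gram_degree u = (\<Sum>x\<leftarrow>u. letter_degree x)"

lemma weight_simps [simp]: "weight [] = 0" "weight (x # u) = letter_weight x + weight u"
    "weight (u @ v) = weight u + weight v"
  by (simp_all add: weight_def)

lemma gram_degree_simps [simp]: "gram_degree [] = 0" "gram_degree (x # u) = letter_degree x + gram_degree u"
    "gram_degree (u @ v) = gram_degree u + gram_degree v"
  by (simp_all add: gram_degree_def)

lemma splits_append: "(u1, k, r, r', u2) \<in> set (splits u) \<Longrightarrow> u = u1 @ Gram k r r' # u2"
  by (induction u arbitrary: u1 rule: splits.induct) auto

lemma gram_degree_pos_split: "gram_degree u > 0 \<Longrightarrow> \<exists>u1 k r r' u2. u = u1 @ Gram k r r' # u2"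
proof (induction u)
  case (Cons x u)
  then show ?case
  proof (cases x)
    case (Gram k r r')
    then show ?thesis by (intro exI[of _ "[]"]) auto
  next
    case (Shift r r')
    with Cons obtain u1 k s s' u2 where "u = u1 @ Gram k s s' # u2" by auto
    then show ?thesis by (intro exI[of _ "x # u1"]) auto
  qed
qed simp

lemma remove_nth_sum_list:
  fixes f :: "'a \<Rightarrow> 'b :: comm_monoid_add"
  shows "p < length us \<Longrightarrow> (\<Sum>u\<leftarrow>us. f u) = f (us ! p) + (\<Sum>u\<leftarrow>remove_nth p us. f u)"
  by (subst id_take_nth_drop[of p us]) (auto simp: remove_nth_def ac_simps)

lemma length_remove_nth: "p < length us \<Longrightarrow> length (remove_nth p us) = length us - 1"
  by (auto simp: remove_nth_def)

lemma sum_list_eq_0: "(\<And>x. x \<in> set xs \<Longrightarrow> f x = 0) \<Longrightarrow> (\<Sum>x\<leftarrow>xs. f x) = (0 :: 'a :: comm_monoid_add)"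
  by (induction xs) auto

lemma trace_product_Cons: "trace_product h N c (u # us) w = (ntrace h N u w - c u) * trace_product h N c us w"
  by (simp add: trace_product_def)

lemma trace_product_middle:
  "trace_product h N c (us @ u # vs) w = (ntrace h N u w - c u) * trace_product h N c (us @ vs) w"
  by (simp add: trace_product_def)

lemma entry_weight:
  "gram_degree u = 0 \<Longrightarrow> entry h N u i j w \<noteq> 0 \<Longrightarrow> int i - int j = weight u"
proof (induction u arbitrary: i)
  case (Cons x u)
  then obtain l l' where x: "x = Shift l l'" by (cases x) auto
  from Cons(3) obtain s where "letter_entry h x i s w * entry h N u s j w \<noteq> 0"
    by (auto elim: sum.not_neutral_contains_not_neutral)
  then show ?case using Cons(1)[of s] Cons(2) x by auto
qed (auto split: if_splits)

lemma ntrace_weight: "gram_degree u = 0 \<Longrightarrow> weight u \<noteq> 0 \<Longrightarrow> ntrace h N u w = 0"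
  unfolding ntrace_def using entry_weight[of u h N i i w for i] by (subst sum.neutral) auto

lemma entry_deterministic: "gram_degree u = 0 \<Longrightarrow> entry h N u i j w = entry h N u i j w'"
proof (induction u arbitrary: i)
  case (Cons x u)
  then obtain l l' where x: "x = Shift l l'" by (cases x) auto
  then show ?case using Cons by simp
qed simp

text \<open>Products of shifts are partial permutation matrices.\<close>

lemma entry_row_sum: "gram_degree u = 0 \<Longrightarrow> (\<Sum>j<N. norm (entry h N u i j w)) \<le> 1"
proof (induction u arbitrary: i)
  case Nil
  have "(\<Sum>j<N. norm (entry h N [] i j w)) = (\<Sum>j<N. if i = j then 1 else 0)"
    by (intro sum.cong) auto
  then show ?case by simp
next
  case (Cons x u)
  then obtain l l' where x: "x = Shift l l'" by (cases x) auto
  have "(\<Sum>j<N. norm (entry h N (x # u) i j w)) \<le> (\<Sum>j<N. \<Sum>s<N. of_bool (i + l = s + l') * norm (entry h N u s j w))"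
    unfolding x by (intro sum_mono) (auto intro!: sum_norm_le simp: norm_mult)
  also have "\<dots> = (\<Sum>s<N. of_bool (i + l = s + l') * (\<Sum>j<N. norm (entry h N u s j w)))"
    by (subst sum.swap) (simp add: sum_distrib_left)
  also have "\<dots> \<le> (\<Sum>s<N. of_bool (s = i + l - l') * 1)"
    using Cons by (intro sum_mono mult_mono sum_nonneg) auto
  also have "\<dots> \<le> 1" by (simp add: of_bool_def)
  finally show ?case .
qed

lemma ntrace_deterministic_bound: "gram_degree u = 0 \<Longrightarrow> norm (ntrace h N u w) \<le> 1"
proof -
  assume u: "gram_degree u = 0"
  have "norm (\<Sum>i<N. entry h N u i i w) \<le> (\<Sum>i<N. 1)"
  proof (rule sum_norm_le)
    fix i assume "i \<in> {..<N}"
    then have "norm (entry h N u i i w) \<le> (\<Sum>j<N. norm (entry h N u i j w))"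
      by (intro member_le_sum) auto
    then show "norm (entry h N u i i w) \<le> 1" using entry_row_sum[OF u, of h N i w] by simp
  qed
  then show ?thesis by (auto simp: ntrace_def norm_divide divide_le_eq)
qed

lemma ntrace_deterministic: "gram_degree u = 0 \<Longrightarrow> ntrace h N u w = ntrace h N u w'"
  unfolding ntrace_def by (intro arg_cong2[where f = "(/)"] sum.cong refl entry_deterministic)

lemma trace_product_eq_0: "u \<in> set us \<Longrightarrow> ntrace h N u w = c u \<Longrightarrow> trace_product h N c us w = 0"
  by (auto dest!: split_list simp: trace_product_middle)

definition mean :: "'w measure \<Rightarrow> (nat \<Rightarrow> nat \<Rightarrow> nat \<Rightarrow> 'w \<Rightarrow> complex) \<Rightarrow> nat \<Rightarrow> letter list \<Rightarrow> complex" where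
  "mean \<Omega> h N u = integral\<^sup>L \<Omega> (ntrace h N u)"

text \<open>The joint central moments of normalized traces.\<close>

definition central :: "'w measure \<Rightarrow> (nat \<Rightarrow> nat \<Rightarrow> nat \<Rightarrow> 'w \<Rightarrow> complex) \<Rightarrow> nat \<Rightarrow> letter list list \<Rightarrow> complex" where
  "central \<Omega> h N us = integral\<^sup>L \<Omega> (trace_product h N (mean \<Omega> h N) us)"

context gaussian_gram
begin

text \<open>Every term of the loop equation preserves the total weight. Without \<open>Gram\<close> letters, a word of nonzero
  weight has a zero diagonal.\<close>

lemma expectation_weight:
  "(\<Sum>u\<leftarrow>us. weight u) \<noteq> 0 \<Longrightarrow> expectation (trace_product h N (\<lambda>_. 0) us) = 0"
proof (induction "\<Sum>u\<leftarrow>us. gram_degree u" arbitrary: us rule: less_induct)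
  case less
  show ?case
  proof (cases "\<exists>u\<in>set us. gram_degree u > 0")
    case True
    then obtain u where u_in: "u \<in> set us" and deg_u: "gram_degree u > 0" by blast
    obtain us1 us2 where us: "us = us1 @ u # us2" using split_list[OF u_in] by blast
    obtain v1 k l l' v2 where u: "u = v1 @ Gram k l l' # v2"
      using gram_degree_pos_split[OF deg_u] by blast
    define v where "v = v2 @ v1"
    define vs where "vs = us1 @ us2"
    note wt = less(2)
    have IH: "expectation (\<lambda>w. tr x w * trace_product h N (\<lambda>_. 0) xs w) = 0"
      if "gram_degree x + (\<Sum>u\<leftarrow>xs. gram_degree u) < (\<Sum>u\<leftarrow>us. gram_degree u)" "weight x + (\<Sum>u\<leftarrow>xs. weight u) \<noteq> 0" for x xs
      using less(1)[of "x # xs"] that by (simp add: trace_product_Cons[abs_def])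
    have IH2: "expectation (\<lambda>w. tr x w * tr y w * trace_product h N (\<lambda>_. 0) xs w) = 0"
      if "gram_degree x + gram_degree y + (\<Sum>u\<leftarrow>xs. gram_degree u) < (\<Sum>u\<leftarrow>us. gram_degree u)"
        "weight x + weight y + (\<Sum>u\<leftarrow>xs. weight u) \<noteq> 0" for x y xs
      using less(1)[of "x # y # xs"] that by (simp add: trace_product_Cons[abs_def] mult.assoc add.assoc)
    have eq: "trace_product h N (\<lambda>_. 0) us = (\<lambda>w. tr (Gram k l l' # v) w * trace_product h N (\<lambda>_. 0) vs w)"
      using ntrace_rotate[of h N v1 "Gram k l l' # v2"]
      by (auto simp: us u v_def vs_def trace_product_middle)
    have "expectation (\<lambda>w. tr (Gram k l l' # v) w * trace_product h N (\<lambda>_. 0) vs w) = 0"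
    proof -
      have 1: "expectation (\<lambda>w. tr (Shift l l' # v) w * trace_product h N (\<lambda>_. 0) vs w) = 0"
        using wt by (intro IH) (auto simp: us u v_def vs_def)
      have 2: "(\<Sum>(u1, k', r, r', u2)\<leftarrow>splits v. expectation (\<lambda>w. tr (u1 @ [Gram (k + k') r l']) w
          * tr (Shift l r' # u2) w * trace_product h N (\<lambda>_. 0) vs w)) = 0"
      proof (intro sum_list_eq_0, safe)
        fix u1 k' r r' u2 assume "(u1, k', r, r', u2) \<in> set (splits v)"
        from arg_cong[OF splits_append[OF this], of gram_degree] arg_cong[OF splits_append[OF this], of weight]
        show "expectation (\<lambda>w. tr (u1 @ [Gram (k + k') r l']) w
          * tr (Shift l r' # u2) w * trace_product h N (\<lambda>_. 0) vs w) = 0"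
          using wt by (intro IH2) (auto simp: us u v_def vs_def)
      qed
      have 3: "(\<Sum>p<length vs. \<Sum>(u1, k', r, r', u2)\<leftarrow>splits (vs ! p). expectation (\<lambda>w.
          tr (v @ Shift l r' # u2 @ u1 @ [Gram (k + k') r l']) w * trace_product h N (\<lambda>_. 0) (remove_nth p vs) w)) = 0"
      proof (intro sum.neutral ballI sum_list_eq_0, safe)
        fix p u1 k' r r' u2 assume p: "p < length vs" and "(u1, k', r, r', u2) \<in> set (splits (vs ! p))"
        from arg_cong[OF splits_append[OF this(2)], of gram_degree] arg_cong[OF splits_append[OF this(2)], of weight]
        show "expectation (\<lambda>w. tr (v @ Shift l r' # u2 @ u1 @ [Gram (k + k') r l']) w
            * trace_product h N (\<lambda>_. 0) (remove_nth p vs) w) = 0"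
          using wt remove_nth_sum_list[OF p, of gram_degree] remove_nth_sum_list[OF p, of weight]
          by (intro IH) (auto simp: us u v_def vs_def)
      qed
      show ?thesis unfolding loop_equation 1 2 3 by simp
    qed
    then show ?thesis unfolding eq .
  next
    case False
    moreover obtain u where "u \<in> set us" "weight u \<noteq> 0"
      using less(2) sum_list_eq_0[of us weight] by blast
    ultimately have "trace_product h N (\<lambda>_. 0) us = (\<lambda>w. 0)"
      using ntrace_weight[of u h N] by (auto intro!: trace_product_eq_0[of u])
    then show ?thesis by simp
  qed
qed

lemma mean_weight: "weight u \<noteq> 0 \<Longrightarrow> mean \<Omega> h N u = 0"
  using expectation_weight[of "[u]"] by (simp add: mean_def trace_product_def[abs_def])

abbreviation "e \<equiv> mean \<Omega> h N"
abbreviation "F \<equiv> central \<Omega> h N"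
abbreviation "Y \<equiv> trace_product h N e"

lemma central_Nil: "F [] = 1"
  by (simp add: central_def trace_product_def[abs_def] prob_space)

lemma central_singleton: "F [u] = 0"
  by (simp add: central_def trace_product_def[abs_def] mean_def polynomial_integrable polynomial_ntrace prob_space)

lemma central_deterministic:
  assumes "u \<in> set us" "gram_degree u = 0" shows "F us = 0"
proof -
  have "ntrace h N u w = e u" for w
  proof -
    have "ntrace h N u = (\<lambda>_. ntrace h N u w)"
      by (rule ext) (rule ntrace_deterministic[OF assms(2)])
    then have "e u = expectation (\<lambda>_. ntrace h N u w)" unfolding mean_def by metis
    then show ?thesis by (simp add: prob_space)
  qed
  then have "Y us = (\<lambda>w. 0)"
    using assms(1) by (intro ext trace_product_eq_0)
  then show ?thesis by (simp add: central_def)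
qed

lemma expectation_one: "expectation (\<lambda>w. tr u w * Y us w) = F (u # us) + e u * F us"
proof -
  have "(\<lambda>w. tr u w * Y us w) = (\<lambda>w. Y (u # us) w + e u * Y us w)"
    by (auto simp: trace_product_Cons algebra_simps)
  then show ?thesis
    by (simp add: central_def polynomial_integrable polynomial_trace_product)
qed

lemma expectation_two:
  "expectation (\<lambda>w. tr u w * tr v w * Y us w)
    = F (u # v # us) + e u * F (v # us) + e v * F (u # us) + e u * e v * F us"
proof -
  have "(\<lambda>w. tr u w * tr v w * Y us w)
      = (\<lambda>w. Y (u # v # us) w + e u * Y (v # us) w + e v * Y (u # us) w + e u * e v * Y us w)"
    by (auto simp: trace_product_Cons algebra_simps)
  then show ?thesis
    by (simp add: central_def polynomial_integrable polynomial_trace_product)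
qed

lemma mean_loop:
  "e (Gram k l l' # u) = moment_R k * e (Shift l l' # u)
    + (\<Sum>(u1, k', r, r', u2)\<leftarrow>splits u. F [u1 @ [Gram (k + k') r l'], Shift l r' # u2]
      + e (u1 @ [Gram (k + k') r l']) * e (Shift l r' # u2))"
  using loop_equation[of k l l' u e "[]"] unfolding expectation_one expectation_two
  by (simp add: central_singleton central_Nil)

text \<open>The loop equation for centered traces: the products of the means of two pieces cancel against the
  loop equation of the mean itself, and in each remaining term every factor is centered.\<close>

lemma central_loop:
  "F ((Gram k l l' # u) # us) = moment_R k * F ((Shift l l' # u) # us)
    + (\<Sum>(u1, k', r, r', u2)\<leftarrow>splits u.
        let x = u1 @ [Gram (k + k') r l']; y = Shift l r' # u2
        in F (x # y # us) + e x * F (y # us) + e y * F (x # us) - F [x, y] * F us)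
    + (\<Sum>p<length us. \<Sum>(u1, k', r, r', u2)\<leftarrow>splits (us ! p).
        let x = u @ Shift l r' # u2 @ u1 @ [Gram (k + k') r l']
        in F (x # remove_nth p us) + e x * F (remove_nth p us)) / of_nat (N^2)"
proof -
  have *: "(\<Sum>(u1, k', r, r', u2)\<leftarrow>xs. f u1 k' r r' u2) * c = (\<Sum>(u1, k', r, r', u2)\<leftarrow>xs. f u1 k' r r' u2 * c)"
    "(\<Sum>(u1, k', r, r', u2)\<leftarrow>xs. f u1 k' r r' u2) - (\<Sum>(u1, k', r, r', u2)\<leftarrow>xs. g u1 k' r r' u2)
      = (\<Sum>(u1, k', r, r', u2)\<leftarrow>xs. f u1 k' r r' u2 - g u1 k' r r' u2)"
    for f g :: "letter list \<Rightarrow> nat \<Rightarrow> nat \<Rightarrow> nat \<Rightarrow> letter list \<Rightarrow> complex" and c xs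
    by (induction xs) (auto simp: algebra_simps)
  \<comment> \<open>Linear expansion of the centered factor; the means are then expanded by their own loop equation.\<close>
  have "F ((Gram k l l' # u) # us)
      = expectation (\<lambda>w. tr (Gram k l l' # u) w * Y us w) - e (Gram k l l' # u) * F us"
    by (simp add: expectation_one)
  also have "\<dots> = moment_R k * F ((Shift l l' # u) # us)
    + ((\<Sum>(u1, k', r, r', u2)\<leftarrow>splits u. expectation (\<lambda>w. tr (u1 @ [Gram (k + k') r l']) w * tr (Shift l r' # u2) w * Y us w))
       - (\<Sum>(u1, k', r, r', u2)\<leftarrow>splits u. F [u1 @ [Gram (k + k') r l'], Shift l r' # u2]
          + e (u1 @ [Gram (k + k') r l']) * e (Shift l r' # u2)) * F us)
    + (\<Sum>p<length us. \<Sum>(u1, k', r, r', u2)\<leftarrow>splits (us ! p).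
        expectation (\<lambda>w. tr (u @ Shift l r' # u2 @ u1 @ [Gram (k + k') r l']) w * Y (remove_nth p us) w)) / of_nat (N^2)"
    unfolding loop_equation mean_loop expectation_one by (simp add: algebra_simps)
  finally show ?thesis
    unfolding * expectation_one expectation_two Let_def by (simp add: algebra_simps)
qed

end

locale gram_sequence = prob_space \<Omega> for \<Omega> :: "'w measure" +
  fixes m :: "nat \<Rightarrow> nat" and Z :: "nat \<Rightarrow> nat \<times> nat \<Rightarrow> 'w \<Rightarrow> complex"
    and P :: "nat \<Rightarrow> nat \<Rightarrow> nat \<Rightarrow> nat \<Rightarrow> complex" and \<rho> :: "nat \<Rightarrow> complex"
  assumes gaussian_gram: "\<And>N. N \<ge> 1 \<Longrightarrow> gaussian_gram \<Omega> (m N) (Z N) N (P N)"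
    and moments: "\<And>k. (\<lambda>N. (\<Sum>a<m N. P N k a a) / of_nat N) \<longlonglongrightarrow> \<rho> k"
    and P_cnj: "\<And>N k a b. N \<ge> 1 \<Longrightarrow> a < m N \<Longrightarrow> b < m N \<Longrightarrow> P N k b a = cnj (P N k a b)"
begin

definition h :: "nat \<Rightarrow> nat \<Rightarrow> nat \<Rightarrow> nat \<Rightarrow> 'w \<Rightarrow> complex" where
  "h N = gram (m N) N (P N) (Z N)"

text \<open>The means and joint central moments of traces, and the normalized traces of the powers of the
  covariance, with their dependence on \<open>N\<close> made explicit.\<close>

definition e :: "nat \<Rightarrow> letter list \<Rightarrow> complex" where "e N = mean \<Omega> (h N) N"
definition F :: "nat \<Rightarrow> letter list list \<Rightarrow> complex" where "F N = central \<Omega> (h N) N"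
definition mom :: "nat \<Rightarrow> nat \<Rightarrow> complex" where "mom N k = (\<Sum>a<m N. P N k a a) / of_nat N"

lemma mom_bigo: "(\<lambda>N. mom N k) \<in> O(\<lambda>_. 1)"
proof -
  have "convergent (\<lambda>N. mom N k)" using moments[of k] by (auto simp: convergent_def mom_def)
  then have "Bseq (\<lambda>N. mom N k)" by (rule convergent_imp_Bseq)
  then obtain K where "\<And>N. norm (mom N k) \<le> K" by (auto simp: Bseq_def)
  then show ?thesis by (intro bigoI[of _ K]) auto
qed

abbreviation rate :: "nat \<Rightarrow> nat \<Rightarrow> complex" where "rate s N \<equiv> 1 / of_nat N ^ s"

lemma rate_mono: "s \<le> t \<Longrightarrow> rate t \<in> O(rate s)"
proof (rule bigoI[of _ 1])
  assume st: "s \<le> t"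
  have "norm (rate t N) \<le> 1 * norm (rate s N)" if "N \<ge> 1" for N
    using that st by (simp add: norm_divide norm_power frac_le power_increasing)
  then show "\<forall>\<^sub>F N in sequentially. norm (rate t N) \<le> 1 * norm (rate s N)"
    by (rule eventually_sequentiallyI[of 1])
qed

lemma rate_mult: "f \<in> O(rate s) \<Longrightarrow> g \<in> O(rate t) \<Longrightarrow> r \<le> s + t \<Longrightarrow> (\<lambda>N. f N * g N) \<in> O(rate r)"
proof -
  assume fg: "f \<in> O(rate s)" "g \<in> O(rate t)" and r: "r \<le> s + t"
  have "(\<lambda>N. f N * g N) \<in> O(\<lambda>N. rate s N * rate t N)" using fg by (rule landau_o.big.mult)
  also have "(\<lambda>N. rate s N * rate t N) = rate (s + t)" by (simp add: power_add)
  also have "rate (s + t) \<in> O(rate r)" by (rule rate_mono[OF r])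
  finally show ?thesis .
qed

lemma rate_sum_splits:
  "(\<And>u1 k r r' u2. (u1, k, r, r', u2) \<in> set xs \<Longrightarrow> (\<lambda>N. f N u1 k r r' u2) \<in> O(rate s)) \<Longrightarrow>
    (\<lambda>N. \<Sum>(u1, k, r, r', u2)\<leftarrow>xs. f N u1 k r r' u2) \<in> O(rate s)"
  by (induction xs) (auto intro: sum_in_bigo)

lemma rate_cong: "(\<And>N. N \<ge> 1 \<Longrightarrow> f N = g N) \<Longrightarrow> g \<in> O(rate r) \<Longrightarrow> f \<in> O(rate r)"
  by (subst landau_o.big.in_cong[of f g]) (auto intro: eventually_sequentiallyI[of 1])

lemma e_rotate: "e N (u @ v) = e N (v @ u)"
  unfolding e_def mean_def by (subst ntrace_rotate[abs_def]) simp

lemma F_rotate: "F N ((u @ v) # us) = F N ((v @ u) # us)"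
proof -
  have "ntrace (h N) N (u @ v) = ntrace (h N) N (v @ u)" by (rule ext, rule ntrace_rotate)
  then show ?thesis
    unfolding F_def central_def using e_rotate[of N u v]
    by (simp add: trace_product_Cons[abs_def] e_def)
qed

lemma mean_loop:
  "N \<ge> 1 \<Longrightarrow> e N (Gram k l l' # u) = mom N k * e N (Shift l l' # u)
    + (\<Sum>(u1, k', r, r', u2)\<leftarrow>splits u. F N [u1 @ [Gram (k + k') r l'], Shift l r' # u2]
      + e N (u1 @ [Gram (k + k') r l']) * e N (Shift l r' # u2))"
  unfolding e_def F_def h_def mom_def
  using gaussian_gram.mean_loop[OF gaussian_gram[of N]] gaussian_gram.moment_R_def[OF gaussian_gram[of N]]
  by simp

lemma central_loop:
  "N \<ge> 1 \<Longrightarrow> F N ((Gram k l l' # u) # us) = mom N k * F N ((Shift l l' # u) # us)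
    + (\<Sum>(u1, k', r, r', u2)\<leftarrow>splits u.
        let x = u1 @ [Gram (k + k') r l']; y = Shift l r' # u2
        in F N (x # y # us) + e N x * F N (y # us) + e N y * F N (x # us) - F N [x, y] * F N us)
    + (\<Sum>p<length us. \<Sum>(u1, k', r, r', u2)\<leftarrow>splits (us ! p).
        let x = u @ Shift l r' # u2 @ u1 @ [Gram (k + k') r l']
        in F N (x # remove_nth p us) + e N x * F N (remove_nth p us)) * rate 2 N"
  unfolding e_def F_def h_def mom_def
  using gaussian_gram.central_loop[OF gaussian_gram[of N]] gaussian_gram.moment_R_def[OF gaussian_gram[of N]]
  by simp

lemma e_deterministic_bound: "gram_degree u = 0 \<Longrightarrow> norm (e N u) \<le> 1"
proof -
  assume u: "gram_degree u = 0"
  obtain w where w: "w \<in> space \<Omega>" using not_empty by blast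
  have "ntrace (h N) N u = (\<lambda>_. ntrace (h N) N u w)"
    by (rule ext) (rule ntrace_deterministic[OF u])
  then have "e N u = expectation (\<lambda>_. ntrace (h N) N u w)" unfolding e_def mean_def by metis
  then show ?thesis using ntrace_deterministic_bound[OF u] by (simp add: prob_space)
qed

lemma F_deterministic: "N \<ge> 1 \<Longrightarrow> u \<in> set us \<Longrightarrow> gram_degree u = 0 \<Longrightarrow> F N us = 0"
  unfolding F_def h_def by (rule gaussian_gram.central_deterministic[OF gaussian_gram])

text \<open>Joint induction on the number of \<open>Gram\<close> letters. In the loop equation of \<open>s\<close> centered traces, cutting a
  trace gives \<open>s + 1\<close> centered traces or a bounded mean times \<open>s\<close> of them, and joining two traces leaves
  at least \<open>s - 2\<close> centered ones together with the factor \<open>N\<^sup>-\<^sup>2\<close>: each term has order \<open>N\<^sup>-\<^sup>s\<close>.\<close>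

theorem trace_bounds:
  "(gram_degree u \<le> d \<longrightarrow> (\<lambda>N. e N u) \<in> O(rate 0)) \<and>
   ((\<Sum>u\<leftarrow>us. gram_degree u) \<le> d \<longrightarrow> (\<lambda>N. F N us) \<in> O(rate (length us)))"
proof (induction d arbitrary: u us rule: less_induct)
  case (less d)
  have e_IH: "(\<lambda>N. e N u) \<in> O(rate 0)" if "gram_degree u < d" for u
    using less[of "gram_degree u" u] that by blast
  have F_IH: "(\<lambda>N. F N us) \<in> O(rate r)"
    if "(\<Sum>u\<leftarrow>us. gram_degree u) < d" "r \<le> length us" for us r
  proof -
    have "(\<lambda>N. F N us) \<in> O(rate (length us))"
      using less[of "\<Sum>u\<leftarrow>us. gram_degree u" _ us] that by blast
    then show ?thesis using rate_mono[OF that(2)] by (rule landau_o.big_trans)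
  qed
  have mom0: "(\<lambda>N. mom N k) \<in> O(rate 0)" for k using mom_bigo[of k] by simp
  have mom_F: "(\<lambda>N. mom N k * F N us) \<in> O(rate r)"
    if "(\<Sum>u\<leftarrow>us. gram_degree u) < d" "r \<le> length us" for k us r
    using rate_mult[OF mom0 F_IH[OF that]] by simp
  have e_F: "(\<lambda>N. e N u * F N us) \<in> O(rate r)"
    if "gram_degree u < d" "(\<Sum>u\<leftarrow>us. gram_degree u) < d" "r \<le> length us" for u us r
    using rate_mult[OF e_IH[OF that(1)] F_IH[OF that(2,3)]] by simp
  have F_F: "(\<lambda>N. F N us * F N vs) \<in> O(rate r)"
    if "(\<Sum>u\<leftarrow>us. gram_degree u) < d" "(\<Sum>u\<leftarrow>vs. gram_degree u) < d" "r \<le> length us + length vs" for us vs r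
    using rate_mult[OF F_IH[OF that(1) order_refl] F_IH[OF that(2) order_refl] that(3)] .
  have e_bound: "(\<lambda>N. e N u) \<in> O(rate 0)" if deg: "gram_degree u \<le> d"
  proof (cases "gram_degree u = 0")
    case True
    then show ?thesis using e_deterministic_bound by (intro bigoI[of _ 1]) auto
  next
    case False
    then obtain v1 k l l' v2 where u: "u = v1 @ Gram k l l' # v2"
      using gram_degree_pos_split by blast
    define v where "v = v2 @ v1"
    have dv: "gram_degree v < d" using deg by (simp add: u v_def)
    have "(\<lambda>N. mom N k * e N (Shift l l' # v)
      + (\<Sum>(u1, k', r, r', u2)\<leftarrow>splits v. F N [u1 @ [Gram (k + k') r l'], Shift l r' # u2]
        + e N (u1 @ [Gram (k + k') r l']) * e N (Shift l r' # u2))) \<in> O(rate 0)"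
    proof (intro sum_in_bigo(1) rate_sum_splits)
      show "(\<lambda>N. mom N k * e N (Shift l l' # v)) \<in> O(rate 0)"
        using dv by (intro rate_mult[OF mom0 e_IH]) auto
    next
      fix u1 k' r r' u2 assume "(u1, k', r, r', u2) \<in> set (splits v)"
      then have "gram_degree u1 + gram_degree u2 + 1 < d"
        using splits_append[of u1 k' r r' u2 v] dv by simp
      then show "(\<lambda>N. F N [u1 @ [Gram (k + k') r l'], Shift l r' # u2]) \<in> O(rate 0)"
        and "(\<lambda>N. e N (u1 @ [Gram (k + k') r l']) * e N (Shift l r' # u2)) \<in> O(rate 0)"
        by (intro F_IH rate_mult[OF e_IH e_IH]; simp)+
    qed
    then have "(\<lambda>N. e N (Gram k l l' # v)) \<in> O(rate 0)"
      by (rule rate_cong[rotated]) (rule mean_loop)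
    then show ?thesis using e_rotate[of _ v1 "Gram k l l' # v2"] by (simp add: u v_def)
  qed
  have F_bound: "(\<lambda>N. F N us) \<in> O(rate (length us))" if deg: "(\<Sum>u\<leftarrow>us. gram_degree u) \<le> d" for us
  proof (cases us)
    case Nil
    have "norm (F N []) \<le> 1" for N
      by (simp add: F_def central_def trace_product_def[abs_def] prob_space)
    then show ?thesis unfolding Nil by (intro bigoI[of _ 1]) auto
  next
    case (Cons u vs)
    show ?thesis
    proof (cases "gram_degree u = 0")
      case True
      have "(\<lambda>N. 0) \<in> O(rate (length us))" by simp
      then show ?thesis using F_deterministic[of _ u us] True Cons by (intro rate_cong[of "\<lambda>N. F N us"]) auto
    next
      case False
      then obtain v1 k l l' v2 where u: "u = v1 @ Gram k l l' # v2"
        using gram_degree_pos_split by blast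
      define v where "v = v2 @ v1"
      have dv: "gram_degree v + (\<Sum>u\<leftarrow>vs. gram_degree u) < d" using deg by (simp add: u v_def Cons)
      have len: "length us = Suc (length vs)" by (simp add: Cons)
      have "(\<lambda>N. mom N k * F N ((Shift l l' # v) # vs)
        + (\<Sum>(u1, k', r, r', u2)\<leftarrow>splits v.
            let x = u1 @ [Gram (k + k') r l']; y = Shift l r' # u2
            in F N (x # y # vs) + e N x * F N (y # vs) + e N y * F N (x # vs) - F N [x, y] * F N vs)
        + (\<Sum>p<length vs. \<Sum>(u1, k', r, r', u2)\<leftarrow>splits (vs ! p).
            let x = v @ Shift l r' # u2 @ u1 @ [Gram (k + k') r l']
            in F N (x # remove_nth p vs) + e N x * F N (remove_nth p vs)) * rate 2 N) \<in> O(rate (length us))"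
        unfolding Let_def
      proof (intro sum_in_bigo(1) rate_sum_splits)
        show "(\<lambda>N. mom N k * F N ((Shift l l' # v) # vs)) \<in> O(rate (length us))"
          using dv by (intro mom_F) (auto simp: len)
      next
        fix u1 k' r r' u2 assume "(u1, k', r, r', u2) \<in> set (splits v)"
        then have "gram_degree u1 + gram_degree u2 + (\<Sum>u\<leftarrow>vs. gram_degree u) + 1 < d"
          using splits_append[of u1 k' r r' u2 v] dv by simp
        then show "(\<lambda>N. F N ((u1 @ [Gram (k + k') r l']) # (Shift l r' # u2) # vs)
          + e N (u1 @ [Gram (k + k') r l']) * F N ((Shift l r' # u2) # vs)
          + e N (Shift l r' # u2) * F N ((u1 @ [Gram (k + k') r l']) # vs)
          - F N [u1 @ [Gram (k + k') r l'], Shift l r' # u2] * F N vs) \<in> O(rate (length us))"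
          by (intro sum_in_bigo F_IH e_F F_F) (auto simp: len)
      next
        have "(\<lambda>N. \<Sum>p<length vs. \<Sum>(u1, k', r, r', u2)\<leftarrow>splits (vs ! p).
            F N ((v @ Shift l r' # u2 @ u1 @ [Gram (k + k') r l']) # remove_nth p vs)
            + e N (v @ Shift l r' # u2 @ u1 @ [Gram (k + k') r l']) * F N (remove_nth p vs))
          \<in> O(rate (length vs - 1))"
        proof (intro big_sum_in_bigo rate_sum_splits)
          fix p u1 k' r r' u2 assume "p \<in> {..<length vs}" and split: "(u1, k', r, r', u2) \<in> set (splits (vs ! p))"
          then have p: "p < length vs" by simp
          have "gram_degree v + gram_degree u1 + gram_degree u2 + (\<Sum>u\<leftarrow>remove_nth p vs. gram_degree u) + 1 < d"
            using dv remove_nth_sum_list[OF p, of gram_degree] splits_append[OF split] by simp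
          then show "(\<lambda>N. F N ((v @ Shift l r' # u2 @ u1 @ [Gram (k + k') r l']) # remove_nth p vs)
            + e N (v @ Shift l r' # u2 @ u1 @ [Gram (k + k') r l']) * F N (remove_nth p vs))
            \<in> O(rate (length vs - 1))"
            by (intro sum_in_bigo F_IH e_F) (auto simp: length_remove_nth p)
        qed
        then show "(\<lambda>N. (\<Sum>p<length vs. \<Sum>(u1, k', r, r', u2)\<leftarrow>splits (vs ! p).
            F N ((v @ Shift l r' # u2 @ u1 @ [Gram (k + k') r l']) # remove_nth p vs)
            + e N (v @ Shift l r' # u2 @ u1 @ [Gram (k + k') r l']) * F N (remove_nth p vs)) * rate 2 N)
          \<in> O(rate (length us))"
          by (rule rate_mult[OF _ landau_o.big_refl]) (auto simp: len)
      qed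
      then have "(\<lambda>N. F N ((Gram k l l' # v) # vs)) \<in> O(rate (length us))"
        by (rule rate_cong[rotated]) (rule central_loop)
      then show ?thesis using F_rotate[of _ v1 "Gram k l l' # v2" vs] by (simp add: u v_def Cons)
    qed
  qed
  show ?case using e_bound F_bound by blast
qed

lemma F_bigo: "(\<lambda>N. F N us) \<in> O(rate (length us))"
  using trace_bounds[of _ "\<Sum>u\<leftarrow>us. gram_degree u" us] by blast

end

section \<open>Limits of mixed moments\<close>

lemma (in prob_space) AE_tendsto_zero_if_summable:
  fixes f :: "nat \<Rightarrow> 'a \<Rightarrow> real"
  assumes nonneg: "\<And>n x. 0 \<le> f n x" and int: "\<And>n. integrable M (f n)"
    and sum: "summable (\<lambda>n. expectation (f n))"
  shows "AE x in M. (\<lambda>n. f n x) \<longlonglongrightarrow> 0"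
proof -
  have meas: "f n \<in> borel_measurable M" for n by (rule borel_measurable_integrable[OF int])
  have "(\<integral>\<^sup>+x. (\<Sum>n. ennreal (f n x)) \<partial>M) = (\<Sum>n. \<integral>\<^sup>+x. ennreal (f n x) \<partial>M)"
    by (rule nn_integral_suminf) (use meas in measurable)
  also have "\<dots> = (\<Sum>n. ennreal (expectation (f n)))"
    by (subst nn_integral_eq_integral[OF int]) (auto simp: nonneg)
  also have "\<dots> = ennreal (\<Sum>n. expectation (f n))"
    by (rule suminf_ennreal2[OF Bochner_Integration.integral_nonneg sum]) (rule nonneg)
  finally have "(\<integral>\<^sup>+x. (\<Sum>n. ennreal (f n x)) \<partial>M) \<noteq> \<infinity>" by simp
  then have "AE x in M. (\<Sum>n. ennreal (f n x)) \<noteq> \<infinity>"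
    by (rule nn_integral_PInf_AE[rotated]) (use meas in measurable)
  then show ?thesis
  proof eventually_elim
    case (elim x)
    then have "summable (\<lambda>n. f n x)"
      by (intro summable_suminf_not_top nonneg) simp
    then show ?case by (rule summable_LIMSEQ_zero)
  qed
qed

primrec adjoint_letter :: "letter \<Rightarrow> letter" where
  "adjoint_letter (Gram k l l') = Gram k l' l"
| "adjoint_letter (Shift l l') = Shift l' l"

definition adjoint_word :: "letter list \<Rightarrow> letter list" where
  "adjoint_word u = rev (map adjoint_letter u)"

instance letter :: countable by countable_datatype

context gram_sequence
begin

abbreviation "tr N \<equiv> ntrace (h N) N"

lemma h_cnj: "N \<ge> 1 \<Longrightarrow> cnj (h N k n p w) = h N k p n w"
proof -
  assume N: "N \<ge> 1"
  have "cnj (h N k n p w) = (\<Sum>a<m N. \<Sum>b<m N. Z N (n, a) w * (cnj (P N k a b) * cnj (Z N (p, b) w))) / of_nat N"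
    by (simp add: h_def gram_def sum_distrib_left)
  also have "(\<Sum>a<m N. \<Sum>b<m N. Z N (n, a) w * (cnj (P N k a b) * cnj (Z N (p, b) w)))
      = (\<Sum>a<m N. \<Sum>b<m N. cnj (Z N (p, b) w) * (P N k b a * Z N (n, a) w))"
  proof (intro sum.cong refl)
    fix a b assume "a \<in> {..<m N}" "b \<in> {..<m N}"
    then have "P N k b a = cnj (P N k a b)" by (intro P_cnj[OF N]) auto
    then show "Z N (n, a) w * (cnj (P N k a b) * cnj (Z N (p, b) w)) = cnj (Z N (p, b) w) * (P N k b a * Z N (n, a) w)"
      by simp
  qed
  also have "\<dots> = (\<Sum>b<m N. \<Sum>a<m N. cnj (Z N (p, b) w) * (P N k b a * Z N (n, a) w))"
    by (rule sum.swap)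
  finally show ?thesis by (simp add: h_def gram_def sum_distrib_left)
qed

lemma cnj_letter: "N \<ge> 1 \<Longrightarrow> cnj (letter_entry (h N) x i j w) = letter_entry (h N) (adjoint_letter x) j i w"
  by (cases x) (auto simp: h_cnj)

lemma cnj_entry:
  "N \<ge> 1 \<Longrightarrow> i < N \<Longrightarrow> j < N \<Longrightarrow> cnj (entry (h N) N u i j w) = entry (h N) N (adjoint_word u) j i w"
proof (induction u arbitrary: i)
  case Nil
  then show ?case by (auto simp: adjoint_word_def)
next
  case (Cons x u)
  have "adjoint_word (x # u) = adjoint_word u @ [adjoint_letter x]" by (simp add: adjoint_word_def)
  then show ?case
    using Cons by (auto simp: entry_append entry_letter cnj_letter mult.commute simp del: entry.simps
        simp add: entry.simps(2)[of "h N" N x] intro!: sum.cong)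
qed

lemma cnj_trace: "N \<ge> 1 \<Longrightarrow> cnj (tr N u w) = tr N (adjoint_word u) w"
  unfolding ntrace_def by (simp add: cnj_entry)

lemma integrable_trace_product: "N \<ge> 1 \<Longrightarrow> integrable \<Omega> (trace_product (h N) N c us)"
  unfolding h_def
  by (rule complex_gaussian_family.polynomial_integrable[OF gaussian_gram.axioms(1)[OF gaussian_gram]
        gaussian_gram.polynomial_trace_product[OF gaussian_gram]])

lemma norm_centered_trace:
  assumes N: "N \<ge> 1"
  shows "complex_of_real ((norm (tr N u w - e N u))\<^sup>2) = trace_product (h N) N (mean \<Omega> (h N) N) [u, adjoint_word u] w"
proof -
  have "cnj (e N u) = e N (adjoint_word u)"
  proof -
    have "tr N (adjoint_word u) = (\<lambda>w. cnj (tr N u w))"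
      by (rule ext) (simp add: cnj_trace[OF N])
    then show ?thesis by (simp add: e_def mean_def)
  qed
  then show ?thesis
    unfolding complex_norm_square by (simp add: trace_product_def cnj_trace[OF N] flip: e_def)
qed

lemma F_tendsto_0: "us \<noteq> [] \<Longrightarrow> (\<lambda>N. F N us) \<longlonglongrightarrow> 0"
proof -
  assume "us \<noteq> []"
  then have "Suc 0 \<le> length us" by (cases us) auto
  then have "(\<lambda>N. F N us) \<in> O(rate 1)"
    using landau_o.big_trans[OF F_bigo rate_mono[of 1 "length us"]] by simp
  then obtain C where "\<forall>\<^sub>F N in sequentially. norm (F N us) \<le> C * norm (rate 1 N)" by (auto elim: landau_o.bigE)
  then have "\<forall>\<^sub>F N in sequentially. norm (F N us) \<le> C * (1 / real N)"
    by (simp add: norm_divide)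
  moreover have "(\<lambda>N. C * (1 / real N)) \<longlonglongrightarrow> 0"
    by (rule tendsto_mult_right_zero) (rule lim_1_over_n)
  ultimately show ?thesis by (rule Lim_null_comparison)
qed

text \<open>The square of the modulus of a centered trace is a product of two centered traces, because the conjugate of
  a trace is the trace of the adjoint word. Its expectation is \<open>O(N\<^sup>-\<^sup>2)\<close>, hence summable.\<close>

lemma trace_AE: "AE w in \<Omega>. \<forall>u. (\<lambda>N. tr N u w - e N u) \<longlonglongrightarrow> 0"
proof -
  have "AE w in \<Omega>. (\<lambda>N. tr N u w - e N u) \<longlonglongrightarrow> 0" for u
  proof -
  define f where "f N w = (if N = 0 then 0 else (norm (tr N u w - e N u))\<^sup>2)" for N w
  have eq: "complex_of_real (f N w) = trace_product (h N) N (mean \<Omega> (h N) N) [u, adjoint_word u] w" if "N \<ge> 1" for N w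
    using norm_centered_trace[OF that] that by (simp add: f_def)
  have int: "integrable \<Omega> (f N)" for N
  proof (cases "N \<ge> 1")
    case True
    have "integrable \<Omega> (\<lambda>w. complex_of_real (f N w))"
      using integrable_trace_product[OF True] eq[OF True] by simp
    then show ?thesis by (simp add: complex_of_real_integrable_eq)
  next
    case False
    then have "f N = (\<lambda>w. 0)" by (simp add: f_def fun_eq_iff)
    then show ?thesis by simp
  qed
  have E: "complex_of_real (expectation (f N)) = F N [u, adjoint_word u]" if "N \<ge> 1" for N
  proof -
    have "complex_of_real (expectation (f N)) = expectation (\<lambda>w. complex_of_real (f N w))" by simp
    then show ?thesis using eq[OF that] by (simp add: F_def central_def)
  qed
  obtain C where "\<forall>\<^sub>F N in sequentially. norm (F N [u, adjoint_word u]) \<le> C * norm (rate 2 N)"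
    using landau_o.bigE[OF F_bigo[of "[u, adjoint_word u]"]] by (auto simp: numeral_2_eq_2)
  then have "\<forall>\<^sub>F N in sequentially. norm (expectation (f N)) \<le> C * (inverse (real N)^2)"
    using eventually_ge_at_top[of 1]
  proof eventually_elim
    case (elim N)
    then show ?case unfolding E[OF elim(2), symmetric] norm_of_real
      by (simp add: norm_divide norm_power inverse_eq_divide power_one_over)
  qed
  moreover have "summable (\<lambda>N. C * (inverse (real N)^2))"
    using inverse_power_summable[of 2, where 'a = real] by (intro summable_mult) (simp add: power_inverse)
  ultimately have "summable (\<lambda>N. expectation (f N))" by (rule summable_comparison_test_ev)
  then have "AE w in \<Omega>. (\<lambda>N. f N w) \<longlonglongrightarrow> 0"
    by (intro AE_tendsto_zero_if_summable int) (simp add: f_def)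
  then show ?thesis
  proof eventually_elim
    case (elim w)
    then have "(\<lambda>N. sqrt (f N w)) \<longlonglongrightarrow> sqrt 0" by (intro tendsto_real_sqrt)
    moreover have "\<forall>\<^sub>F N in sequentially. sqrt (f N w) = norm (tr N u w - e N u)"
      by (rule eventually_sequentiallyI[of 1]) (simp add: f_def)
    ultimately have "(\<lambda>N. norm (tr N u w - e N u)) \<longlonglongrightarrow> 0"
      by (simp add: filterlim_cong)
    then show ?case by (rule tendsto_norm_zero_cancel)
  qed
  qed
  then show ?thesis unfolding AE_all_countable by blast
qed

end

fun list_splits :: "'a list \<Rightarrow> ('a list \<times> 'a \<times> 'a list) list" where
  "list_splits [] = []"
| "list_splits (x # u) = ([], x, u) # map (\<lambda>(u1, g). (x # u1, g)) (list_splits u)"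

lemma list_splits_append: "(u1, x, u2) \<in> set (list_splits u) \<Longrightarrow> u = u1 @ x # u2"
  by (induction u arbitrary: u1) auto

text \<open>The offsets of the windows that add up to the future (\<open>True\<close>) and to the past (\<open>False\<close>) matrix.\<close>

definition window :: "nat \<Rightarrow> bool \<Rightarrow> nat list" where
  "window L c = (if c then [L..<2 * L] else [0..<L])"

text \<open>A word in letters \<open>(c, k)\<close> stands for a product of the sums, over the windows of colour \<open>c\<close>, of
  \<open>Gram k l l\<close>; it is expanded into words of single windows. Only \<open>k = 1\<close> occurs in the matrices of
  interest, but the recursion for the limits produces all \<open>k\<close>.\<close>

fun expand :: "nat \<Rightarrow> (bool \<times> nat) list \<Rightarrow> letter list list" where
  "expand L [] = [[]]"
| "expand L ((c, k) # u) = [Gram k l l # v. l \<leftarrow> window L c, v \<leftarrow> expand L u]"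

lemma sum_list_map_concat:
  "(\<Sum>v\<leftarrow>concat (map g xs). f v) = (\<Sum>x\<leftarrow>xs. \<Sum>v\<leftarrow>g x. f v)" for f :: "'b \<Rightarrow> 'c :: comm_monoid_add"
  by (induction xs) simp_all

lemma sum_expand_Cons:
  "(\<Sum>v\<leftarrow>expand L ((c, k) # u). f v) = (\<Sum>l\<leftarrow>window L c. \<Sum>v\<leftarrow>expand L u. f (Gram k l l # v))"
  for f :: "letter list \<Rightarrow> 'a :: comm_monoid_add"
  by (simp add: sum_list_map_concat comp_def)

lemma sum_expand_append:
  "(\<Sum>v\<leftarrow>expand L (u @ u'). f v) = (\<Sum>v\<leftarrow>expand L u. \<Sum>v'\<leftarrow>expand L u'. f (v @ v'))"
  for f :: "letter list \<Rightarrow> 'a :: comm_monoid_add"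
proof (induction u arbitrary: f)
  case (Cons x u)
  obtain c k where x: "x = (c, k)" by (cases x)
  show ?case unfolding x append_Cons sum_expand_Cons Cons.IH ..
qed simp

lemma sum_list_swap:
  fixes f :: "'a \<Rightarrow> 'b \<Rightarrow> 'c :: comm_monoid_add"
  shows "(\<Sum>x\<leftarrow>xs. \<Sum>y\<leftarrow>ys. f x y) = (\<Sum>y\<leftarrow>ys. \<Sum>x\<leftarrow>xs. f x y)"
  by (induction xs) (simp_all add: sum_list_addf)

lemma expand_weight: "v \<in> set (expand L u) \<Longrightarrow> weight v = 0"
  by (induction u arbitrary: v rule: expand.induct) auto

lemma sum_expand_splits:
  fixes g :: "letter list \<Rightarrow> nat \<Rightarrow> nat \<Rightarrow> nat \<Rightarrow> letter list \<Rightarrow> 'a :: comm_monoid_add"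
  shows "(\<Sum>v\<leftarrow>expand L u. \<Sum>(v1, k, r, r', v2)\<leftarrow>splits v. g v1 k r r' v2)
    = (\<Sum>(u1, (c, k), u2)\<leftarrow>list_splits u. \<Sum>v1\<leftarrow>expand L u1. \<Sum>l\<leftarrow>window L c. \<Sum>v2\<leftarrow>expand L u2. g v1 k l l v2)"
proof (induction u arbitrary: g)
  case (Cons x u)
  obtain c k where x: "x = (c, k)" by (cases x)
  have "(\<Sum>v\<leftarrow>expand L ((c, k) # u). \<Sum>(v1, k, r, r', v2)\<leftarrow>splits v. g v1 k r r' v2)
    = (\<Sum>l\<leftarrow>window L c. \<Sum>v\<leftarrow>expand L u. g [] k l l v)
    + (\<Sum>l\<leftarrow>window L c. \<Sum>v\<leftarrow>expand L u. \<Sum>(v1, k', r, r', v2)\<leftarrow>splits v. g (Gram k l l # v1) k' r r' v2)"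
    unfolding sum_expand_Cons by (simp add: sum_list_addf comp_def case_prod_unfold)
  also have "(\<Sum>l\<leftarrow>window L c. \<Sum>v\<leftarrow>expand L u. \<Sum>(v1, k', r, r', v2)\<leftarrow>splits v. g (Gram k l l # v1) k' r r' v2)
    = (\<Sum>(u1, (c', k'), u2)\<leftarrow>list_splits u. \<Sum>v1\<leftarrow>expand L ((c, k) # u1). \<Sum>l'\<leftarrow>window L c'. \<Sum>v2\<leftarrow>expand L u2. g v1 k' l' l' v2)"
    unfolding Cons.IH sum_expand_Cons unfolding case_prod_unfold by (rule sum_list_swap)
  finally show ?case by (simp add: x comp_def case_prod_unfold del: expand.simps(2))
qed simp

context gram_sequence
begin

definition colour_mean :: "nat \<Rightarrow> nat \<Rightarrow> (bool \<times> nat) list \<Rightarrow> complex" where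
  "colour_mean L N u = (\<Sum>v\<leftarrow>expand L u. e N v)"

lemma e_Nil: "N \<ge> 1 \<Longrightarrow> e N [] = 1"
  by (simp add: e_def mean_def ntrace_def[abs_def] prob_space)

lemma e_Shift_diagonal: "e N (Shift l l # v) = e N v"
proof -
  have "entry (h N) N (Shift l l # v) i i w = entry (h N) N v i i w" if "i < N" for i w
    using that sum_delta_lessThan(1)[of i N "\<lambda>s. entry (h N) N v s i w"] by simp
  then show ?thesis by (simp add: e_def mean_def ntrace_def[abs_def])
qed

lemma e_weight: "N \<ge> 1 \<Longrightarrow> weight u \<noteq> 0 \<Longrightarrow> e N u = 0"
  unfolding e_def h_def by (rule gaussian_gram.mean_weight[OF gaussian_gram])

lemma colour_mean_rotate: "colour_mean L N (u @ v) = colour_mean L N (v @ u)"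
proof -
  have "colour_mean L N (u @ v) = (\<Sum>b\<leftarrow>expand L v. \<Sum>a\<leftarrow>expand L u. e N (a @ b))"
    unfolding colour_mean_def sum_expand_append by (rule sum_list_swap)
  also have "\<dots> = (\<Sum>b\<leftarrow>expand L v. \<Sum>a\<leftarrow>expand L u. e N (b @ a))"
    by (intro arg_cong[where f = sum_list] map_cong refl e_rotate)
  finally show ?thesis unfolding colour_mean_def sum_expand_append .
qed

text \<open>The windows of different colours are disjoint.\<close>

lemma window_diagonal:
  fixes f :: "nat \<Rightarrow> complex"
  shows "(\<Sum>l\<leftarrow>window L c. \<Sum>l'\<leftarrow>window L c'. if l = l' then f l else 0)
    = (if c = c' then \<Sum>l\<leftarrow>window L c. f l else 0)"
proof -
  have win: "distinct (window L c)" "set (window L c) = (if c then {L..<2*L} else {..<L})" for c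
    by (auto simp: window_def)
  have "(\<Sum>l\<leftarrow>window L c. \<Sum>l'\<leftarrow>window L c'. if l = l' then f l else 0)
      = (\<Sum>l\<in>set (window L c). \<Sum>l'\<in>set (window L c'). if l = l' then f l else 0)"
    by (simp add: sum_list_distinct_conv_sum_set win(1))
  also have "\<dots> = (\<Sum>l\<in>set (window L c). if l \<in> set (window L c') then f l else 0)"
    by simp
  also have "\<dots> = (if c = c' then \<Sum>l\<in>set (window L c). f l else 0)"
    by (auto simp: win(2) intro!: sum.neutral)
  finally show ?thesis by (simp add: sum_list_distinct_conv_sum_set win(1))
qed

text \<open>Cutting a word at a letter of another window leaves a piece of nonzero weight, whose mean vanishes.
  Thus only the diagonal terms \<open>l = l'\<close> contribute to the products of means, and they add up to words
  in the same coloured letters.\<close>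

lemma colour_mean_loop:
  assumes N: "N \<ge> 1"
  shows "colour_mean L N ((c, k) # u) = of_nat L * mom N k * colour_mean L N u
    + (\<Sum>(u1, (c', k'), u2)\<leftarrow>list_splits u.
        if c = c' then colour_mean L N (u1 @ [(c, k + k')]) * colour_mean L N u2 else 0)
    + (\<Sum>l\<leftarrow>window L c. \<Sum>v\<leftarrow>expand L u. \<Sum>(v1, k', r, r', v2)\<leftarrow>splits v.
        F N [v1 @ [Gram (k + k') r l], Shift l r' # v2])"
proof -
  have "colour_mean L N ((c, k) # u)
    = (\<Sum>l\<leftarrow>window L c. \<Sum>v\<leftarrow>expand L u. mom N k * e N (Shift l l # v)
      + ((\<Sum>(v1, k', r, r', v2)\<leftarrow>splits v. F N [v1 @ [Gram (k + k') r l], Shift l r' # v2])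
        + (\<Sum>(v1, k', r, r', v2)\<leftarrow>splits v. e N (v1 @ [Gram (k + k') r l]) * e N (Shift l r' # v2))))"
    unfolding colour_mean_def sum_expand_Cons mean_loop[OF N] case_prod_unfold sum_list_addf ..
  also have "\<dots> = (\<Sum>l\<leftarrow>window L c. mom N k * colour_mean L N u)
    + (\<Sum>l\<leftarrow>window L c. \<Sum>v\<leftarrow>expand L u. \<Sum>(v1, k', r, r', v2)\<leftarrow>splits v.
        F N [v1 @ [Gram (k + k') r l], Shift l r' # v2])
    + (\<Sum>l\<leftarrow>window L c. \<Sum>v\<leftarrow>expand L u. \<Sum>(v1, k', r, r', v2)\<leftarrow>splits v.
        e N (v1 @ [Gram (k + k') r l]) * e N (Shift l r' # v2))"
    by (simp add: sum_list_addf e_Shift_diagonal colour_mean_def sum_list_const_mult)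
  also have "(\<Sum>l\<leftarrow>window L c. mom N k * colour_mean L N u) = of_nat L * mom N k * colour_mean L N u"
    by (simp add: window_def sum_list_triv)
  also have "(\<Sum>l\<leftarrow>window L c. \<Sum>v\<leftarrow>expand L u. \<Sum>(v1, k', r, r', v2)\<leftarrow>splits v.
        e N (v1 @ [Gram (k + k') r l]) * e N (Shift l r' # v2))
    = (\<Sum>(u1, (c', k'), u2)\<leftarrow>list_splits u. \<Sum>l\<leftarrow>window L c. \<Sum>v1\<leftarrow>expand L u1. \<Sum>l'\<leftarrow>window L c'. \<Sum>v2\<leftarrow>expand L u2.
        e N (v1 @ [Gram (k + k') l' l]) * e N (Shift l l' # v2))"
    unfolding sum_expand_splits unfolding case_prod_unfold by (rule sum_list_swap)
  also have "\<dots> = (\<Sum>(u1, (c', k'), u2)\<leftarrow>list_splits u.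
        if c = c' then colour_mean L N (u1 @ [(c, k + k')]) * colour_mean L N u2 else 0)"
  proof -
    have "(\<Sum>l\<leftarrow>window L c. \<Sum>v1\<leftarrow>expand L u1. \<Sum>l'\<leftarrow>window L c'. \<Sum>v2\<leftarrow>expand L u2.
        e N (v1 @ [Gram (k + k') l' l]) * e N (Shift l l' # v2))
      = (if c = c' then colour_mean L N (u1 @ [(c, k + k')]) * colour_mean L N u2 else 0)" for u1 c' k' u2
    proof -
      have shift: "(\<Sum>v2\<leftarrow>expand L u2. e N (Shift l l' # v2)) = (if l = l' then colour_mean L N u2 else 0)" for l l'
        using expand_weight[of _ L u2] e_weight[OF N]
        by (auto simp: colour_mean_def e_Shift_diagonal intro!: sum_list_eq_0)
      have "(\<Sum>l\<leftarrow>window L c. \<Sum>v1\<leftarrow>expand L u1. \<Sum>l'\<leftarrow>window L c'. \<Sum>v2\<leftarrow>expand L u2.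
          e N (v1 @ [Gram (k + k') l' l]) * e N (Shift l l' # v2))
        = (\<Sum>v1\<leftarrow>expand L u1. \<Sum>l\<leftarrow>window L c. \<Sum>l'\<leftarrow>window L c'.
            if l = l' then e N (v1 @ [Gram (k + k') l l]) * colour_mean L N u2 else 0)"
        unfolding sum_list_const_mult shift
        by (subst sum_list_swap) (auto intro!: arg_cong[where f = sum_list] map_cong)
      also have "\<dots> = (if c = c' then (\<Sum>v1\<leftarrow>expand L u1. \<Sum>l\<leftarrow>window L c.
            e N (v1 @ [Gram (k + k') l l])) * colour_mean L N u2 else 0)"
        unfolding window_diagonal by (simp add: sum_list_mult_const)
      also have "(\<Sum>v1\<leftarrow>expand L u1. \<Sum>l\<leftarrow>window L c. e N (v1 @ [Gram (k + k') l l]))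
        = colour_mean L N (u1 @ [(c, k + k')])"
        unfolding colour_mean_def sum_expand_append sum_expand_Cons by simp
      finally show ?thesis .
    qed
    then show ?thesis by (simp only: case_prod_unfold)
  qed
  finally show ?thesis by (simp only: ac_simps)
qed

lemma tendsto_sum_list:
  fixes f :: "'a \<Rightarrow> nat \<Rightarrow> complex"
  assumes "\<And>x. x \<in> set xs \<Longrightarrow> f x \<longlonglongrightarrow> g x"
  shows "(\<lambda>N. \<Sum>x\<leftarrow>xs. f x N) \<longlonglongrightarrow> (\<Sum>x\<leftarrow>xs. g x)"
  using assms by (induction xs) (auto intro!: tendsto_add)

definition limit_moment :: "nat \<Rightarrow> (bool \<times> nat) list \<Rightarrow> complex" where
  "limit_moment L u = lim (\<lambda>N. colour_mean L N u)"

lemma colour_mean_tendsto_step: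
  assumes conv: "\<And>v. length v \<le> length u \<Longrightarrow> (\<lambda>N. colour_mean L N v) \<longlonglongrightarrow> limit_moment L v"
  shows "(\<lambda>N. colour_mean L N ((c, k) # u)) \<longlonglongrightarrow> of_nat L * \<rho> k * limit_moment L u
    + (\<Sum>(u1, (c', k'), u2)\<leftarrow>list_splits u.
        if c = c' then limit_moment L (u1 @ [(c, k + k')]) * limit_moment L u2 else 0)"
proof -
  define A where "A N = of_nat L * mom N k * colour_mean L N u" for N
  define B where "B N = (\<Sum>(u1, (c', k'), u2)\<leftarrow>list_splits u.
    if c = c' then colour_mean L N (u1 @ [(c, k + k')]) * colour_mean L N u2 else 0)" for N
  define C where "C N = (\<Sum>l\<leftarrow>window L c. \<Sum>v\<leftarrow>expand L u. \<Sum>(v1, k', r, r', v2)\<leftarrow>splits v.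
        F N [v1 @ [Gram (k + k') r l], Shift l r' # v2])" for N
  have "(\<lambda>N. mom N k) \<longlonglongrightarrow> \<rho> k" using moments by (simp add: mom_def)
  then have A: "A \<longlonglongrightarrow> of_nat L * \<rho> k * limit_moment L u"
    unfolding A_def by (rule tendsto_mult[OF tendsto_mult[OF tendsto_const] conv[OF order_refl]])
  have B: "B \<longlonglongrightarrow> (\<Sum>(u1, (c', k'), u2)\<leftarrow>list_splits u.
        if c = c' then limit_moment L (u1 @ [(c, k + k')]) * limit_moment L u2 else 0)"
    unfolding B_def
  proof (rule tendsto_sum_list)
    fix x assume x_in: "x \<in> set (list_splits u)"
    obtain u1 c' k' u2 where x: "x = (u1, (c', k'), u2)" by (metis prod.exhaust)
    from x_in list_splits_append[of u1 "(c', k')" u2 u]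
    have len: "length (u1 @ [(c, k + k')]) \<le> length u" "length u2 \<le> length u"
      by (auto simp: x)
    show "(\<lambda>N. (\<lambda>(u1, (c', k'), u2).
          if c = c' then colour_mean L N (u1 @ [(c, k + k')]) * colour_mean L N u2 else 0) x)
      \<longlonglongrightarrow> (\<lambda>(u1, (c', k'), u2).
          if c = c' then limit_moment L (u1 @ [(c, k + k')]) * limit_moment L u2 else 0) x"
    proof (cases "c = c'")
      case True
      then show ?thesis using tendsto_mult[OF conv[OF len(1)] conv[OF len(2)]] by (simp add: x)
    qed (simp add: x)
  qed
  have "C \<longlonglongrightarrow> (\<Sum>l\<leftarrow>window L c. \<Sum>v\<leftarrow>expand L u. \<Sum>t\<leftarrow>splits v. 0)"
    unfolding C_def case_prod_unfold
    by (rule tendsto_sum_list)+ (rule F_tendsto_0, simp)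
  then have C: "C \<longlonglongrightarrow> 0" by simp
  have "\<forall>\<^sub>F N in sequentially. A N + B N + C N = colour_mean L N ((c, k) # u)"
    by (rule eventually_sequentiallyI[of 1]) (simp only: colour_mean_loop A_def B_def C_def)
  then show ?thesis
    using Lim_transform_eventually[OF tendsto_add[OF tendsto_add[OF A B] C]] by simp
qed

lemma colour_mean_tendsto: "(\<lambda>N. colour_mean L N u) \<longlonglongrightarrow> limit_moment L u"
proof (induction "length u" arbitrary: u rule: less_induct)
  case less
  show ?case
  proof (cases u)
    case Nil
    have "(\<lambda>N. colour_mean L N u) \<longlonglongrightarrow> 1"
      unfolding Nil
      by (rule tendsto_eventually, rule eventually_sequentiallyI[of 1]) (simp add: colour_mean_def e_Nil)
    then show ?thesis unfolding limit_moment_def by (simp add: limI)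
  next
    case (Cons x v)
    obtain c k where x: "x = (c, k)" by (cases x)
    have "(\<lambda>N. colour_mean L N w) \<longlonglongrightarrow> limit_moment L w" if "length w \<le> length v" for w
      using less[of w] that by (simp add: Cons)
    note step = colour_mean_tendsto_step[OF this, where c = c and k = k]
    show ?thesis
      unfolding limit_moment_def Cons x
      by (rule convergent_LIMSEQ_iff[THEN iffD1, OF convergentI[OF step]])
  qed
qed

lemma limit_moment_rotate: "limit_moment L (u @ v) = limit_moment L (v @ u)"
  unfolding limit_moment_def colour_mean_rotate[of L _ u v] ..

text \<open>The covariances in \<open>colour_mean_loop\<close> disappear in the limit; the recursion no longer mixes the two
  colours in the letter that interacts.\<close>

lemma limit_moment_loop:
  "limit_moment L ((c, k) # u) = of_nat L * \<rho> k * limit_moment L u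
    + (\<Sum>(u1, (c', k'), u2)\<leftarrow>list_splits u.
        if c = c' then limit_moment L (u1 @ [(c, k + k')]) * limit_moment L u2 else 0)"
  by (rule LIMSEQ_unique[OF colour_mean_tendsto colour_mean_tendsto_step]) (rule colour_mean_tendsto)

definition colour_trace :: "nat \<Rightarrow> nat \<Rightarrow> (bool \<times> nat) list \<Rightarrow> 'w \<Rightarrow> complex" where
  "colour_trace L N u w = (\<Sum>v\<leftarrow>expand L u. tr N v w)"

lemma colour_trace_AE: "AE w in \<Omega>. \<forall>u. (\<lambda>N. colour_trace L N u w) \<longlonglongrightarrow> limit_moment L u"
  using trace_AE
proof eventually_elim
  case (elim w)
  show ?case
  proof
    fix u
    have "(\<lambda>N. \<Sum>v\<leftarrow>expand L u. tr N v w - e N v) \<longlonglongrightarrow> (\<Sum>v\<leftarrow>expand L u. 0)"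
      using elim by (intro tendsto_sum_list) auto
    then have "(\<lambda>N. colour_trace L N u w - colour_mean L N u) \<longlonglongrightarrow> 0"
      by (simp add: colour_trace_def colour_mean_def sum_list_subtractf)
    from tendsto_add[OF this colour_mean_tendsto[of L u]]
    show "(\<lambda>N. colour_trace L N u w) \<longlonglongrightarrow> limit_moment L u" by simp
  qed
qed

end

section \<open>The loop recursion implies freeness\<close>

text \<open>The multilinear extension of a function \<open>f\<close> on words: each list of pairs is a noncommutative polynomial,
  given by coefficients and words, and \<open>f\<close> is evaluated at the product of the polynomials.\<close>

fun lin :: "('a list \<Rightarrow> complex) \<Rightarrow> (complex \<times> 'a list) list list \<Rightarrow> complex" where
  "lin f [] = f []"
| "lin f (p # ps) = (\<Sum>(x, v)\<leftarrow>p. x * lin (\<lambda>z. f (v @ z)) ps)"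

lemma lin_add: "lin (\<lambda>v. f v + g v) ps = lin f ps + lin g ps"
  by (induction ps arbitrary: f g) (auto simp: distrib_left sum_list_addf case_prod_unfold)

lemma lin_cmult: "lin (\<lambda>v. c * f v) ps = c * lin f ps"
proof (induction ps arbitrary: f)
  case (Cons p ps)
  show ?case
    by (simp add: Cons.IH case_prod_unfold mult.left_commute[of _ c] sum_list_const_mult)
qed simp

lemma lin_0: "lin (\<lambda>v. 0) ps = 0"
  using lin_cmult[of 0 "\<lambda>v. 0"] by simp

lemma lin_mult_right: "lin (\<lambda>v. f v * c) ps = lin f ps * c"
  using lin_cmult[of c f ps] by (simp add: mult.commute)

lemma lin_sum_list: "lin (\<lambda>v. \<Sum>x\<leftarrow>xs. f x v) ps = (\<Sum>x\<leftarrow>xs. lin (f x) ps)"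
  by (induction xs) (simp_all add: lin_add lin_0)

lemma lin_append: "lin f (ps @ qs) = lin (\<lambda>u. lin (\<lambda>v. f (u @ v)) qs) ps"
  by (induction ps arbitrary: f) simp_all

lemma lin_tendsto:
  assumes "\<And>v. (\<lambda>N. f N v) \<longlonglongrightarrow> g v"
  shows "(\<lambda>N. lin (f N) ps) \<longlonglongrightarrow> lin g ps"
  using assms
proof (induction ps arbitrary: f g)
  case (Cons p ps)
  have "(\<lambda>N. \<Sum>t\<leftarrow>p. fst t * lin (\<lambda>z. f N (snd t @ z)) ps) \<longlonglongrightarrow> (\<Sum>t\<leftarrow>p. fst t * lin (\<lambda>z. g (snd t @ z)) ps)"
    using Cons by (induction p) (auto intro!: tendsto_intros)
  then show ?case by (simp add: case_prod_unfold)
qed simp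

lemma list_splits_snoc_sum:
  fixes g :: "'a list \<Rightarrow> 'a \<Rightarrow> 'a list \<Rightarrow> 'b :: comm_monoid_add"
  shows "(\<Sum>(u1, x, u2)\<leftarrow>list_splits (u @ v). g u1 x u2)
    = (\<Sum>(u1, x, u2)\<leftarrow>list_splits u. g u1 x (u2 @ v)) + (\<Sum>(v1, x, v2)\<leftarrow>list_splits v. g (u @ v1) x v2)"
proof (induction u arbitrary: g)
  case (Cons a u)
  from Cons.IH[of "\<lambda>u1. g (a # u1)"] show ?case
    by (simp add: case_prod_unfold comp_def add.assoc)
qed simp

text \<open>The positions in a product of polynomials are the positions in its factors, so a sum over all
  positions vanishes once it vanishes for the positions in each factor.\<close>

lemma list_splits_lin:
  fixes \<phi> :: "'a list \<Rightarrow> complex" and \<psi> :: "'a list \<Rightarrow> 'a \<Rightarrow> 'a list \<Rightarrow> complex"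
  assumes "\<And>ps q qs t v1 x v2. ps @ q # qs = rs \<Longrightarrow> t \<in> set q \<Longrightarrow> (v1, x, v2) \<in> set (list_splits (snd t)) \<Longrightarrow>
    lin (\<lambda>a. lin (\<lambda>b. \<psi> (a @ v1) x (v2 @ b)) qs) ps = 0"
  shows "lin (\<lambda>v. \<Sum>(v1, x, v2)\<leftarrow>list_splits v. \<psi> v1 x v2) rs = 0"
proof -
  have "lin (\<lambda>a. lin (\<lambda>v. \<Sum>(v1, x, v2)\<leftarrow>list_splits v. \<psi> (a @ v1) x v2) qs) ps = 0" if "ps @ qs = rs" for ps qs
    using that
  proof (induction qs arbitrary: ps)
    case Nil
    then show ?case by (simp add: lin_0)
  next
    case (Cons q qs)
    have IH: "lin (\<lambda>a. lin (\<lambda>v. \<Sum>(v1, x, v2)\<leftarrow>list_splits v. \<psi> (a @ v1) x v2) qs) (ps @ [q]) = 0"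
      using Cons by simp
    have "lin (\<lambda>a. lin (\<lambda>v. \<Sum>(v1, x, v2)\<leftarrow>list_splits v. \<psi> (a @ v1) x v2) (q # qs)) ps
      = lin (\<lambda>a. \<Sum>t\<leftarrow>q. fst t * lin (\<lambda>z. \<Sum>(v1, x, v2)\<leftarrow>list_splits (snd t). \<psi> (a @ v1) x (v2 @ z)) qs) ps
        + lin (\<lambda>a. \<Sum>t\<leftarrow>q. fst t * lin (\<lambda>z. \<Sum>(v1, x, v2)\<leftarrow>list_splits z. \<psi> (a @ snd t @ v1) x v2) qs) ps"
      unfolding lin_add[symmetric] lin.simps list_splits_snoc_sum
      by (simp add: case_prod_unfold lin_add distrib_left sum_list_addf)
    also have "lin (\<lambda>a. \<Sum>t\<leftarrow>q. fst t * lin (\<lambda>z. \<Sum>(v1, x, v2)\<leftarrow>list_splits z. \<psi> (a @ snd t @ v1) x v2) qs) ps = 0"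
      using IH by (simp add: lin_append case_prod_unfold)
    also have "lin (\<lambda>a. \<Sum>t\<leftarrow>q. fst t * lin (\<lambda>z. \<Sum>(v1, x, v2)\<leftarrow>list_splits (snd t). \<psi> (a @ v1) x (v2 @ z)) qs) ps
      = (\<Sum>t\<leftarrow>q. fst t * (\<Sum>(v1, x, v2)\<leftarrow>list_splits (snd t). lin (\<lambda>a. lin (\<lambda>z. \<psi> (a @ v1) x (v2 @ z)) qs) ps))"
      by (simp add: lin_sum_list lin_cmult case_prod_unfold)
    also have "\<dots> = 0"
    proof (rule sum_list_eq_0)
      fix t assume "t \<in> set q"
      then have "(\<Sum>(v1, x, v2)\<leftarrow>list_splits (snd t). lin (\<lambda>a. lin (\<lambda>z. \<psi> (a @ v1) x (v2 @ z)) qs) ps) = 0"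
        by (intro sum_list_eq_0) (auto intro!: assms[OF Cons.prems])
      then show "fst t * (\<Sum>(v1, x, v2)\<leftarrow>list_splits (snd t). lin (\<lambda>a. lin (\<lambda>z. \<psi> (a @ v1) x (v2 @ z)) qs) ps) = 0"
        by simp
    qed
    finally show ?case by simp
  qed
  from this[of "[]" rs] show ?thesis by simp
qed

text \<open>The recursion of the limiting moments, with an arbitrary set of colours. It forces freeness because
  the first letter interacts with letters of its own colour only.\<close>

locale free_recursion =
  fixes \<phi> :: "('c \<times> nat) list \<Rightarrow> complex" and \<kappa> :: "nat \<Rightarrow> complex"
  assumes rotate: "\<phi> (u @ v) = \<phi> (v @ u)"
    and recursion: "\<phi> ((c, k) # u) = \<kappa> k * \<phi> u
      + (\<Sum>(u1, (c', k'), u2)\<leftarrow>list_splits u. if c = c' then \<phi> (u1 @ [(c, k + k')]) * \<phi> u2 else 0)"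
begin

definition centered :: "'c \<Rightarrow> (complex \<times> ('c \<times> nat) list) list \<Rightarrow> bool" where
  "centered c p \<longleftrightarrow> (\<forall>(x, v)\<in>set p. \<forall>a\<in>set v. fst a = c) \<and> (\<Sum>(x, v)\<leftarrow>p. x * \<phi> v) = 0"

lemma centered_colour: "centered c p \<Longrightarrow> t \<in> set p \<Longrightarrow> \<forall>a\<in>set (snd t). fst a = c"
  unfolding centered_def case_prod_unfold by blast

text \<open>Induction on the number of factors and then on the length of the prefix \<open>w\<close>, whose colour differs
  from that of the first factor. For the first letter of \<open>w\<close> there are three kinds of partners. If there is none, or
  it lies in \<open>w\<close>, the prefix in front of the product becomes shorter. If it lies in a factor that is
  not the last, then the part after it is a shorter alternating product behind a one-coloured
  prefix. If it lies in the last factor, the part before it is, after a rotation, such a product;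
  here the partner cannot lie in the first factor, which has another colour.\<close>

theorem alternating_centered:
  assumes "list_all2 centered cs ps" "ps \<noteq> []" "distinct_adj cs"
    and "w \<noteq> [] \<Longrightarrow> c \<noteq> hd cs" "\<forall>a\<in>set w. fst a = c"
  shows "lin (\<lambda>v. \<phi> (w @ v)) ps = 0"
  using assms
proof (induction "(length ps, length w)" arbitrary: ps cs w c rule: wf_induct_rule[OF wf_lex_prod[OF wf_less_than wf_less_than]])
  case (1 ps w cs c)
  have IH_ps: "lin (\<lambda>v. \<phi> (w' @ v)) ps' = 0"
    if "length ps' < length ps" "list_all2 centered cs' ps'" "ps' \<noteq> []" "distinct_adj cs'"
      "w' \<noteq> [] \<Longrightarrow> c' \<noteq> hd cs'" "\<forall>a\<in>set w'. fst a = c'" for ps' cs' w' c'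
    by (rule 1(1)[of ps' w' cs' c']) (use that in auto)
  have IH_w: "lin (\<lambda>v. \<phi> (w' @ v)) ps = 0" if "length w' < length w" "set w' \<subseteq> set w" for w'
  proof -
    from that(1) have "c \<noteq> hd cs" by (intro 1(5)) auto
    then show ?thesis by (intro 1(1)[of ps w' cs c]) (use that 1(2,3,4,6) in auto)
  qed
  show ?case
  proof (cases w)
    case Nil
    from 1(2,3) obtain c1 cs' q qs where cs: "cs = c1 # cs'" and ps: "ps = q # qs"
      and q: "centered c1 q" and qs: "list_all2 centered cs' qs"
      by (cases ps) (auto simp: list_all2_Cons2)
    show ?thesis
    proof (cases "qs = []")
      case True
      then show ?thesis using q by (simp add: Nil ps centered_def)
    next
      case False
      have "lin (\<lambda>z. \<phi> (snd t @ z)) qs = 0" if "t \<in> set q" for t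
      proof (rule IH_ps[OF _ qs False])
        show "distinct_adj cs'" using 1(4) cs by (cases cs') auto
        show "c1 \<noteq> hd cs'" using 1(4) cs qs False by (cases cs') auto
        show "\<forall>a\<in>set (snd t). fst a = c1" by (rule centered_colour[OF q that])
      qed (simp add: ps)
      then show ?thesis by (auto simp: Nil ps case_prod_unfold intro!: sum_list_eq_0)
    qed
  next
    case (Cons a w')
    with 1(6) obtain k where a: "a = (c, k)" by (cases a) auto
    have c: "c \<noteq> hd cs" using 1(5) Cons by simp
    have col_w': "\<forall>a\<in>set w'. fst a = c" using 1(6) Cons by simp
    define \<psi> where "\<psi> u1 x u2 = (if c = fst x then \<phi> (u1 @ [(c, k + snd x)]) * \<phi> u2 else 0)" for u1 x u2
    \<comment> \<open>The positions of the recursion are split into those in \<open>w'\<close> and those in the product.\<close>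
    have "\<phi> (w @ v) = \<kappa> k * \<phi> (w' @ v)
        + ((\<Sum>(u1, x, u2)\<leftarrow>list_splits w'. \<psi> u1 x (u2 @ v)) + (\<Sum>(v1, x, v2)\<leftarrow>list_splits v. \<psi> (w' @ v1) x v2))" for v
      unfolding list_splits_snoc_sum[symmetric] Cons a append_Cons recursion
      by (simp add: \<psi>_def case_prod_unfold)
    then have "lin (\<lambda>v. \<phi> (w @ v)) ps = \<kappa> k * lin (\<lambda>v. \<phi> (w' @ v)) ps
        + (lin (\<lambda>v. \<Sum>(u1, x, u2)\<leftarrow>list_splits w'. \<psi> u1 x (u2 @ v)) ps
          + lin (\<lambda>v. \<Sum>(v1, x, v2)\<leftarrow>list_splits v. \<psi> (w' @ v1) x v2) ps)"
      by (simp only: lin_add lin_cmult)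
    moreover have "lin (\<lambda>v. \<phi> (w' @ v)) ps = 0"
      by (rule IH_w) (auto simp: Cons)
    moreover have "lin (\<lambda>v. \<Sum>(u1, x, u2)\<leftarrow>list_splits w'. \<psi> u1 x (u2 @ v)) ps = 0"
      unfolding case_prod_unfold lin_sum_list
    proof (rule sum_list_eq_0)
      fix t assume "t \<in> set (list_splits w')"
      then have w': "w' = fst t @ fst (snd t) # snd (snd t)" by (intro list_splits_append) simp
      have "lin (\<lambda>v. \<phi> (snd (snd t) @ v)) ps = 0"
        by (rule IH_w) (auto simp: Cons w')
      then show "lin (\<lambda>v. \<psi> (fst t) (fst (snd t)) (snd (snd t) @ v)) ps = 0"
        by (cases "c = fst (fst (snd t))") (simp_all add: \<psi>_def lin_cmult lin_0)
    qed
    moreover have "lin (\<lambda>v. \<Sum>(v1, x, v2)\<leftarrow>list_splits v. \<psi> (w' @ v1) x v2) ps = 0"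
    proof (rule list_splits_lin)
      fix ps1 q qs t v1 x v2
      assume ps: "ps1 @ q # qs = ps" and t: "t \<in> set q" and split: "(v1, x, v2) \<in> set (list_splits (snd t))"
      from 1(2) ps obtain cs1 cq cs2 where cs: "cs = cs1 @ cq # cs2" and l1: "list_all2 centered cs1 ps1"
        and q: "centered cq q" and l2: "list_all2 centered cs2 qs"
        by (auto simp: list_all2_append2 list_all2_Cons2)
      note snd_t = list_splits_append[OF split]
      have col: "\<forall>a\<in>set (snd t). fst a = cq" by (rule centered_colour[OF q t])
      have adj: "distinct_adj cs1" "distinct_adj (cq # cs2)"
        using 1(4) unfolding cs distinct_adj_append_iff by auto
      show "lin (\<lambda>a. lin (\<lambda>b. \<psi> (w' @ a @ v1) x (v2 @ b)) qs) ps1 = 0"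
      proof (cases "c = fst x")
        case True
        then have cq: "cq = c" using col snd_t by auto
        have "lin (\<lambda>a. lin (\<lambda>b. \<psi> (w' @ a @ v1) x (v2 @ b)) qs) ps1
          = lin (\<lambda>a. \<phi> (w' @ a @ v1 @ [(c, k + snd x)])) ps1 * lin (\<lambda>b. \<phi> (v2 @ b)) qs"
          using True by (simp add: \<psi>_def lin_cmult lin_mult_right)
        also have "\<dots> = 0"
        proof (cases "qs = []")
          case False
          have "lin (\<lambda>b. \<phi> (v2 @ b)) qs = 0"
          proof (rule IH_ps[OF _ l2 False])
            show "distinct_adj cs2" using adj(2) by (cases cs2) auto
            show "cq \<noteq> hd cs2" using adj(2) l2 False by (cases cs2) auto
            show "\<forall>a\<in>set v2. fst a = cq" using col snd_t by auto
          qed (simp add: ps[symmetric])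
          then show ?thesis by simp
        next
          case True
          have ps1: "ps1 \<noteq> []"
            using c cs cq l1 by auto
          have "lin (\<lambda>a. \<phi> (w' @ a @ v1 @ [(c, k + snd x)])) ps1
            = lin (\<lambda>a. \<phi> ((v1 @ [(c, k + snd x)] @ w') @ a)) ps1"
            using rotate[of "w' @ a" "v1 @ [(c, k + snd x)]" for a] by simp
          also have "\<dots> = 0"
          proof (rule IH_ps[OF _ l1 ps1 adj(1)])
            show "c \<noteq> hd cs1" using c cs l1 ps1 by (cases cs1) auto
            show "\<forall>a\<in>set (v1 @ [(c, k + snd x)] @ w'). fst a = c"
              using col snd_t cq col_w' by auto
          qed (simp add: ps[symmetric])
          finally show ?thesis by simp
        qed
        finally show ?thesis .
      qed (simp add: \<psi>_def lin_0)
    qed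
    ultimately show ?thesis by simp
  qed
qed

end

section \<open>Hermitian matrices\<close>

lemma mat_adjoint_index:
  "i < dim_col A \<Longrightarrow> j < dim_row A \<Longrightarrow> mat_adjoint A $$ (i, j) = cnj (A $$ (j, i))"
  by (simp add: mat_adjoint_def mat_of_rows_index conjugate_complex_def)

lemma mat_adjoint_dim: "dim_row (mat_adjoint A) = dim_col A" "dim_col (mat_adjoint A) = dim_row A"
  by (simp_all add: mat_adjoint_def)

lemma hermitian_mat_iff:
  "A \<in> carrier_mat n n \<Longrightarrow> hermitian_mat A \<longleftrightarrow> (\<forall>i<n. \<forall>j<n. A $$ (i, j) = cnj (A $$ (j, i)))"
proof -
  assume A: "A \<in> carrier_mat n n"
  have adj: "mat_adjoint A $$ (i, j) = cnj (A $$ (j, i))" if "i < n" "j < n" for i j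
    using A that by (intro mat_adjoint_index) auto
  show ?thesis
  proof
    assume "hermitian_mat A"
    then have eq: "mat_adjoint A = A" by (simp add: hermitian_mat_def)
    show "\<forall>i<n. \<forall>j<n. A $$ (i, j) = cnj (A $$ (j, i))" using adj unfolding eq by blast
  next
    assume sym: "\<forall>i<n. \<forall>j<n. A $$ (i, j) = cnj (A $$ (j, i))"
    have "mat_adjoint A = A"
    proof (rule eq_matI)
      fix i j assume "i < dim_row A" "j < dim_col A"
      then have ij: "i < n" "j < n" using A by auto
      show "mat_adjoint A $$ (i, j) = A $$ (i, j)"
        unfolding adj[OF ij] using sym ij by metis
    qed (use A in \<open>auto simp: mat_adjoint_dim\<close>)
    then show "hermitian_mat A" using A by (simp add: hermitian_mat_def)
  qed
qed

lemma hermitian_inner: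
  assumes A: "A \<in> carrier_mat n n" "hermitian_mat A" and v: "v \<in> carrier_vec n" and w: "w \<in> carrier_vec n"
  shows "(A *\<^sub>v v) \<bullet>c w = v \<bullet>c (A *\<^sub>v w)"
proof -
  have "(A *\<^sub>v v) \<bullet>c w = (\<Sum>i<n. \<Sum>j<n. A $$ (i, j) * v $ j * cnj (w $ i))"
    using A v w by (simp add: scalar_prod_def conjugate_complex_def atLeast0LessThan sum_distrib_right)
  also have "\<dots> = (\<Sum>j<n. \<Sum>i<n. A $$ (i, j) * v $ j * cnj (w $ i))" by (rule sum.swap)
  also have "\<dots> = (\<Sum>j<n. \<Sum>i<n. v $ j * (cnj (A $$ (j, i)) * cnj (w $ i)))"
  proof (intro sum.cong refl)
    fix i j assume "i \<in> {..<n}" "j \<in> {..<n}"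
    then have sym: "A $$ (i, j) = cnj (A $$ (j, i))" using A(2) unfolding hermitian_mat_iff[OF A(1)] by blast
    show "A $$ (i, j) * v $ j * cnj (w $ i) = v $ j * (cnj (A $$ (j, i)) * cnj (w $ i))"
      by (subst sym) (simp only: mult.left_commute mult.assoc)
  qed
  also have "\<dots> = v \<bullet>c (A *\<^sub>v w)"
    using A v w by (simp add: scalar_prod_def conjugate_complex_def atLeast0LessThan sum_distrib_left)
  finally show ?thesis .
qed

lemma inner_self_pos:
  assumes "v \<in> carrier_vec n" "v \<noteq> 0\<^sub>v n" shows "0 < Re (v \<bullet>c (v :: complex vec))"
  using conjugate_square_greater_0_vec[of v n] assms by (simp add: less_complex_def)

lemma hermitian_eigenvalue_real:
  assumes A: "A \<in> carrier_mat n n" "hermitian_mat A" and ev: "eigenvalue A e"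
  shows "e \<in> \<real>"
proof -
  obtain v where v: "v \<in> carrier_vec n" "v \<noteq> 0\<^sub>v n" and Av: "A *\<^sub>v v = e \<cdot>\<^sub>v v"
    using ev A by (auto simp: eigenvalue_def eigenvector_def)
  have "e * (v \<bullet>c v) = cnj e * (v \<bullet>c v)"
    using hermitian_inner[OF A v(1) v(1)] v(1) unfolding Av
    by (simp add: conjugate_smult_vec conjugate_complex_def)
  moreover have "v \<bullet>c v \<noteq> 0" using inner_self_pos[OF v] by auto
  ultimately have "e = cnj e" by simp
  then show ?thesis unfolding Reals_cnj_iff by (rule sym)
qed

text \<open>If \<open>C\<^sup>2 v = 0\<close> then \<open>\<parallel>C v\<parallel>\<^sup>2 = \<langle>v, C\<^sup>2 v\<rangle> = 0\<close>.\<close>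

lemma hermitian_kernel_square:
  assumes C: "C \<in> carrier_mat n n" "hermitian_mat C"
  shows "mat_kernel (C * C) = mat_kernel C"
proof
  show "mat_kernel (C * C) \<subseteq> mat_kernel C"
  proof
    fix v assume "v \<in> mat_kernel (C * C)"
    then have v: "v \<in> carrier_vec n" and CCv: "C *\<^sub>v (C *\<^sub>v v) = 0\<^sub>v n"
      using C by (auto simp: mat_kernel_def)
    have "(C *\<^sub>v v) \<bullet>c (C *\<^sub>v v) = v \<bullet>c (C *\<^sub>v (C *\<^sub>v v))"
      using C v by (intro hermitian_inner) auto
    also have "\<dots> = 0" using v unfolding CCv by simp
    finally have "C *\<^sub>v v = 0\<^sub>v n" using C v by (subst (asm) conjugate_square_eq_0_vec[of _ n]) auto
    then show "v \<in> mat_kernel C" using C v by (auto simp: mat_kernel_def)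
  qed
  show "mat_kernel C \<subseteq> mat_kernel (C * C)"
  proof
    fix v assume "v \<in> mat_kernel C"
    then have v: "v \<in> carrier_vec n" and Cv: "C *\<^sub>v v = 0\<^sub>v n"
      using C by (auto simp: mat_kernel_def)
    have "(C * C) *\<^sub>v v = C *\<^sub>v (C *\<^sub>v v)" using C v by simp
    also have "\<dots> = 0\<^sub>v n" unfolding Cv using C by (intro eq_vecI) (auto simp: scalar_prod_def)
    finally show "v \<in> mat_kernel (C * C)" using C v by (auto simp: mat_kernel_def)
  qed
qed

text \<open>The number of blocks of size at least two for \<open>e\<close> is the difference of the kernel dimensions of
  \<open>(A - e)\<^sup>2\<close> and \<open>A - e\<close>, which is zero by the previous lemma.\<close>

lemma hermitian_jordan_blocks:
  assumes A: "A \<in> carrier_mat n n" "hermitian_mat A" and jnf: "jordan_nf A n_as" and b: "(s, e) \<in> set n_as"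
  shows "s = 1"
proof -
  have s0: "s \<noteq> 0" using jnf b by (force simp: jordan_nf_def)
  have "poly (char_poly A) e = 0"
    unfolding jordan_nf_char_poly[OF jnf] using b s0
    by (auto simp: poly_prod_list prod_list_zero_iff intro!: bexI[of _ "(s, e)"] image_eqI[of _ _ "(s, e)"])
  then have "eigenvalue A e" using eigenvalue_root_char_poly[OF A(1)] by simp
  then have e: "e \<in> \<real>" by (rule hermitian_eigenvalue_real[OF A])
  define C where "C = char_matrix A e"
  have C: "C \<in> carrier_mat n n" using A(1) by (simp add: C_def)
  have hC: "hermitian_mat C"
    unfolding hermitian_mat_iff[OF C]
  proof (intro allI impI)
    fix i j assume "i < n" "j < n"
    then have "A $$ (i, j) = cnj (A $$ (j, i))" using A(2) unfolding hermitian_mat_iff[OF A(1)] by blast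
    moreover have "C $$ (i, j) = A $$ (i, j) - (if i = j then e else 0)"
      "C $$ (j, i) = A $$ (j, i) - (if i = j then e else 0)"
      using \<open>i < n\<close> \<open>j < n\<close> A(1) by (auto simp: C_def char_matrix_def)
    moreover have "cnj e = e" using e by (simp add: Reals_cnj_iff)
    ultimately show "C $$ (i, j) = cnj (C $$ (j, i))" by (simp only: complex_cnj_diff) simp
  qed
  have "kernel_dim (C ^\<^sub>m 2) = kernel_dim (C ^\<^sub>m 1)"
    using C hermitian_kernel_square[OF C hC] by (simp add: kernel_dim_def numeral_2_eq_2)
  moreover have "dim_gen_eigenspace A e k = dim_gen_eigenspace (jordan_matrix n_as) e k" for k
    using dim_gen_eigenspace_similar[of A "jordan_matrix n_as"] jnf by (simp add: jordan_nf_def)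
  ultimately have "(\<Sum>n\<leftarrow>map fst [(n, e')\<leftarrow>n_as . e' = e]. min 2 n) = (\<Sum>n\<leftarrow>map fst [(n, e')\<leftarrow>n_as . e' = e]. min 1 n)"
    unfolding C_def dim_gen_eigenspace_def[symmetric] dim_gen_eigenspace_jordan_matrix by simp
  moreover have "s \<in> set (map fst [(n, e')\<leftarrow>n_as . e' = e])" using b by force
  moreover have "(\<Sum>n\<leftarrow>xs. min 2 n) > (\<Sum>n\<leftarrow>xs. min 1 n)" if "s \<in> set xs" "s \<ge> 2" for xs :: "nat list"
  proof -
    from that(1) obtain ys zs where xs: "xs = ys @ s # zs" by (meson split_list)
    have "(\<Sum>n\<leftarrow>ys. min 1 n) \<le> (\<Sum>n\<leftarrow>ys. min 2 n)" for ys :: "nat list"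
      by (intro sum_list_mono) auto
    from this[of ys] this[of zs] that(2) show ?thesis by (simp add: xs)
  qed
  ultimately have "\<not> s \<ge> 2" by fastforce
  then show ?thesis using s0 by simp
qed

lemma diagonal_jordan_matrix:
  assumes "\<forall>(s, e)\<in>set n_as. s = 1"
  shows "jordan_matrix n_as = mat (length n_as) (length n_as) (\<lambda>(i, j). if i = j then snd (n_as ! i) else 0)"
  using assms
proof (induction n_as)
  case Nil
  show ?case by (rule eq_matI) (auto simp: jordan_matrix_def)
next
  case (Cons x n_as)
  obtain e where x: "x = (1, e)" using Cons.prems by (cases x) auto
  have len: "sum_list (map fst n_as) = length n_as"
    using Cons.prems by (induction n_as) auto
  have IH: "jordan_matrix n_as = mat (length n_as) (length n_as) (\<lambda>(i, j). if i = j then snd (n_as ! i) else 0)"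
    using Cons by auto
  show ?case unfolding x jordan_matrix_Cons IH len
    by (rule eq_matI) (auto simp: nth_Cons' split: if_splits)
qed

text \<open>The matrix \<open>P\<close> comes from the Jordan normal form, all of whose blocks have size one. Real eigenvalues
  and an invertible \<open>P\<close> suffice for the square root and for the traces of powers.\<close>

theorem hermitian_diagonalizable:
  assumes A: "A \<in> carrier_mat n n" "hermitian_mat A"
  shows "\<exists>P Q (d :: nat \<Rightarrow> real). P \<in> carrier_mat n n \<and> Q \<in> carrier_mat n n \<and> P * Q = 1\<^sub>m n \<and> Q * P = 1\<^sub>m n
    \<and> (\<forall>i<n. eigenvalue A (of_real (d i)))
    \<and> A = P * mat n n (\<lambda>(i, j). if i = j then of_real (d i) else 0) * Q
    \<and> char_poly A = (\<Prod>i\<leftarrow>[0..<n]. [:- of_real (d i), 1:])"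
proof -
  obtain as where "char_poly A = (\<Prod>a\<leftarrow>as. [:- a, 1:])" using char_poly_factorized[OF A(1)] by blast
  from jordan_nf_exists[OF A(1) this] obtain n_as where jnf: "jordan_nf A n_as" by blast
  have one: "\<forall>(s, e)\<in>set n_as. s = 1" using hermitian_jordan_blocks[OF A jnf] by auto
  obtain P Q where wit: "similar_mat_wit A (jordan_matrix n_as) P Q"
    using jnf by (auto simp: jordan_nf_def similar_mat_def)
  note w = similar_mat_witD2[OF A(1) wit]
  have len: "length n_as = n" using w(5) diagonal_jordan_matrix[OF one] by auto
  define d where "d i = Re (snd (n_as ! i))" for i
  have cp: "char_poly A = (\<Prod>i\<leftarrow>[0..<n]. [:- snd (n_as ! i), 1:])"
  proof -
    have "map (\<lambda>(na, a). [:- a, 1:] ^ na) n_as = map (\<lambda>i. [:- snd (n_as ! i), 1:]) [0..<n]"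
      using one len by (intro nth_equalityI) (auto simp: case_prod_unfold dest!: nth_mem)
    then show ?thesis unfolding jordan_nf_char_poly[OF jnf] by simp
  qed
  have ev: "eigenvalue A (snd (n_as ! i))" if "i < n" for i
    unfolding eigenvalue_root_char_poly[OF A(1)] cp using that
    by (auto simp: poly_prod_list prod_list_zero_iff)
  have d: "snd (n_as ! i) = of_real (d i)" if "i < n" for i
    using hermitian_eigenvalue_real[OF A ev[OF that]] by (simp add: d_def complex_is_Real_iff complex_eq_iff)
  have "jordan_matrix n_as = mat n n (\<lambda>(i, j). if i = j then of_real (d i) else 0)"
    unfolding diagonal_jordan_matrix[OF one] len using d by (intro eq_matI) auto
  then have "A = P * mat n n (\<lambda>(i, j). if i = j then of_real (d i) else 0) * Q" using w(3) by simp
  moreover have "char_poly A = (\<Prod>i\<leftarrow>[0..<n]. [:- of_real (d i), 1:])"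
    unfolding cp using d by (intro arg_cong[where f = prod_list] map_cong) auto
  moreover have "eigenvalue A (of_real (d i))" if "i < n" for i using ev[OF that] d[OF that] by simp
  ultimately show ?thesis using w(1,2,6,7) by blast
qed

lemma diagonal_conjugate_entry:
  fixes f :: "nat \<Rightarrow> complex"
  assumes P: "P \<in> carrier_mat n n" and Q: "Q \<in> carrier_mat n n" and ij: "i < n" "j < n"
  shows "(P * mat n n (\<lambda>(i, j). if i = j then f i else 0) * Q) $$ (i, j) = (\<Sum>l<n. P $$ (i, l) * f l * Q $$ (l, j))"
proof -
  let ?D = "mat n n (\<lambda>(i, j). if i = j then f i else 0)"
  have PD: "(P * ?D) $$ (i, l) = P $$ (i, l) * f l" if "l < n" for l
  proof -
    have "(P * ?D) $$ (i, l) = (\<Sum>k<n. P $$ (i, k) * (if k = l then f k else 0))"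
      using P ij that by (simp add: scalar_prod_def atLeast0LessThan)
    also have "\<dots> = (\<Sum>k<n. if k = l then P $$ (i, k) * f k else 0)" by (intro sum.cong) auto
    finally show ?thesis using that by simp
  qed
  have "(P * ?D * Q) $$ (i, j) = (\<Sum>l<n. (P * ?D) $$ (i, l) * Q $$ (l, j))"
    using P Q ij by (simp add: scalar_prod_def atLeast0LessThan)
  then show ?thesis using PD by simp
qed

lemma diagonal_conjugate_mult:
  fixes f g :: "nat \<Rightarrow> complex"
  assumes P: "P \<in> carrier_mat n n" and Q: "Q \<in> carrier_mat n n" and QP: "Q * P = 1\<^sub>m n"
  shows "(P * mat n n (\<lambda>(i, j). if i = j then f i else 0) * Q) * (P * mat n n (\<lambda>(i, j). if i = j then g i else 0) * Q)
    = P * mat n n (\<lambda>(i, j). if i = j then f i * g i else 0) * Q"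
proof -
  let ?D = "\<lambda>f. mat n n (\<lambda>(i, j). if i = j then f i else (0 :: complex))"
  have D: "?D f \<in> carrier_mat n n" for f by simp
  have DD: "?D f * ?D g = ?D (\<lambda>i. f i * g i)"
  proof (rule eq_matI)
    fix i j assume "i < dim_row (?D (\<lambda>i. f i * g i))" "j < dim_col (?D (\<lambda>i. f i * g i))"
    then have ij: "i < n" "j < n" by auto
    have "(?D f * ?D g) $$ (i, j) = (\<Sum>k<n. (if i = k then f i else 0) * (if k = j then g k else 0))"
      using ij by (simp add: scalar_prod_def atLeast0LessThan)
    also have "\<dots> = (\<Sum>k<n. if i = k then f i * (if k = j then g k else 0) else 0)" by (intro sum.cong) auto
    finally show "(?D f * ?D g) $$ (i, j) = ?D (\<lambda>i. f i * g i) $$ (i, j)" using ij by simp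
  qed auto
  have "(P * ?D f * Q) * (P * ?D g * Q) = P * ?D f * (Q * (P * (?D g * Q)))"
    by (simp only: assoc_mult_mat[OF P D[of g] Q]
        assoc_mult_mat[OF mult_carrier_mat[OF P D[of f]] Q mult_carrier_mat[OF P mult_carrier_mat[OF D[of g] Q]]])
  also have "Q * (P * (?D g * Q)) = (Q * P) * (?D g * Q)"
    using P Q D[of g] by (intro assoc_mult_mat[symmetric]) auto
  also have "\<dots> = ?D g * Q" unfolding QP using Q D[of g] by simp
  also have "P * ?D f * (?D g * Q) = P * (?D f * ?D g) * Q"
    by (simp only: assoc_mult_mat[OF P D[of f] D[of g], symmetric]
        assoc_mult_mat[OF mult_carrier_mat[OF P D[of f]] D[of g] Q])
  finally show ?thesis unfolding DD .
qed

lemma diagonal_conjugate_power: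
  fixes f :: "nat \<Rightarrow> complex"
  assumes P: "P \<in> carrier_mat n n" and Q: "Q \<in> carrier_mat n n" and QP: "Q * P = 1\<^sub>m n" and PQ: "P * Q = 1\<^sub>m n"
  shows "(P * mat n n (\<lambda>(i, j). if i = j then f i else 0) * Q) ^\<^sub>m k
    = P * mat n n (\<lambda>(i, j). if i = j then f i ^ k else 0) * Q"
proof (induction k)
  case 0
  have "mat n n (\<lambda>(i, j). if i = j then f i ^ 0 else 0) = (1\<^sub>m n :: complex mat)"
    by (rule eq_matI) auto
  then show ?case using P Q PQ by simp
next
  case (Suc k)
  have "mat n n (\<lambda>(i, j). if i = j then f i ^ k * f i else 0) = mat n n (\<lambda>(i, j). if i = j then f i ^ Suc k else 0)"
    by (rule eq_matI) (auto simp: mult.commute)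
  then show ?case using Suc diagonal_conjugate_mult[OF P Q QP, of "\<lambda>i. f i ^ k" f] by simp
qed

lemma interpolation:
  fixes g :: "real \<Rightarrow> real"
  assumes "finite S" shows "\<exists>p. \<forall>x\<in>S. poly p x = g x"
  using assms
proof (induction S)
  case (insert s S)
  then obtain p where p: "\<forall>x\<in>S. poly p x = g x" by blast
  define q where "q = (\<Prod>x\<in>S. [:- x, 1:])"
  have "poly q x = 0" if "x \<in> S" for x
    using that insert(1) by (auto simp: q_def poly_prod)
  moreover have "poly q s \<noteq> 0" using insert(1,2) by (auto simp: q_def poly_prod)
  ultimately show ?case using p
    by (intro exI[of _ "p + Polynomial.smult ((g s - poly p s) / poly q s) q"]) auto
qed simp

lemma hermitian_mult_self:
  assumes T: "T \<in> carrier_mat n n" "hermitian_mat T"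
  shows "hermitian_mat (T * T)"
proof -
  have TT: "T * T \<in> carrier_mat n n" using T by simp
  show ?thesis unfolding hermitian_mat_iff[OF TT]
  proof (intro allI impI)
    fix i j assume ij: "i < n" "j < n"
    have sym: "T $$ (i, j) = cnj (T $$ (j, i))" if "i < n" "j < n" for i j
      using T(2) that unfolding hermitian_mat_iff[OF T(1)] by blast
    have "(T * T) $$ (i, j) = (\<Sum>k<n. T $$ (i, k) * T $$ (k, j))"
      using T ij by (simp add: scalar_prod_def atLeast0LessThan)
    also have "\<dots> = (\<Sum>k<n. cnj (T $$ (k, i)) * cnj (T $$ (j, k)))"
      using ij by (intro sum.cong refl arg_cong2[where f = "(*)"] sym) auto
    also have "\<dots> = cnj ((T * T) $$ (j, i))"
      using T ij by (simp add: scalar_prod_def atLeast0LessThan mult.commute)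
    finally show "(T * T) $$ (i, j) = cnj ((T * T) $$ (j, i))" .
  qed
qed

lemma hermitian_pow:
  assumes A: "A \<in> carrier_mat n n" "hermitian_mat A"
  shows "i < n \<Longrightarrow> j < n \<Longrightarrow> (A ^\<^sub>m k) $$ (i, j) = cnj ((A ^\<^sub>m k) $$ (j, i))"
proof (induction k arbitrary: i j)
  case 0
  then show ?case using A(1) by simp
next
  case (Suc k)
  have sym: "A $$ (i, j) = cnj (A $$ (j, i))" if "i < n" "j < n" for i j
    using A(2) that unfolding hermitian_mat_iff[OF A(1)] by blast
  have comm: "A ^\<^sub>m k * A = A * A ^\<^sub>m k" for k
  proof (induction k)
    case (Suc k)
    have "A ^\<^sub>m Suc k * A = A * A ^\<^sub>m k * A" using Suc by simp
    also have "\<dots> = A * (A ^\<^sub>m k * A)" using A(1) by (intro assoc_mult_mat) auto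
    finally show ?case by simp
  qed (use A(1) in simp)
  have Ak: "A ^\<^sub>m k \<in> carrier_mat n n" using A(1) by simp
  have "(A ^\<^sub>m Suc k) $$ (i, j) = (\<Sum>l<n. (A ^\<^sub>m k) $$ (i, l) * A $$ (l, j))"
    using A(1) Ak Suc.prems by (simp add: scalar_prod_def atLeast0LessThan)
  also have "\<dots> = (\<Sum>l<n. cnj ((A ^\<^sub>m k) $$ (l, i)) * cnj (A $$ (j, l)))"
    using Suc.prems by (intro sum.cong refl arg_cong2[where f = "(*)"] sym Suc.IH) auto
  also have "\<dots> = cnj ((A * A ^\<^sub>m k) $$ (j, i))"
    using A(1) Ak Suc.prems by (simp add: scalar_prod_def atLeast0LessThan mult.commute)
  finally show ?case using comm[of k] by simp
qed

text \<open>Take the matrix \<open>T\<close> with the fourth roots of the eigenvalues. Interpolation makes \<open>T\<close> a real polynomial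
  in \<open>A\<close>, hence Hermitian although \<open>P\<close> need not be unitary; then \<open>T\<^sup>2\<close> is positive semidefinite and
  squares to \<open>A\<close>.\<close>

lemma pos_semidef_sqrt_exists:
  assumes A: "A \<in> carrier_mat n n" "hermitian_mat A" and ev: "\<And>e. eigenvalue A (complex_of_real e) \<Longrightarrow> 0 \<le> e"
  shows "\<exists>S. S \<in> carrier_mat n n \<and> pos_semidef S \<and> S * S = A"
proof -
  obtain P Q and d :: "nat \<Rightarrow> real" where PQ: "P \<in> carrier_mat n n" "Q \<in> carrier_mat n n" "P * Q = 1\<^sub>m n" "Q * P = 1\<^sub>m n"
    and d: "\<And>i. i < n \<Longrightarrow> eigenvalue A (of_real (d i))"
    and A_eq: "A = P * mat n n (\<lambda>(i, j). if i = j then of_real (d i) else 0) * Q"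
    and "char_poly A = (\<Prod>i\<leftarrow>[0..<n]. [:- of_real (d i), 1:])"
    using hermitian_diagonalizable[OF A] by blast
  define D where "D f = P * mat n n (\<lambda>(i, j). if i = j then f i else 0) * Q" for f :: "nat \<Rightarrow> complex"
  have D_carrier: "D f \<in> carrier_mat n n" for f
    unfolding D_def by (rule mult_carrier_mat[OF mult_carrier_mat[OF PQ(1)] PQ(2)]) simp
  have D_mult: "D f * D g = D (\<lambda>i. f i * g i)" for f g
    unfolding D_def by (rule diagonal_conjugate_mult[OF PQ(1,2,4)])
  define t where "t i = sqrt (sqrt (d i))" for i
  define T where "T = D (\<lambda>i. of_real (t i))"
  have T: "T \<in> carrier_mat n n" by (simp add: T_def D_carrier)
  obtain p where p: "\<forall>x\<in>d ` {..<n}. poly p x = sqrt (sqrt x)"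
    using interpolation[of "d ` {..<n}" "\<lambda>x. sqrt (sqrt x)"] by auto
  have T_poly: "T $$ (i, j) = (\<Sum>k\<le>Polynomial.degree p. of_real (coeff p k) * (A ^\<^sub>m k) $$ (i, j))" if ij: "i < n" "j < n" for i j
  proof -
    have "(\<Sum>k\<le>Polynomial.degree p. of_real (coeff p k) * (A ^\<^sub>m k) $$ (i, j))
      = (\<Sum>k\<le>Polynomial.degree p. \<Sum>l<n. P $$ (i, l) * of_real (coeff p k * d l ^ k) * Q $$ (l, j))"
      unfolding A_eq diagonal_conjugate_power[OF PQ(1,2,4,3)] diagonal_conjugate_entry[OF PQ(1,2) ij]
      by (simp add: sum_distrib_left mult_ac)
    also have "\<dots> = (\<Sum>l<n. P $$ (i, l) * of_real (\<Sum>k\<le>Polynomial.degree p. coeff p k * d l ^ k) * Q $$ (l, j))"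
      by (subst sum.swap) (simp add: sum_distrib_left sum_distrib_right)
    also have "\<dots> = (\<Sum>l<n. P $$ (i, l) * of_real (t l) * Q $$ (l, j))"
      using p by (intro sum.cong) (auto simp: t_def poly_altdef)
    finally show ?thesis by (simp add: T_def D_def diagonal_conjugate_entry[OF PQ(1,2) ij])
  qed
  have hT: "hermitian_mat T" unfolding hermitian_mat_iff[OF T]
  proof (intro allI impI)
    fix i j assume ij: "i < n" "j < n"
    have "(\<Sum>k\<le>Polynomial.degree p. of_real (coeff p k) * (A ^\<^sub>m k) $$ (i, j))
      = (\<Sum>k\<le>Polynomial.degree p. of_real (coeff p k) * cnj ((A ^\<^sub>m k) $$ (j, i)))"
      by (intro sum.cong refl arg_cong2[where f = "(*)"] hermitian_pow[OF A] ij)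
    then show "T $$ (i, j) = cnj (T $$ (j, i))" unfolding T_poly[OF ij] T_poly[OF ij(2,1)] by simp
  qed
  have "pos_semidef (T * T)"
    unfolding pos_semidef_def
  proof (intro conjI ballI hermitian_mult_self[OF T hT])
    fix v :: "complex Matrix.vec" assume "v \<in> carrier_vec (dim_row (T * T))"
    then have v: "v \<in> carrier_vec n" using T by simp
    have "(T * T *\<^sub>v v) \<bullet>c v = (T *\<^sub>v (T *\<^sub>v v)) \<bullet>c v" using T v by simp
    also have "\<dots> = (T *\<^sub>v v) \<bullet>c (T *\<^sub>v v)" using T v by (intro hermitian_inner[OF T hT]) auto
    finally show "0 \<le> Re ((T * T *\<^sub>v v) \<bullet>c v)"
      using conjugate_square_ge_0_vec[of "T *\<^sub>v v"] by (simp add: less_eq_complex_def)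
  qed
  moreover have "(T * T) * (T * T) = A"
  proof -
    have "of_real (t i) * of_real (t i) * (of_real (t i) * of_real (t i)) = complex_of_real (d i)" if "i < n" for i
    proof -
      have "0 \<le> d i" using ev d that by blast
      then have "t i * t i * (t i * t i) = d i" by (simp add: t_def)
      then show ?thesis by (simp only: of_real_mult[symmetric])
    qed
    then have "D (\<lambda>i. of_real (t i) * of_real (t i) * (of_real (t i) * of_real (t i))) = D (\<lambda>i. of_real (d i))"
      unfolding D_def by (intro arg_cong[where f = "\<lambda>X. P * X * Q"] eq_matI) auto
    moreover have "A = D (\<lambda>i. of_real (d i))" unfolding D_def by (rule A_eq)
    ultimately show ?thesis by (simp only: T_def D_mult)
  qed
  ultimately show ?thesis using T by (intro exI[of _ "T * T"]) auto
qed

lemma mat_sqrt: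
  assumes "A \<in> carrier_mat n n" "hermitian_mat A" and "\<And>e. eigenvalue A (complex_of_real e) \<Longrightarrow> 0 \<le> e"
  shows "mat_sqrt A \<in> carrier_mat n n" "hermitian_mat (mat_sqrt A)" "mat_sqrt A * mat_sqrt A = A"
proof -
  have "dim_row A = n" using assms(1) by simp
  then have "\<exists>S. S \<in> carrier_mat (dim_row A) (dim_row A) \<and> pos_semidef S \<and> S * S = A"
    using pos_semidef_sqrt_exists[OF assms] by simp
  from someI_ex[OF this]
  have "mat_sqrt A \<in> carrier_mat (dim_row A) (dim_row A) \<and> pos_semidef (mat_sqrt A) \<and> mat_sqrt A * mat_sqrt A = A"
    unfolding mat_sqrt_def .
  then show "mat_sqrt A \<in> carrier_mat n n" "hermitian_mat (mat_sqrt A)" "mat_sqrt A * mat_sqrt A = A"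
    using assms(1) by (auto simp: pos_semidef_def)
qed

lemma loewner_eigenvalue_bounds:
  assumes A: "A \<in> carrier_mat n n"
    and le: "loewner_le (complex_of_real a \<cdot>\<^sub>m 1\<^sub>m n) A" and less: "loewner_less A (complex_of_real b \<cdot>\<^sub>m 1\<^sub>m n)"
    and ev: "eigenvalue A (complex_of_real e)"
  shows "a \<le> e" "e < b"
proof -
  obtain v where v: "v \<in> carrier_vec n" "v \<noteq> 0\<^sub>v n" and Av: "A *\<^sub>v v = of_real e \<cdot>\<^sub>v v"
    using ev A by (auto simp: eigenvalue_def eigenvector_def)
  have scalar: "(complex_of_real x \<cdot>\<^sub>m 1\<^sub>m n) *\<^sub>v v = of_real x \<cdot>\<^sub>v v" for x
  proof (rule eq_vecI)
    fix i assume "i < dim_vec (of_real x \<cdot>\<^sub>v v)"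
    then have i: "i < n" using v(1) by simp
    have "row (complex_of_real x \<cdot>\<^sub>m 1\<^sub>m n) i = of_real x \<cdot>\<^sub>v unit_vec n i"
      using i by (intro eq_vecI) auto
    then show "((complex_of_real x \<cdot>\<^sub>m 1\<^sub>m n) *\<^sub>v v) $ i = (of_real x \<cdot>\<^sub>v v) $ i"
      using i v(1) by simp
  qed (use v in simp)
  have "(A - complex_of_real a \<cdot>\<^sub>m 1\<^sub>m n) *\<^sub>v v = of_real (e - a) \<cdot>\<^sub>v v"
    using A v(1) minus_mult_distrib_mat_vec[of A n n "complex_of_real a \<cdot>\<^sub>m 1\<^sub>m n" v]
    by (simp add: Av scalar) (auto intro!: eq_vecI simp: algebra_simps)
  moreover have "0 \<le> Re (((A - complex_of_real a \<cdot>\<^sub>m 1\<^sub>m n) *\<^sub>v v) \<bullet>c v)"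
    using le v(1) A by (auto simp: loewner_le_def pos_semidef_def)
  ultimately have "0 \<le> (e - a) * Re (v \<bullet>c v)" using v(1) by simp
  then show "a \<le> e" using inner_self_pos[OF v] by (simp add: zero_le_mult_iff)
  have "(complex_of_real b \<cdot>\<^sub>m 1\<^sub>m n - A) *\<^sub>v v = of_real (b - e) \<cdot>\<^sub>v v"
    using A v(1) minus_mult_distrib_mat_vec[of "complex_of_real b \<cdot>\<^sub>m 1\<^sub>m n" n n A v]
    by (simp add: Av scalar) (auto intro!: eq_vecI simp: algebra_simps)
  moreover have "0 < Re (((complex_of_real b \<cdot>\<^sub>m 1\<^sub>m n - A) *\<^sub>v v) \<bullet>c v)"
    using less v A by (auto simp: loewner_less_def pos_def_def)
  ultimately have "0 < (b - e) * Re (v \<bullet>c v)" using v(1) by simp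
  then show "e < b" using inner_self_pos[OF v] by (simp add: zero_less_mult_iff)
qed

lemma proots_linear_factors:
  "proots (\<Prod>i\<leftarrow>[0..<n]. [:- f i, 1:]) = image_mset f (mset_set {..<n})"
  for f :: "nat \<Rightarrow> 'a :: idom"
proof (induction n)
  case (Suc n)
  have "(\<Prod>i\<leftarrow>[0..<n]. [:- f i, 1:]) \<noteq> 0" by (auto simp: prod_list_zero_iff)
  then have mult: "proots ((\<Prod>i\<leftarrow>[0..<n]. [:- f i, 1:]) * [:- f n, 1:])
      = proots (\<Prod>i\<leftarrow>[0..<n]. [:- f i, 1:]) + proots [:- f n, 1:]"
    by (rule proots_mult) simp
  have eq: "(\<Prod>i\<leftarrow>[0..<Suc n]. [:- f i, 1:]) = (\<Prod>i\<leftarrow>[0..<n]. [:- f i, 1:]) * [:- f n, 1:]"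
    by simp
  show ?case unfolding eq mult Suc by (simp add: lessThan_Suc)
qed simp

text \<open>The test function \<open>f\<close> only has to agree with the power on the spectrum, which allows a bounded one.\<close>

theorem trace_pow_empirical:
  assumes A: "A \<in> carrier_mat n n" "hermitian_mat A" and n: "n \<ge> 1"
    and f: "\<And>e. eigenvalue A (complex_of_real e) \<Longrightarrow> f e = e ^ k" and cont: "f \<in> borel_measurable borel"
  shows "mat_trace (A ^\<^sub>m k) = of_nat n * of_real (integral\<^sup>L (empirical_eigenvalue_dist A) f)"
proof -
  obtain P Q and d :: "nat \<Rightarrow> real" where PQ: "P \<in> carrier_mat n n" "Q \<in> carrier_mat n n" "P * Q = 1\<^sub>m n" "Q * P = 1\<^sub>m n"
    and d: "\<And>i. i < n \<Longrightarrow> eigenvalue A (of_real (d i))"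
    and A_eq: "A = P * mat n n (\<lambda>(i, j). if i = j then of_real (d i) else 0) * Q"
    and cp: "char_poly A = (\<Prod>i\<leftarrow>[0..<n]. [:- of_real (d i), 1:])"
    using hermitian_diagonalizable[OF A] by blast
  have Ak: "A ^\<^sub>m k \<in> carrier_mat n n" using A(1) by simp
  have "(A ^\<^sub>m k) $$ (i, i) = (\<Sum>l<n. P $$ (i, l) * of_real (d l) ^ k * Q $$ (l, i))" if "i < n" for i
    unfolding A_eq diagonal_conjugate_power[OF PQ(1,2,4,3)] by (rule diagonal_conjugate_entry[OF PQ(1,2) that that])
  then have "mat_trace (A ^\<^sub>m k) = (\<Sum>i<n. \<Sum>l<n. P $$ (i, l) * of_real (d l) ^ k * Q $$ (l, i))"
    using A(1) by (simp add: mat_trace_def)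
  also have "\<dots> = (\<Sum>l<n. of_real (d l) ^ k * (\<Sum>i<n. Q $$ (l, i) * P $$ (i, l)))"
    by (subst sum.swap) (simp add: sum_distrib_left mult_ac)
  also have "\<dots> = (\<Sum>l<n. of_real (d l) ^ k)"
  proof (intro sum.cong refl)
    fix l assume l: "l \<in> {..<n}"
    have "(\<Sum>i<n. Q $$ (l, i) * P $$ (i, l)) = (Q * P) $$ (l, l)"
      using PQ(1,2) l by (simp add: scalar_prod_def atLeast0LessThan)
    then show "of_real (d l) ^ k * (\<Sum>i<n. Q $$ (l, i) * P $$ (i, l)) = complex_of_real (d l) ^ k"
      using l by (simp add: PQ(4))
  qed
  finally have trace: "mat_trace (A ^\<^sub>m k) = of_real (\<Sum>l<n. d l ^ k)" by simp
  have roots: "proots (char_poly A) = image_mset (\<lambda>i. of_real (d i)) (mset_set {..<n})"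
    unfolding cp by (rule proots_linear_factors)
  have "integral\<^sup>L (empirical_eigenvalue_dist A) f
      = measure_pmf.expectation (pmf_of_multiset (proots (char_poly A))) (\<lambda>z. f (Re z))"
    unfolding empirical_eigenvalue_dist_def using cont by (subst integral_distr) auto
  also have "\<dots> = (\<Sum>l<n. f (d l)) / n"
  proof -
    have ne: "finite {..<n}" "{..<n} \<noteq> {}" using n by (auto simp: lessThan_empty_iff)
    show ?thesis unfolding roots map_pmf_of_set[OF ne, symmetric]
      by (simp add: integral_pmf_of_set[OF ne(2,1)])
  qed
  also have "\<dots> = (\<Sum>l<n. d l ^ k) / n" using f d by simp
  finally show ?thesis using trace n by simp
qed

lemma empirical_real_distribution: "real_distribution (empirical_eigenvalue_dist A)"
  unfolding empirical_eigenvalue_dist_def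
  by (intro prob_space.real_distribution_distr) (auto intro: measure_pmf.prob_space_axioms)

section \<open>Polynomials in the window matrices\<close>

lemma lin_sum: "finite S \<Longrightarrow> lin (\<lambda>v. \<Sum>s\<in>S. f s v) ps = (\<Sum>s\<in>S. lin (f s) ps)"
  by (induction S rule: finite_induct) (simp_all add: lin_add lin_0)

text \<open>The polynomial \<open>p\<close> in the matrix of colour \<open>c\<close>, as a combination of words.\<close>

definition colour_poly :: "bool \<Rightarrow> complex poly \<Rightarrow> (complex \<times> (bool \<times> nat) list) list" where
  "colour_poly c p = map (\<lambda>k. (coeff p k, replicate k (c, 1))) [0..<Suc (Polynomial.degree p)]"

context gram_sequence
begin

definition colour_entry :: "nat \<Rightarrow> nat \<Rightarrow> (bool \<times> nat) list \<Rightarrow> nat \<Rightarrow> nat \<Rightarrow> 'w \<Rightarrow> complex" where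
  "colour_entry L N u i j w = (\<Sum>v\<leftarrow>expand L u. entry (h N) N v i j w)"

lemma colour_entry_Nil: "colour_entry L N [] i j w = of_bool (i = j)"
  by (simp add: colour_entry_def)

lemma colour_entry_append:
  assumes "i < N"
  shows "colour_entry L N (u @ v) i j w = (\<Sum>s<N. colour_entry L N u i s w * colour_entry L N v s j w)"
proof -
  have "colour_entry L N (u @ v) i j w
      = (\<Sum>a\<leftarrow>expand L u. \<Sum>b\<leftarrow>expand L v. \<Sum>s<N. entry (h N) N a i s w * entry (h N) N b s j w)"
    unfolding colour_entry_def sum_expand_append entry_append[OF assms] ..
  also have "\<dots> = (\<Sum>s<N. \<Sum>a\<leftarrow>expand L u. \<Sum>b\<leftarrow>expand L v. entry (h N) N a i s w * entry (h N) N b s j w)"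
    unfolding sum_sum_list_swap ..
  finally show ?thesis
    by (simp add: colour_entry_def sum_list_mult_const sum_list_const_mult)
qed

lemma colour_entry_single: "j < N \<Longrightarrow> colour_entry L N [(c, k)] i j w = (\<Sum>l\<leftarrow>window L c. h N k (i + l) (j + l) w)"
  unfolding colour_entry_def sum_expand_Cons by (simp add: entry_letter del: entry.simps)

lemma colour_trace_entry: "colour_trace L N u w = (\<Sum>i<N. colour_entry L N u i i w) / of_nat N"
  unfolding colour_trace_def colour_entry_def ntrace_def sum_list_divide[symmetric] sum_sum_list_swap ..

lemma pow_entry:
  assumes X: "X \<in> carrier_mat N N" "\<And>i j. i < N \<Longrightarrow> j < N \<Longrightarrow> X $$ (i, j) = colour_entry L N [(c, 1)] i j w"
  shows "i < N \<Longrightarrow> j < N \<Longrightarrow> (X ^\<^sub>m k) $$ (i, j) = colour_entry L N (replicate k (c, 1)) i j w"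
proof (induction k arbitrary: j)
  case 0
  then show ?case using X(1) by (simp add: colour_entry_Nil)
next
  case (Suc k)
  have "replicate (Suc k) (c, 1::nat) = replicate k (c, 1) @ [(c, 1)]"
    by (simp add: replicate_append_same)
  then have "colour_entry L N (replicate (Suc k) (c, 1)) i j w
      = (\<Sum>s<N. colour_entry L N (replicate k (c, 1)) i s w * colour_entry L N [(c, 1)] s j w)"
    by (simp only: colour_entry_append[OF Suc.prems(1)])
  also have "\<dots> = (\<Sum>s<N. (X ^\<^sub>m k) $$ (i, s) * X $$ (s, j))"
    using Suc X(2) by (intro sum.cong) auto
  also have "\<dots> = (X ^\<^sub>m Suc k) $$ (i, j)"
    using X(1) Suc.prems pow_carrier_mat[OF X(1), of k] by (simp add: scalar_prod_def atLeast0LessThan)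
  finally show ?case ..
qed

lemma product_entry:
  assumes X: "\<And>c. X c \<in> carrier_mat N N"
    and entry: "\<And>c i j. i < N \<Longrightarrow> j < N \<Longrightarrow> X c $$ (i, j) = colour_entry L N [(c, 1)] i j w"
  shows "foldr (*) (map (\<lambda>(c, p). mat_poly p (X c)) cps) (1\<^sub>m N) \<in> carrier_mat N N"
    and "i < N \<Longrightarrow> j < N \<Longrightarrow> foldr (*) (map (\<lambda>(c, p). mat_poly p (X c)) cps) (1\<^sub>m N) $$ (i, j)
      = lin (\<lambda>v. colour_entry L N v i j w) (map (\<lambda>(c, p). colour_poly c p) cps)"
proof -
  have poly: "mat_poly p (X c) \<in> carrier_mat N N" for c p
    using X[of c] by (simp add: mat_poly_def)
  have poly_entry: "mat_poly p (X c) $$ (i, j) = (\<Sum>(x, v)\<leftarrow>colour_poly c p. x * colour_entry L N v i j w)"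
    if "i < N" "j < N" for c p i j
  proof -
    have "mat_poly p (X c) $$ (i, j) = (\<Sum>k\<le>Polynomial.degree p. coeff p k * (X c ^\<^sub>m k) $$ (i, j))"
      using X[of c] that by (simp add: mat_poly_def)
    also have "\<dots> = (\<Sum>k\<le>Polynomial.degree p. coeff p k * colour_entry L N (replicate k (c, 1)) i j w)"
      using pow_entry[OF X[of c] entry that] by simp
    also have "\<dots> = (\<Sum>(x, v)\<leftarrow>colour_poly c p. x * colour_entry L N v i j w)"
      unfolding colour_poly_def
      by (simp add: comp_def sum_list_distinct_conv_sum_set atLeast0LessThan lessThan_Suc_atMost del: upt_Suc)
    finally show ?thesis .
  qed
  have "foldr (*) (map (\<lambda>(c, p). mat_poly p (X c)) cps) (1\<^sub>m N) \<in> carrier_mat N N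
    \<and> (\<forall>i<N. \<forall>j<N. foldr (*) (map (\<lambda>(c, p). mat_poly p (X c)) cps) (1\<^sub>m N) $$ (i, j)
      = lin (\<lambda>v. colour_entry L N v i j w) (map (\<lambda>(c, p). colour_poly c p) cps))"
  proof (induction cps)
    case Nil
    then show ?case by (simp add: colour_entry_Nil)
  next
    case (Cons cp cps)
    obtain c p where cp: "cp = (c, p)" by (cases cp)
    let ?Q = "foldr (*) (map (\<lambda>(c, p). mat_poly p (X c)) cps) (1\<^sub>m N)"
    let ?ps = "map (\<lambda>(c, p). colour_poly c p) cps"
    have Q: "?Q \<in> carrier_mat N N" using Cons by blast
    have "(mat_poly p (X c) * ?Q) $$ (i, j) = lin (\<lambda>v. colour_entry L N v i j w) (colour_poly c p # ?ps)"
      if ij: "i < N" "j < N" for i j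
    proof -
      have "(mat_poly p (X c) * ?Q) $$ (i, j) = (\<Sum>s<N. mat_poly p (X c) $$ (i, s) * ?Q $$ (s, j))"
        using poly[of p c] Q ij by (simp add: scalar_prod_def atLeast0LessThan)
      also have "\<dots> = (\<Sum>s<N. (\<Sum>(x, v)\<leftarrow>colour_poly c p. x * colour_entry L N v i s w)
          * lin (\<lambda>v. colour_entry L N v s j w) ?ps)"
        using Cons ij by (intro sum.cong) (auto simp: poly_entry)
      also have "\<dots> = (\<Sum>(x, v)\<leftarrow>colour_poly c p. x * (\<Sum>s<N. colour_entry L N v i s w
          * lin (\<lambda>v. colour_entry L N v s j w) ?ps))"
        unfolding case_prod_unfold sum_list_mult_const[symmetric] sum_sum_list_swap
        by (simp add: sum_distrib_left mult.assoc)
      also have "\<dots> = lin (\<lambda>v. colour_entry L N v i j w) (colour_poly c p # ?ps)"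
        by (simp add: colour_entry_append[OF ij(1)] lin_sum lin_cmult)
      finally show ?thesis .
    qed
    then show ?case using poly[of p c] Q cp by simp
  qed
  then show "foldr (*) (map (\<lambda>(c, p). mat_poly p (X c)) cps) (1\<^sub>m N) \<in> carrier_mat N N"
    and "i < N \<Longrightarrow> j < N \<Longrightarrow> foldr (*) (map (\<lambda>(c, p). mat_poly p (X c)) cps) (1\<^sub>m N) $$ (i, j)
      = lin (\<lambda>v. colour_entry L N v i j w) (map (\<lambda>(c, p). colour_poly c p) cps)" by blast+
qed

lemma product_trace:
  assumes X: "\<And>c. X c \<in> carrier_mat N N"
    and entry: "\<And>c i j. i < N \<Longrightarrow> j < N \<Longrightarrow> X c $$ (i, j) = colour_entry L N [(c, 1)] i j w"
  shows "mat_trace (foldr (*) (map (\<lambda>(c, p). mat_poly p (X c)) cps) (1\<^sub>m N)) / of_nat N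
    = lin (\<lambda>v. colour_trace L N v w) (map (\<lambda>(c, p). colour_poly c p) cps)"
proof -
  let ?Q = "foldr (*) (map (\<lambda>(c, p). mat_poly p (X c)) cps) (1\<^sub>m N)"
  note Q = product_entry[OF X entry, where cps = cps]
  have "mat_trace ?Q = (\<Sum>i<N. lin (\<lambda>v. colour_entry L N v i i w) (map (\<lambda>(c, p). colour_poly c p) cps))"
    using Q by (simp add: mat_trace_def)
  then show ?thesis
    unfolding colour_trace_entry divide_inverse lin_mult_right by (simp add: lin_sum)
qed

text \<open>The trace of a product of polynomials in the two matrices is a multilinear expression in the traces of
  coloured words, so its almost sure limit is the same expression in the limiting moments; the
  freeness of the latter finishes the proof.\<close>

theorem window_matrices_free:
  fixes X :: "bool \<Rightarrow> nat \<Rightarrow> 'w \<Rightarrow> complex mat" and L :: nat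
  assumes carrier: "\<And>c N w. X c N w \<in> carrier_mat N N"
    and entry: "\<And>c N w i j. N \<ge> 1 \<Longrightarrow> w \<in> space \<Omega> \<Longrightarrow> i < N \<Longrightarrow> j < N \<Longrightarrow>
      X c N w $$ (i, j) = (\<Sum>l\<leftarrow>window L c. h N 1 (i + l) (j + l) w)"
  shows "as_asymptotically_free \<Omega> [X True, X False]"
proof -
  have entry': "X c N w $$ (i, j) = colour_entry L N [(c, 1)] i j w"
    if "N \<ge> 1" "w \<in> space \<Omega>" "i < N" "j < N" for c N w i j
    using entry[OF that] colour_entry_single[OF that(4)] by simp
  have limit: "AE w in \<Omega>. (\<lambda>N. mat_trace (foldr (*) (map (\<lambda>(c, p). mat_poly p (X c N w)) cps) (1\<^sub>m N)) / of_nat N)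
      \<longlonglongrightarrow> lin (limit_moment L) (map (\<lambda>(c, p). colour_poly c p) cps)" for cps
    using colour_trace_AE[of L] AE_space
  proof eventually_elim
    case (elim w)
    have "(\<lambda>N. lin (\<lambda>v. colour_trace L N v w) (map (\<lambda>(c, p). colour_poly c p) cps))
        \<longlonglongrightarrow> lin (limit_moment L) (map (\<lambda>(c, p). colour_poly c p) cps)"
      using elim(1) by (intro lin_tendsto) blast
    moreover have "\<forall>\<^sub>F N in sequentially. lin (\<lambda>v. colour_trace L N v w) (map (\<lambda>(c, p). colour_poly c p) cps)
        = mat_trace (foldr (*) (map (\<lambda>(c, p). mat_poly p (X c N w)) cps) (1\<^sub>m N)) / of_nat N"
    proof (rule eventually_sequentiallyI[of 1])
      fix N :: nat assume N: "1 \<le> N"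
      show "lin (\<lambda>v. colour_trace L N v w) (map (\<lambda>(c, p). colour_poly c p) cps)
        = mat_trace (foldr (*) (map (\<lambda>(c, p). mat_poly p (X c N w)) cps) (1\<^sub>m N)) / of_nat N"
        by (rule product_trace[where X = "\<lambda>c. X c N w", symmetric]) (rule carrier entry'[OF N elim(2)]; assumption?)+
    qed
    ultimately show ?case by (rule Lim_transform_eventually)
  qed
  have single: "AE w in \<Omega>. (\<lambda>N. mat_trace (mat_poly p (X c N w)) / of_nat N)
      \<longlonglongrightarrow> lin (limit_moment L) [colour_poly c p]" for c p
  proof -
    have "mat_poly p (X c N w) * 1\<^sub>m N = mat_poly p (X c N w)" for N w
    proof (rule right_mult_one_mat)
      show "mat_poly p (X c N w) \<in> carrier_mat N N" using carrier[of c N w] by (simp add: mat_poly_def)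
    qed
    then show ?thesis using limit[of "[(c, p)]"] by simp
  qed
  interpret free: free_recursion "limit_moment L" "\<lambda>k. of_nat L * \<rho> k"
    by unfold_locales (rule limit_moment_rotate, rule limit_moment_loop)
  have centered: "free.centered c (colour_poly c p)" if "as_centered \<Omega> (X c) p" for c p
  proof -
    have "AE w in \<Omega>. lin (limit_moment L) [colour_poly c p] = 0"
      using single[of p c] that[unfolded as_centered_def]
      by eventually_elim (rule LIMSEQ_unique)
    then have "lin (limit_moment L) [colour_poly c p] = 0" by simp
    then have "(\<Sum>(x, v)\<leftarrow>colour_poly c p. x * limit_moment L v) = 0" by simp
    moreover have "\<forall>(x, v)\<in>set (colour_poly c p). \<forall>a\<in>set v. fst a = c"
      by (auto simp: colour_poly_def)
    ultimately show ?thesis unfolding free.centered_def by blast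
  qed
  have herm: "random_hermitian_seq \<Omega> (X c)" for c
    unfolding random_hermitian_seq_def
  proof (intro allI impI conjI ballI)
    fix N :: nat and w assume N: "1 \<le> N" and w: "w \<in> space \<Omega>"
    show "X c N w \<in> carrier_mat N N" by (rule carrier)
    show "hermitian_mat (X c N w)"
      unfolding hermitian_mat_iff[OF carrier]
    proof (intro allI impI)
      fix i j assume ij: "i < N" "j < N"
      have "cnj (\<Sum>l\<leftarrow>ls. h N 1 (j + l) (i + l) w) = (\<Sum>l\<leftarrow>ls. h N 1 (i + l) (j + l) w)" for ls
        by (induction ls) (simp_all add: h_cnj[OF N])
      then show "X c N w $$ (i, j) = cnj (X c N w $$ (j, i))"
        unfolding entry[OF N w ij] entry[OF N w ij(2,1)] by simp
    qed
  next
    fix N i j :: nat assume N: "1 \<le> N" and ij: "i < N" "j < N"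
    have h_meas: "h N k n p \<in> borel_measurable \<Omega>" for k n p
      unfolding h_def
      by (rule borel_measurable_integrable, rule complex_gaussian_family.polynomial_integrable[OF
            gaussian_gram.axioms(1)[OF gaussian_gram[OF N]] gaussian_gram.polynomial_gram[OF gaussian_gram[OF N]]])
    have "(\<lambda>w. \<Sum>l\<leftarrow>ls. h N 1 (i + l) (j + l) w) \<in> borel_measurable \<Omega>" for ls
      by (induction ls) (auto intro!: borel_measurable_add h_meas)
    then show "(\<lambda>w. X c N w $$ (i, j)) \<in> borel_measurable \<Omega>"
      by (subst measurable_cong[OF entry[OF N _ ij]]) assumption+
  qed
  have Xs: "[X True, X False] ! i = X (i = 0)" if "i < 2" for i
    using that by (cases i) (auto simp: less_Suc_eq)
  show ?thesis
    unfolding as_asymptotically_free_def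
  proof (intro conjI allI impI)
    show "\<forall>Y\<in>set [X True, X False]. random_hermitian_seq \<Omega> Y" using herm by simp
    show "\<forall>Y\<in>set [X True, X False]. has_as_limit_distribution \<Omega> Y"
      unfolding has_as_limit_distribution_def using single by auto
  next
    fix ips :: "(nat \<times> complex poly) list"
    assume ips: "ips \<noteq> [] \<and> (\<forall>(i, p)\<in>set ips. i < length [X True, X False] \<and> as_centered \<Omega> ([X True, X False] ! i) p)
      \<and> distinct_adj (map fst ips)"
    define cps where "cps = map (\<lambda>(i, p). (i = 0, p)) ips"
    have idx: "i < 2" "as_centered \<Omega> (X (i = 0)) p" if "(i, p) \<in> set ips" for i p
    proof -
      from ips have "\<forall>(i, p)\<in>set ips. i < length [X True, X False] \<and> as_centered \<Omega> ([X True, X False] ! i) p"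
        by (elim conjE)
      from bspec[OF this that] have i: "i < 2" and c: "as_centered \<Omega> ([X True, X False] ! i) p"
        by (simp_all add: numeral_2_eq_2)
      show "i < 2" by (rule i)
      show "as_centered \<Omega> (X (i = 0)) p" using c unfolding Xs[OF i] .
    qed
    have "distinct_adj (map (\<lambda>i. i = 0) (map fst ips))"
    proof (rule distinct_adj_mapI)
      show "distinct_adj (map fst ips)" using ips by blast
      show "inj_on (\<lambda>i. i = 0) (set (map fst ips))"
      proof (rule inj_onI)
        fix i j assume "i \<in> set (map fst ips)" "j \<in> set (map fst ips)"
        then have "i < 2" "j < 2" using idx(1) by auto
        moreover assume "(i = 0) = (j = 0)"
        ultimately show "i = j" by linarith
      qed
    qed
    then have adj: "distinct_adj (map fst cps)"
      by (simp add: cps_def comp_def case_prod_unfold)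
    have cent: "list_all2 free.centered (map fst cps) (map (\<lambda>(c, p). colour_poly c p) cps)"
      unfolding cps_def list.rel_map list_all2_same using idx(2) centered by (simp add: split_beta)
    have "lin (limit_moment L) (map (\<lambda>(c, p). colour_poly c p) cps) = 0"
      using free.alternating_centered[OF cent _ adj, of "[]"] ips by (simp add: cps_def)
    then have "AE w in \<Omega>. (\<lambda>N. mat_trace (foldr (*) (map (\<lambda>(c, p). mat_poly p (X c N w)) cps) (1\<^sub>m N)) / of_nat N) \<longlonglongrightarrow> 0"
      using limit[of cps] by simp
    moreover have "map (\<lambda>(c, p). mat_poly p (X c N w)) cps = map (\<lambda>(i, p). mat_poly p (([X True, X False] ! i) N w)) ips" for N w
      using idx(1) Xs by (auto simp: cps_def)
    ultimately show "AE w in \<Omega>. (\<lambda>N. mat_trace (foldr (*) (map (\<lambda>(i, p). mat_poly p (([X True, X False] ! i) N w)) ips) (1\<^sub>m N))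
        / of_nat N) \<longlonglongrightarrow> 0"
      by simp
  qed
qed

end

section \<open>The block Hankel matrices\<close>

lemma (in prob_space) indep_vars_reindex:
  assumes inj: "inj_on f J" and indep: "indep_vars M' X (f ` J)"
  shows "indep_vars (\<lambda>j. M' (f j)) (\<lambda>j. X (f j)) J"
proof -
  have rv: "random_variable (M' i) (X i)" if "i \<in> f ` J" for i
    using indep that unfolding indep_vars_def2 by blast
  have sets: "indep_sets (\<lambda>i. {X i -` A \<inter> space M |A. A \<in> sets (M' i)}) (f ` J)"
    using indep by (simp add: indep_vars_def2)
  have "indep_sets (\<lambda>j. {X (f j) -` A \<inter> space M |A. A \<in> sets (M' (f j))}) J"
  proof (rule indep_setsI)
    show "{X (f j) -` A \<inter> space M |A. A \<in> sets (M' (f j))} \<subseteq> events" if "j \<in> J" for j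
      using measurable_sets[OF rv[of "f j"]] that by auto
    fix A K
    assume K: "K \<noteq> {}" "K \<subseteq> J" "finite K"
      and A: "\<forall>j\<in>K. A j \<in> {X (f j) -` A \<inter> space M |A. A \<in> sets (M' (f j))}"
    define B where "B = A \<circ> inv_into J f"
    have B: "B (f j) = A j" if "j \<in> K" for j
      using that K(2) inj by (auto simp: B_def)
    have "prob (\<Inter>i\<in>f ` K. B i) = (\<Prod>i\<in>f ` K. prob (B i))"
      using K A B by (intro indep_setsD[OF sets]) auto
    also have "\<dots> = (\<Prod>j\<in>K. prob (B (f j)))"
      using inj_on_subset[OF inj K(2)] by (simp add: prod.reindex)
    finally show "prob (\<Inter>j\<in>K. A j) = (\<Prod>j\<in>K. prob (A j))" using B by simp
  qed
  then show ?thesis using rv by (simp add: indep_vars_def2)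
qed

lemma pow_mat_add:
  fixes A :: "complex mat"
  assumes A: "A \<in> carrier_mat n n"
  shows "A ^\<^sub>m k * A ^\<^sub>m j = A ^\<^sub>m (k + j)"
proof (induction j)
  case 0
  then show ?case using A by simp
next
  case (Suc j)
  have "A ^\<^sub>m k * A ^\<^sub>m Suc j = A ^\<^sub>m k * A ^\<^sub>m j * A"
    using A by (simp add: assoc_mult_mat[of _ n n _ n _ n])
  then show ?case using Suc by simp
qed

text \<open>Row \<open>r\<close> of the block Hankel matrix is split into block row \<open>l\<close> and component \<open>a\<close>.\<close>

lemma block_hankel_gram_entry:
  assumes "i < N" "j < N" and y: "\<And>n. n \<ge> 1 \<Longrightarrow> y n \<in> carrier_vec m"
  shows "(mat_adjoint (block_hankel m L N s y) * block_hankel m L N s y) $$ (i, j)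
    = (\<Sum>l<L. y (Suc (j + (s + l))) \<bullet>c y (Suc (i + (s + l)))) / of_nat N"
proof -
  let ?W = "block_hankel m L N s y"
  define g where "g l a = cnj (y (s + l + i + 1) $ a) * y (s + l + j + 1) $ a / of_nat N" for l a
  have dims: "dim_row ?W = m * L" "dim_col ?W = N" by (simp_all add: block_hankel_def)
  have sqrt: "complex_of_real (sqrt (real N)) * complex_of_real (sqrt (real N)) = of_nat N"
    by (simp flip: of_real_mult)
  have "(mat_adjoint ?W * ?W) $$ (i, j) = (\<Sum>r<m * L. mat_adjoint ?W $$ (i, r) * ?W $$ (r, j))"
    using assms dims by (simp add: scalar_prod_def atLeast0LessThan mat_adjoint_dim)
  also have "\<dots> = (\<Sum>r<m * L. g (r div m) (r mod m))"
  proof (rule sum.cong[OF refl])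
    fix r assume "r \<in> {..<m * L}"
    then have r: "r < m * L" by simp
    have "mat_adjoint ?W $$ (i, r) = cnj (?W $$ (r, i))"
      using dims assms r by (intro mat_adjoint_index) auto
    then show "mat_adjoint ?W $$ (i, r) * ?W $$ (r, j) = g (r div m) (r mod m)"
      using r assms(1,2) sqrt by (simp add: block_hankel_def g_def)
  qed
  also have "\<dots> = (\<Sum>l<L. \<Sum>a<m. g l a)"
  proof (cases "m = 0")
    case False
    have "(\<Sum>l<L. \<Sum>a<m. g l a) = (\<Sum>(l, a)\<in>{..<L} \<times> {..<m}. g l a)"
      by (simp add: sum.cartesian_product)
    also have "\<dots> = (\<Sum>r<m * L. g (r div m) (r mod m))"
    proof (rule sum.reindex_bij_witness[where i = "\<lambda>r. (r div m, r mod m)" and j = "\<lambda>(l, a). l * m + a"])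
      fix p assume "p \<in> {..<L} \<times> {..<m}"
      then obtain l a where p: "p = (l, a)" "l < L" "a < m" by auto
      have "l * m + a < Suc l * m" using p by simp
      also have "\<dots> \<le> L * m" using p(2) by (intro mult_le_mono1) simp
      finally show "(case p of (l, a) \<Rightarrow> l * m + a) \<in> {..<m * L}" using p by (simp add: mult.commute)
    qed (use False in \<open>auto simp: less_mult_imp_div_less mult.commute\<close>)
    finally show ?thesis ..
  qed simp
  also have "\<dots> = (\<Sum>l<L. y (Suc (j + (s + l))) \<bullet>c y (Suc (i + (s + l)))) / of_nat N"
    unfolding sum_divide_distrib
  proof (rule sum.cong[OF refl])
    fix l
    have dimy: "dim_vec (y (Suc n)) = m" for n using y[of "Suc n"] by auto
    show "(\<Sum>a<m. g l a) = y (Suc (j + (s + l))) \<bullet>c y (Suc (i + (s + l))) / of_nat N"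
      by (simp add: g_def scalar_prod_def atLeast0LessThan conjugate_complex_def sum_divide_distrib dimy
          ac_simps)
  qed
  finally show ?thesis .
qed

theorem proposition15:
  fixes \<Omega> :: "'w measure"
    and L :: nat and M :: "nat \<Rightarrow> nat"
    and a b c :: real
    and R :: "nat \<Rightarrow> complex mat"
    and \<omega> :: "real measure"
    and \<xi> y :: "nat \<Rightarrow> nat \<Rightarrow> 'w \<Rightarrow> complex vec"
    and Wp Wf :: "nat \<Rightarrow> 'w \<Rightarrow> complex mat"
  assumes "prob_space \<Omega>"
    and "L \<ge> 1"
    and "\<And>N. N \<ge> 1 \<Longrightarrow> M N \<ge> 1"
    and "c > 0"
    and "(\<lambda>N. real (M N * L) / real N) \<longlonglongrightarrow> c"
    and "a > 0" and "b > 0"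
    and "\<And>N. N \<ge> 1 \<Longrightarrow> R N \<in> carrier_mat (M N) (M N)"
    and "\<And>N. N \<ge> 1 \<Longrightarrow> pos_def (R N)"
    and "\<And>N. N \<ge> 1 \<Longrightarrow> loewner_le (complex_of_real a \<cdot>\<^sub>m 1\<^sub>m (M N)) (R N)"
    and "\<And>N. N \<ge> 1 \<Longrightarrow> loewner_less (R N) (complex_of_real b \<cdot>\<^sub>m 1\<^sub>m (M N))"
    and "real_distribution \<omega>"
    and "weak_conv_m (\<lambda>N. empirical_eigenvalue_dist (R N)) \<omega>"
    and "\<And>N. N \<ge> 1 \<Longrightarrow> iid_gaussian_vectors \<Omega> (M N) (\<xi> N)"
    and "\<And>N n w. y N n w = mat_sqrt (R N) *\<^sub>v \<xi> N n w"
    and "\<And>N w. Wp N w = W_past (M N) L N (\<lambda>n. y N n w)"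
    and "\<And>N w. Wf N w = W_future (M N) L N (\<lambda>n. y N n w)"
  shows "as_asymptotically_free \<Omega>
           [\<lambda>N w. mat_adjoint (Wf N w) * Wf N w, \<lambda>N w. mat_adjoint (Wp N w) * Wp N w]"
proof -
  interpret prob_space \<Omega> by fact
  note carrier_R = assms(8) and iid = assms(14) and y_def = assms(15)
  have herm_R: "hermitian_mat (R N)" if "N \<ge> 1" for N
    using assms(9)[OF that] by (simp add: pos_def_def)
  have bounds: "a \<le> x" "x < b" if "N \<ge> 1" "eigenvalue (R N) (complex_of_real x)" for N x
    using loewner_eigenvalue_bounds[OF carrier_R[OF that(1)] assms(10)[OF that(1)] assms(11)[OF that(1)] that(2)] by auto
  have nonneg: "0 \<le> x" if "N \<ge> 1" "eigenvalue (R N) (complex_of_real x)" for N x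
    using bounds(1)[OF that] assms(6) by linarith
  have sqrt_R: "mat_sqrt (R N) \<in> carrier_mat (M N) (M N)" "hermitian_mat (mat_sqrt (R N))"
      "mat_sqrt (R N) * mat_sqrt (R N) = R N" if "N \<ge> 1" for N
    by (rule mat_sqrt[OF carrier_R[OF that] herm_R[OF that] nonneg[OF that]]; assumption)+
  define P where "P N k i j = (R N ^\<^sub>m k) $$ (i, j)" for N k i j
  \<comment> \<open>The Gaussian vectors are numbered from 1, the windows from 0.\<close>
  define Z where "Z N = (\<lambda>(n, k) w. \<xi> N (Suc n) w $ k)" for N
  \<comment> \<open>On \<open>[a, b]\<close>, which contains the spectra, \<open>clip k\<close> is the \<open>k\<close>-th power; it is bounded, so that weak convergence applies to it.\<close>
  define clip where "clip k x = (min b (max 0 x)) ^ k" for k :: nat and x :: real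
  define \<rho> where "\<rho> k = complex_of_real (c / real L * integral\<^sup>L \<omega> (clip k))" for k

  have gram: "gaussian_gram \<Omega> (M N) (Z N) N (P N)" if N: "N \<ge> 1" for N
  proof (intro gaussian_gram.intro complex_gaussian_family.intro complex_gaussian_family_axioms.intro
      gaussian_gram_axioms.intro)
    show "prob_space \<Omega>" by fact
    let ?f = "\<lambda>(n, k). (Suc n, k) :: nat \<times> nat"
    have "indep_vars (\<lambda>_. borel) (\<lambda>(n, k) w. \<xi> N n w $ k) ({1..} \<times> {..<M N})"
      using iid[OF N] by (simp add: iid_gaussian_vectors_def)
    then have "indep_vars (\<lambda>_. borel) (\<lambda>(n, k) w. \<xi> N n w $ k) (?f ` (UNIV \<times> {..<M N}))"
      by (rule indep_vars_subset) auto
    moreover have "inj_on ?f (UNIV \<times> {..<M N})" by (auto simp: inj_on_def)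
    ultimately have indep: "indep_vars (\<lambda>_. borel) (\<lambda>p. (\<lambda>(n, k) w. \<xi> N n w $ k) (?f p)) (UNIV \<times> {..<M N})"
      using indep_vars_reindex[where f = ?f and M' = "\<lambda>_. borel" and X = "\<lambda>(n, k) w. \<xi> N n w $ k"] by blast
    have "Z N = (\<lambda>p. (\<lambda>(n, k) w. \<xi> N n w $ k) (?f p))"
      by (auto simp: Z_def fun_eq_iff)
    then show "indep_vars (\<lambda>_. borel) (Z N) (UNIV \<times> {..<M N})"
      using indep by simp
    show "std_complex_gaussian \<Omega> (Z N v)" if "v \<in> UNIV \<times> {..<M N}" for v
      using iid[OF N] that by (auto simp: iid_gaussian_vectors_def Z_def)
    show "N > 0" using N by simp
    fix k l i j assume ij: "i < M N" "j < M N"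
    have "P N (k + l) i j = (R N ^\<^sub>m k * R N ^\<^sub>m l) $$ (i, j)"
      by (simp add: P_def pow_mat_add[OF carrier_R[OF N]])
    then show "(\<Sum>s<M N. P N k i s * P N l s j) = P N (k + l) i j"
      using carrier_R[OF N] ij by (simp add: P_def scalar_prod_def atLeast0LessThan)
  qed
  have moments: "(\<lambda>N. (\<Sum>i<M N. P N k i i) / of_nat N) \<longlonglongrightarrow> \<rho> k" for k
  proof -
    have clip_cont: "isCont (clip k) x" for x
      unfolding clip_def by (intro continuous_intros)
    have "norm (clip k x) \<le> b ^ k" for x
      using assms(7) by (auto simp: clip_def norm_power intro!: power_mono)
    then have "(\<lambda>N. integral\<^sup>L (empirical_eigenvalue_dist (R N)) (clip k)) \<longlonglongrightarrow> integral\<^sup>L \<omega> (clip k)"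
      by (intro weak_conv_imp_integral_bdd_continuous_conv[OF empirical_real_distribution assms(12,13)] clip_cont)
    moreover have "(\<lambda>N. real (M N * L) / real N / real L) \<longlonglongrightarrow> c / real L"
      using assms(2,5) by (intro tendsto_divide tendsto_const) auto
    ultimately have "(\<lambda>N. complex_of_real (real (M N * L) / real N / real L
        * integral\<^sup>L (empirical_eigenvalue_dist (R N)) (clip k))) \<longlonglongrightarrow> \<rho> k"
      unfolding \<rho>_def by (intro tendsto_of_real tendsto_mult)
    moreover have "\<forall>\<^sub>F N in sequentially. complex_of_real (real (M N * L) / real N / real L
        * integral\<^sup>L (empirical_eigenvalue_dist (R N)) (clip k)) = (\<Sum>i<M N. P N k i i) / of_nat N"
    proof (rule eventually_sequentiallyI[of 1])
      fix N :: nat assume N: "1 \<le> N"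
      have "clip k x = x ^ k" if "eigenvalue (R N) (complex_of_real x)" for x
        using bounds[OF N that] assms(6) by (simp add: clip_def)
      moreover have "clip k \<in> borel_measurable borel"
        using clip_cont by (intro borel_measurable_continuous_onI continuous_at_imp_continuous_on) auto
      ultimately have "mat_trace (R N ^\<^sub>m k) = of_nat (M N) * of_real (integral\<^sup>L (empirical_eigenvalue_dist (R N)) (clip k))"
        by (intro trace_pow_empirical[OF carrier_R[OF N] herm_R[OF N] assms(3)[OF N]])
      moreover have "mat_trace (R N ^\<^sub>m k) = (\<Sum>i<M N. P N k i i)"
        using carrier_R[OF N] by (simp add: mat_trace_def P_def)
      ultimately show "complex_of_real (real (M N * L) / real N / real L
        * integral\<^sup>L (empirical_eigenvalue_dist (R N)) (clip k)) = (\<Sum>i<M N. P N k i i) / of_nat N"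
        using assms(2) by simp
    qed
    ultimately show ?thesis by (rule Lim_transform_eventually)
  qed
  have cnj_P: "P N k j i = cnj (P N k i j)" if "N \<ge> 1" "i < M N" "j < M N" for N k i j
    unfolding P_def by (rule hermitian_pow[OF carrier_R[OF that(1)] herm_R[OF that(1)] that(3) that(2)])
  interpret seq: gram_sequence \<Omega> M Z P \<rho>
    by (intro gram_sequence.intro gram_sequence_axioms.intro prob_space_axioms gram moments cnj_P)

  \<comment> \<open>The square root of the covariance disappears from the inner products.\<close>
  have inner: "y N (Suc p) w \<bullet>c y N (Suc n) w / of_nat N = seq.h N 1 n p w"
    if N: "N \<ge> 1" and w: "w \<in> space \<Omega>" for N n p w
  proof -
    let ?S = "mat_sqrt (R N)"
    have \<xi>: "\<xi> N (Suc n) w \<in> carrier_vec (M N)" for n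
      using iid[OF N] w by (simp add: iid_gaussian_vectors_def)
    have "y N (Suc p) w \<bullet>c y N (Suc n) w = (?S *\<^sub>v (?S *\<^sub>v \<xi> N (Suc p) w)) \<bullet>c \<xi> N (Suc n) w"
      unfolding y_def using sqrt_R[OF N] \<xi> by (intro hermitian_inner[symmetric]) auto
    also have "?S *\<^sub>v (?S *\<^sub>v \<xi> N (Suc p) w) = R N *\<^sub>v \<xi> N (Suc p) w"
      using assoc_mult_mat_vec[OF sqrt_R(1)[OF N] sqrt_R(1)[OF N] \<xi>, of p] sqrt_R(3)[OF N] by simp
    finally show ?thesis
      using carrier_R[OF N] carrier_vecD[OF \<xi>]
      by (simp add: seq.h_def gram_def P_def Z_def scalar_prod_def atLeast0LessThan conjugate_complex_def mult.commute)
  qed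
  define X where "X f N w = mat_adjoint (block_hankel (M N) L N (if f then L else 0) (\<lambda>n. y N n w))
    * block_hankel (M N) L N (if f then L else 0) (\<lambda>n. y N n w)" for f N w
  have "as_asymptotically_free \<Omega> [X True, X False]"
  proof (rule seq.window_matrices_free[where L = L])
    show "X f N w \<in> carrier_mat N N" for f N w
      unfolding X_def carrier_mat_def by (simp add: mat_adjoint_dim block_hankel_def)
    fix f and N i j :: nat and w assume N: "1 \<le> N" and w: "w \<in> space \<Omega>" and ij: "i < N" "j < N"
    let ?s = "if f then L else 0"
    have "y N n w \<in> carrier_vec (M N)" if "n \<ge> 1" for n
      unfolding y_def using sqrt_R(1)[OF N] iid[OF N] w that by (simp add: iid_gaussian_vectors_def)
    then have "X f N w $$ (i, j) = (\<Sum>l<L. y N (Suc (j + (?s + l))) w \<bullet>c y N (Suc (i + (?s + l))) w) / of_nat N"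
      unfolding X_def by (rule block_hankel_gram_entry[OF ij])
    also have "\<dots> = (\<Sum>l<L. seq.h N 1 (i + (?s + l)) (j + (?s + l)) w)"
      unfolding sum_divide_distrib inner[OF N w] ..
    also have "\<dots> = (\<Sum>l\<in>set (window L f). seq.h N 1 (i + l) (j + l) w)"
      by (rule sum.reindex_bij_witness[where i = "\<lambda>l. l - ?s" and j = "\<lambda>l. ?s + l"])
        (auto simp: window_def)
    also have "\<dots> = (\<Sum>l\<leftarrow>window L f. seq.h N 1 (i + l) (j + l) w)"
      by (simp add: sum_list_distinct_conv_sum_set window_def)
    finally show "X f N w $$ (i, j) = (\<Sum>l\<leftarrow>window L f. seq.h N 1 (i + l) (j + l) w)" .
  qed
  then show ?thesis
    unfolding X_def[abs_def] assms(16,17) W_past_def W_future_def by simp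
qed

end
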